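(* Let $\alpha>0$, $\gamma>0$. Let $\kappa$ be a fragmentation kernel for which there exists an interval $I\subset(0,\infty)$ such that $\kappa$ and the function $x\mapsto s^{-1}x^s\kappa(x)$ are absolutely continuous functions of $x\in[0,1]$ for all $s\in S_I=\{s\in\mathbb C:\ \Re e(s)\in I\}$. Let the initial datum be a non-negative function $\mu_0\equiv u_0$ with $\operatorname{supp}(u_0)\subset[0,L]$ and $u_0\in\mathcal C^3([0,L])$, such that either $u_0(L)>0$, or $u_0(L)=0$ and $u_0'(L)<0$. Let $R(s,t,\Delta\tau)=K(s)-K^{est}(s,t,\Delta\tau)$ be the error term (defined in the context). Then the following holds. (i) For all $T>0$, $\tau_0>0$ and $V>0$ sufficiently large, there exists a constant $C>0$ depending on $\alpha,\gamma,V,I,T,\tau_0$ and $L$ such that for all $t\in(0,T)$ and all $\Delta\tau\in(0,\tau_0)$, $$|R(s,t,\Delta\tau)|\le\frac{C\alpha\Delta\tau}{|s|}\qquad\forall s\in D_{I,V}=\{s\in\mathbb C:\ \Re e(s)\in I,\ |\Im m(s)|>V\}.$$ (ii) For all $T>0$, all $\tau_0>0$ and all $s\in\mathbb R$ with $s>1$, there exists a constant $C=C(T,s,\tau_0)>0$ such that $$|R(s,t,\Delta\tau)|\le C\alpha\Delta\tau\qquad\forall t\in(0,T),\ \forall\Delta\tau\in(0,\tau_0).$$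
   Context: $\mathbb R^+=[0,\infty)$. $\mathcal M(\mathbb R^+)$ is the space of (finite, signed) Radon measures supported in $\mathbb R^+$ with the total variation norm; $\mathcal M^+(\mathbb R^+)$ is the subset of non-negative measures. Fragmentation kernel: $\kappa\in\mathcal M^+(\mathbb R^+)$ with no atom at $0$ nor at $1$, $\operatorname{supp}(\kappa)\subset[0,1]$, $\int_0^1 d\kappa(z)=N<+\infty$, $\int_0^1 z\,d\kappa(z)=1$. When $\kappa$ is absolutely continuous, $\kappa$ also denotes its density on $[0,1]$. The initial measure $\mu_0$ has density $u_0$ on $[0,L]$. Fragmentation equation (formally): $\partial_t\mu_t(x)=-\alpha x^\gamma\mu_t(x)+\alpha\int_x^\infty\kappa(x/y)\,y^{\gamma-1}d\mu_t(y)$, $\mu_{t=0}=\mu_0$. A measure-valued solution is a narrowly continuous family $(\mu_t)_{t\ge0}\subset\mathcal M(\mathbb R^+)$ such that, for all $\varphi\in\mathcal C(\mathbb R^+)$ with $x\mapsto\varphi(x)/(1+x)$ bounded and all $t\ge0$, $$\int\varphi\,d\mu_t=\int\varphi\,d\mu_0+\int_0^t ds\int d\mu_s(x)\,\alpha x^\gamma\Big(-\varphi(x)+\int_0^1 d\kappa(z)\varphi(xz)\Big).$$ For compactly supported $\mu_0\in\mathcal M^+(\mathbb R^+)$ there is a unique non-negative such solution in $\mathcal C(\mathbb R^+,(\mathcal M(\mathbb R^+),\|\cdot\|_{TV}))$, denoted $\mu_t$. Mellin transforms: $$U(t,s)=\int_0^{\infty}x^{s-1}d\mu_t(x),\quad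 K(s)=\int_0^\infty z^{s-1}d\kappa(z),\quad W(t,h,s)=\int_0^\infty x^{s-1}e^{-\alpha hx^\gamma}d\mu_t(x)\quad(t\ge0,\ h>0).$$ Approximation formula and error: $$K^{est}(s,t,\Delta\tau)=\frac{U(t+\Delta\tau,s)-W(t,\Delta\tau,s)}{\alpha\Delta\tau\,U(t,s+\gamma)},\qquad R(s,t,\Delta\tau)=K(s)-K^{est}(s,t,\Delta\tau).$$ *)

theory Defs
  imports "HOL-Analysis.Analysis"
begin

definition msupp :: "real measure \<Rightarrow> real set" where
  "msupp M = {x. \<forall>U. open U \<and> x \<in> U \<longrightarrow> emeasure M U > 0}"

text \<open>The cone of non-negative Radon measures supported in the closed half-line. A finite Borel
  measure on the real line is automatically Radon.\<close>

definition nonneg_measure :: "real measure \<Rightarrow> bool" where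
  "nonneg_measure M \<longleftrightarrow> finite_measure M \<and> sets M = sets borel \<and> msupp M \<subseteq> {0..}"

text \<open>Total variation norm of the signed measure \<open>M - N\<close>.\<close>

definition tv_dist :: "real measure \<Rightarrow> real measure \<Rightarrow> ennreal" where
  "tv_dist M N =
     (SUP P \<in> {P. finite P \<and> P \<subseteq> sets borel \<and> disjoint P}.
        ennreal (\<Sum>A\<in>P. \<bar>measure M A - measure N A\<bar>))"

definition tv_continuous :: "(real \<Rightarrow> real measure) \<Rightarrow> bool" where
  "tv_continuous \<mu> \<longleftrightarrow>
     (\<forall>t\<ge>0. ((\<lambda>s. tv_dist (\<mu> s) (\<mu> t)) \<longlongrightarrow> 0) (at t within {0..}))"

definition narrowly_continuous :: "(real \<Rightarrow> real measure) \<Rightarrow> bool" where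
  "narrowly_continuous \<mu> \<longleftrightarrow>
     (\<forall>\<psi>::real \<Rightarrow> real. continuous_on {0..} \<psi> \<and> bounded (\<psi> ` {0..}) \<longrightarrow>
        continuous_on {0..} (\<lambda>t. LINT x:{0..}|\<mu> t. \<psi> x))"

definition abs_continuous_fun_on :: "real set \<Rightarrow> (real \<Rightarrow> 'a::real_normed_vector) \<Rightarrow> bool" where
  "abs_continuous_fun_on S f \<longleftrightarrow>
     (\<forall>\<epsilon>>0. \<exists>\<delta>>0. \<forall>(n::nat) a b.
        (\<forall>i<n. a i \<le> b i \<and> {a i..b i} \<subseteq> S) \<and>
        disjoint_family_on (\<lambda>i. {a i<..<b i}) {..<n} \<and>
        (\<Sum>i<n. b i - a i) < \<delta>
        \<longrightarrow> (\<Sum>i<n. norm (f (b i) - f (a i))) < \<epsilon>)"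

text \<open>Functions of class \<open>C\<^sup>k\<close> on \<open>S\<close>, with one-sided derivatives at boundary points of an interval;
  \<open>D j\<close> is the \<open>j\<close>-th derivative.\<close>

definition Ck_on :: "nat \<Rightarrow> (real \<Rightarrow> real) \<Rightarrow> real set \<Rightarrow> bool" where
  "Ck_on k f S \<longleftrightarrow>
     (\<exists>D :: nat \<Rightarrow> real \<Rightarrow> real.
        (\<forall>x\<in>S. D 0 x = f x) \<and>
        (\<forall>j<k. \<forall>x\<in>S. (D j has_real_derivative D (Suc j) x) (at x within S)) \<and>
        (\<forall>j\<le>k. continuous_on S (D j)))"

text \<open>The total mass \<open>N\<close> of the kernel is finite because \<open>nonneg_measure\<close> requires finiteness.\<close>

definition fragmentation_kernel :: "real measure \<Rightarrow> bool" where
  "fragmentation_kernel \<kappa> \<longleftrightarrow>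
     nonneg_measure \<kappa> \<and> emeasure \<kappa> {0} = 0 \<and> emeasure \<kappa> {1} = 0 \<and>
     msupp \<kappa> \<subseteq> {0..1} \<and> (LINT z:{0..1}|\<kappa>. z) = 1"

text \<open>The density is only constrained on the unit interval; it is extended by zero.\<close>

definition kernel_density :: "real measure \<Rightarrow> (real \<Rightarrow> real) \<Rightarrow> bool" where
  "kernel_density \<kappa> k \<longleftrightarrow>
     (\<forall>z\<in>{0..1}. 0 \<le> k z) \<and> \<kappa> = density lborel (\<lambda>z. ennreal (indicator {0..1} z * k z))"

definition frag_integrand ::
    "real \<Rightarrow> real \<Rightarrow> real measure \<Rightarrow> (real \<Rightarrow> real) \<Rightarrow> real \<Rightarrow> real" where
  "frag_integrand \<alpha> \<gamma> \<kappa> \<phi> x =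
     \<alpha> * x powr \<gamma> * (- \<phi> x + (LINT z:{0..1}|\<kappa>. \<phi> (x * z)))"

text \<open>Non-negative measure-valued solutions, continuous for the total variation norm; the initial
  measure is \<open>\<mu> 0\<close>. The integrability conditions say that every integral in the weak formulation
  exists, since the Bochner integral of a non-integrable function is \<open>0\<close> by convention.\<close>

definition frag_solution ::
    "real \<Rightarrow> real \<Rightarrow> real measure \<Rightarrow> (real \<Rightarrow> real measure) \<Rightarrow> bool" where
  "frag_solution \<alpha> \<gamma> \<kappa> \<mu> \<longleftrightarrow>
     (\<forall>t\<ge>0. nonneg_measure (\<mu> t)) \<and> narrowly_continuous \<mu> \<and> tv_continuous \<mu> \<and>
     (\<forall>\<phi>::real \<Rightarrow> real.
        continuous_on {0..} \<phi> \<and> bounded ((\<lambda>x. \<phi> x / (1 + x)) ` {0..}) \<longrightarrow>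
        (\<forall>t\<ge>0.
           set_integrable (\<mu> t) {0..} \<phi> \<and>
           set_integrable (\<mu> t) {0..} (frag_integrand \<alpha> \<gamma> \<kappa> \<phi>) \<and>
           set_integrable lborel {0..t} (\<lambda>s. LINT x:{0..}|\<mu> s. frag_integrand \<alpha> \<gamma> \<kappa> \<phi> x) \<and>
           (LINT x:{0..}|\<mu> t. \<phi> x) =
             (LINT x:{0..}|\<mu> 0. \<phi> x) +
             (LINT s:{0..t}|lborel. (LINT x:{0..}|\<mu> s. frag_integrand \<alpha> \<gamma> \<kappa> \<phi> x))))"

text \<open>At \<open>x = 0\<close> the library sets \<open>0 powr w = 0\<close> for every complex \<open>w\<close>, so an atom at \<open>0\<close> would not
  contribute to the transforms below.\<close>

definition mellin :: "real measure \<Rightarrow> complex \<Rightarrow> complex" where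
  "mellin M s = (LINT x:{0..}|M. complex_of_real x powr (s - 1))"

definition U_transform :: "(real \<Rightarrow> real measure) \<Rightarrow> real \<Rightarrow> complex \<Rightarrow> complex" where
  "U_transform \<mu> t s = mellin (\<mu> t) s"

definition K_transform :: "real measure \<Rightarrow> complex \<Rightarrow> complex" where
  "K_transform \<kappa> s = mellin \<kappa> s"

definition W_transform ::
    "real \<Rightarrow> real \<Rightarrow> (real \<Rightarrow> real measure) \<Rightarrow> real \<Rightarrow> real \<Rightarrow> complex \<Rightarrow> complex" where
  "W_transform \<alpha> \<gamma> \<mu> t h s =
     (LINT x:{0..}|\<mu> t.
        complex_of_real x powr (s - 1) * complex_of_real (exp (- \<alpha> * h * x powr \<gamma>)))"

definition K_est ::
    "real \<Rightarrow> real \<Rightarrow> (real \<Rightarrow> real measure) \<Rightarrow> complex \<Rightarrow> real \<Rightarrow> real \<Rightarrow> complex" where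
  "K_est \<alpha> \<gamma> \<mu> s t \<Delta>\<tau> =
     (U_transform \<mu> (t + \<Delta>\<tau>) s - W_transform \<alpha> \<gamma> \<mu> t \<Delta>\<tau> s) /
     (complex_of_real (\<alpha> * \<Delta>\<tau>) * U_transform \<mu> t (s + complex_of_real \<gamma>))"

definition R_error ::
    "real \<Rightarrow> real \<Rightarrow> real measure \<Rightarrow> (real \<Rightarrow> real measure) \<Rightarrow> complex \<Rightarrow> real \<Rightarrow> real \<Rightarrow> complex" where
  "R_error \<alpha> \<gamma> \<kappa> \<mu> s t \<Delta>\<tau> = K_transform \<kappa> s - K_est \<alpha> \<gamma> \<mu> s t \<Delta>\<tau>"

definition S_strip :: "real set \<Rightarrow> complex set" where
  "S_strip I = {s. Re s \<in> I}"

definition D_strip :: "real set \<Rightarrow> real \<Rightarrow> complex set" where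
  "D_strip I V = {s. Re s \<in> I \<and> \<bar>Im s\<bar> > V}"

end

theory Submission
  imports Defs
begin

text \<open>Write \<open>U(t,s)\<close>, \<open>K(s)\<close> and \<open>W(t,h,s)\<close> for the Mellin transforms of the solution, of the
kernel and of the solution damped by \<open>exp(-\<alpha> h x\<^sup>\<gamma>)\<close>. Testing the equation against \<open>x\<^sup>s\<^sup>-\<^sup>1\<close> turns it
into \<open>\<partial>\<^sub>t U(t,s) = \<alpha> (K(s) - 1) U(t,s+\<gamma>)\<close>, so every time derivative of \<open>U\<close> is known in terms of
\<open>U\<close> at shifted arguments. Since the solution stays supported in \<open>[0,L]\<close>, the Taylor series converges:
with \<open>P\<^sub>n(s)\<close> the product of \<open>K(s+j\<gamma>) - 1\<close> over \<open>j < n\<close>,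

  \<open>U(t+h,s) = \<Sum>\<^sub>n (\<alpha>h)\<^sup>n/n! P\<^sub>n(s) U(t,s+n\<gamma>)\<close> and \<open>W(t,h,s) = \<Sum>\<^sub>n (-\<alpha>h)\<^sup>n/n! U(t,s+n\<gamma>)\<close>.

In the difference the terms \<open>n = 0\<close> cancel and the terms \<open>n = 1\<close> give exactly \<open>\<alpha> h K(s) U(t,s+\<gamma>)\<close>.
Hence \<open>R\<close> is, up to sign, the sum over \<open>n \<ge> 2\<close> divided by \<open>\<alpha> h U(t,s+\<gamma>)\<close>, which is of order \<open>\<alpha>h\<close>
(\<open>R_error_bound\<close>). Two estimates make this quantitative.

The factor \<open>P\<^sub>n(s) - (-1)\<^sup>n\<close> vanishes when all \<open>K(s+j\<gamma>)\<close> do, so it is at most \<open>n\<close> times an exponential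
times the largest \<open>|K(s+j\<gamma>)|\<close>, and absolute continuity of the kernel density gives \<open>K(s) = O(1/|s|)\<close>
for \<open>Re s > 0\<close> (\<open>K_transform_decay\<close>). This is the source of the factor \<open>1/|s|\<close> in the estimate on vertical strips.

The ratio \<open>|U(t,s+n\<gamma>)| / |U(t,s+\<gamma>)|\<close> must grow at most like \<open>L\<close> to the power \<open>(n-1)\<gamma>\<close>. For real \<open>s\<close>
this is positivity together with \<open>x \<le> L\<close>. For complex \<open>s\<close> oscillation could make the denominator
small, and here the shape of \<open>u\<^sub>0\<close> at \<open>L\<close> enters: integration by parts gives
\<open>U(0,s) = c L\<^sup>s/s\<^sup>p (1 + O(1/|s|))\<close> with \<open>p = 1\<close>, \<open>c = u\<^sub>0(L)\<close> if \<open>u\<^sub>0(L) > 0\<close>, and \<open>p = 2\<close>,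
\<open>c = - L u\<^sub>0'(L)\<close> otherwise. As \<open>P\<^sub>n(s)\<close> is close to \<open>(-1)\<^sup>n\<close>, the series at \<open>t = 0\<close> shows that
\<open>U(t,s)\<close> has the same size up to the factor \<open>exp(-\<alpha> t L\<^sup>\<gamma>)\<close>, uniformly for \<open>Re s > 0\<close>, \<open>|s|\<close> large
and \<open>t\<close> bounded (\<open>transform_asymptotics\<close>).

The analytic work lies in the evolution equation. For \<open>0 < Re s < 1\<close> the function \<open>x\<^sup>s\<^sup>-\<^sup>1\<close> is singular at
\<open>0\<close> and is not an admissible test function; it is replaced by truncations whose moments obey a Gronwall
inequality uniform in the truncation (\<open>moment_bound\<close>), after which dominated convergence applies.\<close>

section \<open>Complex powers of a positive variable\<close>

lemma continuous_on_cpowr: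
  assumes "0 < Re s"
  shows "continuous_on {0..} (\<lambda>x::real. complex_of_real x powr s)"
  by (rule continuous_on_powr_complex) (use assms in \<open>auto intro!: continuous_intros simp: complex_nonpos_Reals_iff complex_eq_iff\<close>)

lemma cmod_cpowr: "0 \<le> x \<Longrightarrow> cmod (complex_of_real x powr s) = x powr Re s"
  by (cases "x = 0") (auto simp: norm_powr_real_powr)

lemma cpowr_mult_of_real:
  assumes "0 \<le> x" "0 \<le> y"
  shows "complex_of_real (x * y) powr s = complex_of_real x powr s * complex_of_real y powr s"
  using assms powr_times_real[of "complex_of_real x" "complex_of_real y" s] by simp

lemma cpowr_has_vector_derivative:
  assumes "0 < x"
  shows "((\<lambda>x. complex_of_real x powr s) has_vector_derivative s * complex_of_real x powr (s - 1)) (at x within A)"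
proof -
  have "((\<lambda>z. z powr s) has_field_derivative s * complex_of_real x powr (s - 1)) (at (complex_of_real x))"
    by (rule has_field_derivative_powr) (use assms in \<open>simp add: complex_nonpos_Reals_iff\<close>)
  from has_vector_derivative_real_field[OF this]
  show ?thesis
    by (rule has_vector_derivative_at_within)
qed

text \<open>The power is singular at \<open>0\<close> but its primitive is continuous there because \<open>Re s > 0\<close>, so the
fundamental theorem applies with differentiability in the interior only.\<close>

lemma cpowr_parts_has_integral:
  fixes f f' :: "real \<Rightarrow> complex"
  assumes s: "0 < Re s" and ab: "0 \<le> a" "a \<le> b"
    and f: "\<And>x. x \<in> {a..b} \<Longrightarrow> (f has_vector_derivative f' x) (at x within {a..b})"
  shows "((\<lambda>x. complex_of_real x powr (s - 1) * f x + complex_of_real x powr s / s * f' x) has_integral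
           (complex_of_real b powr s / s * f b - complex_of_real a powr s / s * f a)) {a..b}"
proof (rule fundamental_theorem_of_calculus_interior[OF ab(2)])
  have s0: "s \<noteq> 0" using s by auto
  have "continuous_on {a..b} f"
    using has_vector_derivative_continuous[OF f] continuous_on_eq_continuous_within by blast
  moreover have "continuous_on {a..b} (\<lambda>x::real. complex_of_real x powr s)"
    using continuous_on_cpowr[OF s] by (rule continuous_on_subset) (use ab in simp)
  ultimately show "continuous_on {a..b} (\<lambda>x. complex_of_real x powr s / s * f x)"
    using s0 by (intro continuous_on_mult continuous_on_divide continuous_on_const) simp_all
  fix x assume x: "x \<in> {a<..<b}"
  then have "0 < x" using ab by simp
  have f1: "(f has_vector_derivative f' x) (at x)" using f[of x] x by (simp add: at_within_Icc_at)
  have "((\<lambda>x. complex_of_real x powr s * f x) has_vector_derivative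
       complex_of_real x powr s * f' x + s * complex_of_real x powr (s - 1) * f x) (at x)"
    by (rule has_vector_derivative_mult[OF cpowr_has_vector_derivative[OF \<open>0 < x\<close>] f1])
  then have "((\<lambda>x. complex_of_real x powr s * f x / s) has_vector_derivative
       (complex_of_real x powr s * f' x + s * complex_of_real x powr (s - 1) * f x) / s) (at x)"
    by (rule has_vector_derivative_divide)
  then show "((\<lambda>x. complex_of_real x powr s / s * f x) has_vector_derivative
         complex_of_real x powr (s - 1) * f x + complex_of_real x powr s / s * f' x) (at x)"
    using s0 by (simp add: add_divide_distrib add.commute)
qed

lemma cpowr_has_integral:
  assumes "0 < Re s" "0 \<le> a" "a \<le> b"
  shows "((\<lambda>x. complex_of_real x powr (s - 1)) has_integral
           (complex_of_real b powr s - complex_of_real a powr s) / s) {a..b}"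
  using cpowr_parts_has_integral[OF assms has_vector_derivative_const, of 1]
  by (simp add: diff_divide_distrib)

lemma powr_has_integral:
  assumes "0 < \<sigma>" "0 \<le> a" "a \<le> (b::real)"
  shows "((\<lambda>x. x powr (\<sigma> - 1)) has_integral (b powr \<sigma> - a powr \<sigma>) / \<sigma>) {a..b}"
proof -
  have "((\<lambda>x. Re (complex_of_real x powr (complex_of_real \<sigma> - 1))) has_integral
        Re ((complex_of_real b powr \<sigma> - complex_of_real a powr \<sigma>) / \<sigma>)) {a..b}"
    using cpowr_has_integral[of "complex_of_real \<sigma>" a b] assms by (intro has_integral_Re) auto
  moreover have "Re (complex_of_real x powr (complex_of_real \<sigma> - 1)) = x powr (\<sigma> - 1)" if "x \<in> {a..b}" for x
    using that assms powr_of_real[of x "\<sigma> - 1"] by simp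
  ultimately have "((\<lambda>x. x powr (\<sigma> - 1)) has_integral
        Re ((complex_of_real b powr \<sigma> - complex_of_real a powr \<sigma>) / \<sigma>)) {a..b}"
    by (rule has_integral_eq[rotated])
  moreover have "Re ((complex_of_real b powr \<sigma> - complex_of_real a powr \<sigma>) / \<sigma>) = (b powr \<sigma> - a powr \<sigma>) / \<sigma>"
    using assms by (simp add: powr_of_real)
  ultimately show ?thesis by (simp only:)
qed

lemma set_integrable_powr:
  assumes "0 < \<sigma>"
  shows "set_integrable lborel {0..b} (\<lambda>x::real. x powr (\<sigma> - 1))"
proof (cases "0 \<le> b")
  case True
  have "(\<lambda>x. x powr (\<sigma> - 1)) absolutely_integrable_on {0..b}"
    using powr_has_integral[OF assms, of 0 b] True
    by (intro nonnegative_absolutely_integrable_1) auto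
  moreover have "(\<lambda>x. indicator {0..b} x *\<^sub>R x powr (\<sigma> - 1)) \<in> borel_measurable borel"
    by measurable
  ultimately show ?thesis
    unfolding set_integrable_def by (simp add: integrable_completion)
qed (simp add: set_integrable_def)

text \<open>The principal branch jumps across the negative axis, hence the restriction to the half-line.\<close>

lemma measurable_cpowr_on [measurable]:
  "(\<lambda>x::real. indicator {0..} x *\<^sub>R complex_of_real x powr s) \<in> borel_measurable borel"
proof -
  have "continuous_on {0<..} (\<lambda>x::real. complex_of_real x powr s)"
    by (auto simp: continuous_on_eq_continuous_within
        intro!: has_vector_derivative_continuous[OF cpowr_has_vector_derivative])
  then have "(\<lambda>x::real. indicator {0<..} x *\<^sub>R complex_of_real x powr s) \<in> borel_measurable borel"
    by (intro borel_measurable_continuous_on_indicator) auto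
  moreover have "indicator {0<..} x *\<^sub>R complex_of_real x powr s = indicator {0..} x *\<^sub>R complex_of_real x powr s" for x :: real
    by (auto simp: indicator_def)
  ultimately show ?thesis by simp
qed

lemma set_integrable_cpowr_mult:
  fixes f :: "real \<Rightarrow> complex"
  assumes "0 < Re s" and "continuous_on {0..b} f"
  shows "set_integrable lborel {0..b} (\<lambda>x. complex_of_real x powr (s - 1) * f x)"
proof -
  obtain C where C: "\<And>x. x \<in> {0..b} \<Longrightarrow> cmod (f x) \<le> C"
    using compact_imp_bounded[OF compact_continuous_image[OF assms(2) compact_Icc]]
    unfolding bounded_iff by blast
  have "set_integrable lborel {0..b} (\<lambda>x. C * x powr (Re s - 1))"
    using set_integrable_powr[OF assms(1)] by simp
  moreover have "set_borel_measurable lborel {0..b} (\<lambda>x. complex_of_real x powr (s - 1) * f x)"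
  proof -
    have "(\<lambda>x. indicator {0..b} x *\<^sub>R f x) \<in> borel_measurable borel"
      using assms(2) by (intro borel_measurable_continuous_on_indicator) auto
    then have "(\<lambda>x. (indicator {0..} x *\<^sub>R complex_of_real x powr (s - 1)) * (indicator {0..b} x *\<^sub>R f x)) \<in> borel_measurable borel"
      by (intro borel_measurable_times measurable_cpowr_on)
    also have "(\<lambda>x. (indicator {0..} x *\<^sub>R complex_of_real x powr (s - 1)) * (indicator {0..b} x *\<^sub>R f x))
        = (\<lambda>x. indicator {0..b} x *\<^sub>R (complex_of_real x powr (s - 1) * f x))"
      by (auto simp: indicator_def)
    finally show ?thesis by (simp add: set_borel_measurable_def)
  qed
  ultimately show ?thesis
  proof (rule set_integrable_bound)
    show "AE x in lborel. x \<in> {0..b} \<longrightarrow> norm (complex_of_real x powr (s - 1) * f x) \<le> norm (C * x powr (Re s - 1))"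
    proof (intro AE_I2 impI)
      fix x :: real assume x: "x \<in> {0..b}"
      have "norm (complex_of_real x powr (s - 1) * f x) \<le> x powr (Re s - 1) * C"
        unfolding norm_mult using x C[OF x] by (intro mult_mono) (auto simp: cmod_cpowr)
      then show "norm (complex_of_real x powr (s - 1) * f x) \<le> norm (C * x powr (Re s - 1))"
        by (simp add: abs_mult mult.commute) (smt (verit) mult_right_mono powr_ge_zero)
    qed
  qed
qed

lemma measurable_cpowr_on_Icc:
  "(\<lambda>x::real. indicator {0..b} x *\<^sub>R complex_of_real x powr s) \<in> borel_measurable borel"
proof -
  have "(\<lambda>x::real. indicator {0..b} x *\<^sub>R (indicator {0..} x *\<^sub>R complex_of_real x powr s)) \<in> borel_measurable borel"
    by (intro borel_measurable_scaleR measurable_cpowr_on) simp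
  also have "(\<lambda>x::real. indicator {0..b} x *\<^sub>R (indicator {0..} x *\<^sub>R complex_of_real x powr s))
      = (\<lambda>x. indicator {0..b} x *\<^sub>R complex_of_real x powr s)"
    by (auto simp: indicator_def)
  finally show ?thesis .
qed

lemma cmod_le_cmod_add_of_real:
  assumes "0 \<le> Re s" "0 \<le> a"
  shows "cmod s \<le> cmod (s + complex_of_real a)"
  unfolding cmod_def using assms by (intro real_sqrt_le_mono add_mono) (auto intro: power_mono)

text \<open>Telescoping: each factor \<open>1/(s+a)\<close> differs from \<open>1/s\<close> by \<open>a/((s+a)s)\<close>, and a shift to the
right does not decrease the modulus of \<open>s\<close>.\<close>

lemma cmod_inverse_power_diff_le:
  assumes s: "0 < Re s" and a: "0 \<le> a"
  shows "cmod (1 / (s + complex_of_real a) ^ p - 1 / s ^ p) \<le> real p * a / cmod s ^ (p + 1)"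
proof (induction p)
  case (Suc p)
  let ?w = "s + complex_of_real a"
  have s0: "s \<noteq> 0" "0 < cmod s" using s by auto
  have w0: "?w \<noteq> 0" using s a by (auto simp: complex_eq_iff)
  have sw: "cmod s \<le> cmod ?w" using s a by (intro cmod_le_cmod_add_of_real) auto
  have "1 / ?w - 1 / s = - (complex_of_real a / (?w * s))"
    using s0 w0 by (simp add: field_simps)
  moreover have "1 / ?w ^ Suc p - 1 / s ^ Suc p = 1 / ?w * (1 / ?w ^ p - 1 / s ^ p) + 1 / s ^ p * (1 / ?w - 1 / s)"
    by (simp add: right_diff_distrib mult.commute)
  ultimately have "1 / ?w ^ Suc p - 1 / s ^ Suc p = 1 / ?w * (1 / ?w ^ p - 1 / s ^ p) - complex_of_real a / (?w * s * s ^ p)"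
    by (simp add: mult_ac)
  then have "cmod (1 / ?w ^ Suc p - 1 / s ^ Suc p)
      \<le> cmod (1 / ?w * (1 / ?w ^ p - 1 / s ^ p)) + cmod (complex_of_real a / (?w * s * s ^ p))"
    using norm_triangle_ineq4 by metis
  also have "cmod (1 / ?w * (1 / ?w ^ p - 1 / s ^ p)) \<le> 1 / cmod s * (real p * a / cmod s ^ (p + 1))"
    unfolding norm_mult using Suc s0 sw by (intro mult_mono) (auto simp: norm_divide frac_le)
  also have "cmod (complex_of_real a / (?w * s * s ^ p)) \<le> a / (cmod s * cmod s * cmod s ^ p)"
    using a s0 sw by (auto simp: norm_divide norm_mult norm_power intro!: divide_left_mono mult_right_mono mult_pos_pos)
  finally show ?case
    using s0 by (simp add: field_simps)
qed simp

lemma power_mult_powr: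
  fixes L :: real assumes "0 < L"
  shows "L powr (real n * \<gamma>) = (L powr \<gamma>) ^ n"
  using assms by (simp add: powr_power mult.commute)

section \<open>Decay of the Mellin transform of an absolutely continuous density\<close>

lemma abs_continuous_imp_continuous_on:
  fixes k :: "real \<Rightarrow> 'a::real_normed_vector"
  assumes "abs_continuous_fun_on {a..b} k"
  shows "continuous_on {a..b} k"
  unfolding continuous_on_iff
proof (intro ballI allI impI)
  fix x e :: real assume x: "x \<in> {a..b}" and "0 < e"
  then obtain d where d: "d > 0" and
    *: "\<And>(n::nat) a' b'. (\<forall>i<n. a' i \<le> b' i \<and> {a' i..b' i} \<subseteq> {a..b}) \<Longrightarrow>
        disjoint_family_on (\<lambda>i. {a' i<..<b' i}) {..<n} \<Longrightarrow>
        (\<Sum>i<n. b' i - a' i) < d \<Longrightarrow> (\<Sum>i<n. norm (k (b' i) - k (a' i))) < e"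
    using assms unfolding abs_continuous_fun_on_def by meson
  have one: "norm (k v - k u) < e" if "u \<in> {a..b}" "v \<in> {a..b}" "u \<le> v" "v - u < d" for u v
    using *[of 1 "\<lambda>_. u" "\<lambda>_. v"] that by (auto simp: disjoint_family_on_def)
  have "dist (k y) (k x) < e" if "y \<in> {a..b}" "dist y x < d" for y
    using one[of x y] one[of y x] that x
    by (cases "x \<le> y") (auto simp: dist_norm norm_minus_commute)
  then show "\<exists>d>0. \<forall>x'\<in>{a..b}. dist x' x < d \<longrightarrow> dist (k x') (k x) < e"
    using d by blast
qed

text \<open>Absolute continuity with tolerance \<open>1\<close> bounds the variation over any block of length below \<open>\<delta>\<close> by
\<open>1\<close>. Cutting the unit interval into \<open>M > 1/\<delta>\<close> blocks bounds the total variation by \<open>M\<close>. Only uniform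
partitions that refine the blocks are needed, which keeps the index arithmetic simple.\<close>

lemma abs_continuous_uniform_partition_variation:
  fixes k :: "real \<Rightarrow> 'a::real_normed_vector"
  assumes "abs_continuous_fun_on {0..1} k"
  obtains M :: nat where "M > 0" and
    "\<And>m. m > 0 \<Longrightarrow> (\<Sum>i<M * m. norm (k (real (Suc i) / real (M * m)) - k (real i / real (M * m)))) \<le> real M"
proof -
  obtain d where d: "d > 0" and
    *: "\<And>(n::nat) a' b'. (\<forall>i<n. a' i \<le> b' i \<and> {a' i..b' i} \<subseteq> {0..1}) \<Longrightarrow>
        disjoint_family_on (\<lambda>i. {a' i<..<b' i}) {..<n} \<Longrightarrow>
        (\<Sum>i<n. b' i - a' i) < d \<Longrightarrow> (\<Sum>i<n. norm (k (b' i) - k (a' i))) < 1"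
    using assms unfolding abs_continuous_fun_on_def by (meson zero_less_one)
  obtain M0 :: nat where M0: "inverse (real (Suc M0)) < d"
    using reals_Archimedean[OF d] by blast
  define M where "M = Suc M0"
  have M: "M > 0" "1 / real M < d" using M0 by (auto simp: M_def divide_inverse)
  show ?thesis
  proof
    fix m :: nat assume m: "m > 0"
    define z where "z i = real i / real (M * m)" for i
    have zle: "z i \<le> z j \<longleftrightarrow> i \<le> j" for i j
    proof -
      have "0 < real (M * m)" using M m by simp
      then show ?thesis by (simp add: z_def divide_le_cancel del: of_nat_mult)
    qed
    \<comment> \<open>A block consists of \<open>m\<close> consecutive cells and has length \<open>1/M\<close>.\<close>
    let ?f = "\<lambda>i. norm (k (z (Suc i)) - k (z i))"
    have block: "sum ?f {b * m..<b * m + m} \<le> 1" if b: "b < M" for b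
    proof -
      have "(\<Sum>i<m. norm (k (z (Suc (b * m + i))) - k (z (b * m + i)))) < 1"
      proof (rule *)
        show "\<forall>i<m. z (b * m + i) \<le> z (Suc (b * m + i)) \<and> {z (b * m + i)..z (Suc (b * m + i))} \<subseteq> {0..1}"
        proof (intro allI impI conjI)
          fix i assume i: "i < m"
          show "z (b * m + i) \<le> z (Suc (b * m + i))" by (simp add: zle)
          have "Suc b * m \<le> M * m" using b by (intro mult_right_mono) auto
          then have "Suc (b * m + i) \<le> M * m" using i by simp
          then have "z (Suc (b * m + i)) \<le> z (M * m)" by (simp only: zle)
          moreover have "z (M * m) = 1" using M m by (simp add: z_def)
          moreover have "0 \<le> z (b * m + i)" by (simp add: z_def)
          ultimately show "{z (b * m + i)..z (Suc (b * m + i))} \<subseteq> {0..1}" by auto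
        qed
        show "disjoint_family_on (\<lambda>i. {z (b * m + i)<..<z (Suc (b * m + i))}) {..<m}"
          unfolding disjoint_family_on_def
        proof (intro ballI impI)
          fix i j assume "i \<in> {..<m}" "j \<in> {..<m}" "i \<noteq> j"
          then have "z (Suc (b * m + i)) \<le> z (b * m + j) \<or> z (Suc (b * m + j)) \<le> z (b * m + i)"
            unfolding zle by linarith
          then show "{z (b * m + i)<..<z (Suc (b * m + i))} \<inter> {z (b * m + j)<..<z (Suc (b * m + j))} = {}"
            by auto
        qed
        have "(\<Sum>i<m. z (Suc (b * m + i)) - z (b * m + i)) = real m * (1 / real (M * m))"
          by (simp add: z_def diff_divide_distrib[symmetric])
        also have "\<dots> < d" using M m by simp
        finally show "(\<Sum>i<m. z (Suc (b * m + i)) - z (b * m + i)) < d" .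
      qed
      then show ?thesis
        using sum.shift_bounds_nat_ivl[of ?f 0 "b * m" m]
        by (simp add: atLeast0LessThan add.commute)
    qed
    have "(\<Sum>i<M * m. ?f i) = (\<Sum>b<M. sum ?f {b * m..<b * m + m})"
      by (rule sum.nat_group[symmetric])
    also have "\<dots> \<le> (\<Sum>b<M. 1)" using block by (intro sum_mono) auto
    finally show "(\<Sum>i<M * m. norm (k (real (Suc i) / real (M * m)) - k (real i / real (M * m)))) \<le> real M"
      by (simp add: z_def)
  qed (rule M)
qed

lemma sum_mult_diff_by_parts:
  fixes k w :: "nat \<Rightarrow> 'a::comm_ring"
  assumes "w 0 = 0"
  shows "(\<Sum>i<n. k (Suc i) * (w (Suc i) - w i)) = k n * w n - (\<Sum>i<n. (k (Suc i) - k i) * w i)"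
  using assms by (induction n) (auto simp: algebra_simps)

text \<open>Freezing \<open>k\<close> at the right end of each cell leaves an integrand with the explicit primitive \<open>x\<^sup>s/s\<close>.
The error on a cell is the oscillation \<open>\<epsilon>\<close> times the integral of \<open>x\<close> to the power \<open>Re s - 1\<close>, and these integrals telescope.\<close>

lemma mellin_integral_Riemann_sum:
  fixes k :: "real \<Rightarrow> complex"
  assumes s: "0 < Re s" and k: "continuous_on {0..1} k" and n: "n > 0"
    and osc: "\<And>x y. x \<in> {0..1} \<Longrightarrow> y \<in> {0..1} \<Longrightarrow> \<bar>x - y\<bar> \<le> 1 / real n \<Longrightarrow> cmod (k x - k y) \<le> \<epsilon>"
    and j: "j \<le> n"
  defines "z \<equiv> \<lambda>i. real i / real n"
  defines "w \<equiv> \<lambda>i. complex_of_real (z i) powr s"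
  shows "cmod (integral {0..z j} (\<lambda>x. complex_of_real x powr (s - 1) * k x)
            - (\<Sum>i<j. k (z (Suc i)) * (w (Suc i) - w i)) / s) \<le> \<epsilon> * z j powr Re s / Re s"
  using j
proof (induction j)
  case 0
  then show ?case using s by (simp add: z_def)
next
  case (Suc j)
  let ?F = "\<lambda>x. complex_of_real x powr (s - 1) * k x"
  let ?I = "{z j..z (Suc j)}"
  have zz: "0 \<le> z j" "z j \<le> z (Suc j)" "z (Suc j) \<le> 1" "z (Suc j) - z j = 1 / real n"
    using n Suc.prems by (auto simp: z_def divide_right_mono diff_divide_distrib[symmetric])
  have int1: "?F integrable_on {0..1}"
    using set_integrable_cpowr_mult[OF s k] by (rule set_borel_integral_eq_integral)
  have int: "?F integrable_on {a..b}" if "0 \<le> a" "b \<le> 1" for a b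
    using int1 by (rule integrable_on_subinterval) (use that in auto)
  have P: "((\<lambda>x. complex_of_real x powr (s - 1) * k (z (Suc j))) has_integral
        (w (Suc j) - w j) / s * k (z (Suc j))) ?I"
    unfolding w_def by (intro has_integral_mult_left cpowr_has_integral s zz)
  have Q: "((\<lambda>x. \<epsilon> * x powr (Re s - 1)) has_integral
        \<epsilon> * ((z (Suc j) powr Re s - z j powr Re s) / Re s)) ?I"
    by (intro has_integral_mult_right powr_has_integral s zz)
  have "(\<lambda>x. ?F x - complex_of_real x powr (s - 1) * k (z (Suc j))) integrable_on ?I"
    using zz by (intro integrable_diff int has_integral_integrable[OF P]) auto
  moreover have "cmod (?F x - complex_of_real x powr (s - 1) * k (z (Suc j))) \<le> \<epsilon> * x powr (Re s - 1)"
    if x: "x \<in> ?I" for x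
  proof -
    have "cmod (k x - k (z (Suc j))) \<le> \<epsilon>"
      using x zz by (intro osc) auto
    then have "cmod (complex_of_real x powr (s - 1) * (k x - k (z (Suc j)))) \<le> \<epsilon> * x powr (Re s - 1)"
      using x zz by (simp add: norm_mult cmod_cpowr mult.commute[of "x powr _"] mult_right_mono)
    then show ?thesis
      by (simp add: right_diff_distrib)
  qed
  ultimately have "cmod (integral ?I (\<lambda>x. ?F x - complex_of_real x powr (s - 1) * k (z (Suc j))))
      \<le> integral ?I (\<lambda>x. \<epsilon> * x powr (Re s - 1))"
    by (intro integral_norm_bound_integral has_integral_integrable[OF Q]) auto
  also have "integral ?I (\<lambda>x. ?F x - complex_of_real x powr (s - 1) * k (z (Suc j)))
      = integral ?I ?F - (w (Suc j) - w j) / s * k (z (Suc j))"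
    using zz integral_unique[OF P]
    by (subst integral_diff) (auto intro!: int has_integral_integrable[OF P])
  finally have "cmod (integral ?I ?F - (w (Suc j) - w j) / s * k (z (Suc j)))
      \<le> \<epsilon> * z (Suc j) powr Re s / Re s - \<epsilon> * z j powr Re s / Re s"
    using integral_unique[OF Q] by (simp add: diff_divide_distrib right_diff_distrib)
  moreover have "integral {0..z (Suc j)} ?F = integral {0..z j} ?F + integral ?I ?F"
    using zz by (intro Henstock_Kurzweil_Integration.integral_combine[symmetric] int) auto
  moreover have "cmod (integral {0..z j} ?F - (\<Sum>i<j. k (z (Suc i)) * (w (Suc i) - w i)) / s)
      \<le> \<epsilon> * z j powr Re s / Re s"
    using Suc by simp
  moreover have "(\<Sum>i<Suc j. k (z (Suc i)) * (w (Suc i) - w i)) / s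
      = (\<Sum>i<j. k (z (Suc i)) * (w (Suc i) - w i)) / s + (w (Suc j) - w j) / s * k (z (Suc j))"
    by (simp add: add_divide_distrib)
  ultimately show ?case
    using norm_triangle_ineq[of "integral {0..z j} ?F - (\<Sum>i<j. k (z (Suc i)) * (w (Suc i) - w i)) / s"
        "integral ?I ?F - (w (Suc j) - w j) / s * k (z (Suc j))"]
    by (simp only: add_diff_add)
qed

text \<open>This is integration by parts carried out on Riemann sums, so that no derivative of \<open>k\<close> has to
be constructed: after Abel summation the differences of \<open>k\<close> are multiplied by values \<open>x\<^sup>s\<close> of modulus
at most \<open>1\<close>, and the variation of \<open>k\<close> bounds the sum. The constant does not depend on \<open>Re s\<close>.\<close>

lemma mellin_abs_continuous_decay:
  fixes k :: "real \<Rightarrow> complex"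
  assumes ac: "abs_continuous_fun_on {0..1} k"
  obtains C where "C > 0" and
    "\<And>s. 0 < Re s \<Longrightarrow> cmod (integral {0..1} (\<lambda>x. complex_of_real x powr (s - 1) * k x)) \<le> C / cmod s"
proof -
  have cont: "continuous_on {0..1} k" using ac by (rule abs_continuous_imp_continuous_on)
  obtain M where M: "M > 0" and var:
    "\<And>m. m > 0 \<Longrightarrow> (\<Sum>i<M * m. cmod (k (real (Suc i) / real (M * m)) - k (real i / real (M * m)))) \<le> real M"
    using abs_continuous_uniform_partition_variation[OF ac] by blast
  show ?thesis
  proof
    show "cmod (k 1) + real M > 0" using M by (simp add: add_nonneg_pos)
    fix s assume s: "0 < Re s"
    let ?J = "integral {0..1} (\<lambda>x. complex_of_real x powr (s - 1) * k x)"
    have s0: "cmod s > 0" using s by auto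
    have "cmod ?J \<le> (cmod (k 1) + real M) / cmod s + e" if e: "e > 0" for e
    proof -
      have eps: "e * Re s > 0" using e s by simp
      have "uniformly_continuous_on {0..1} k"
        using cont by (rule compact_uniformly_continuous) simp
      then obtain d where d: "d > 0" and
        unif: "\<And>x y. x \<in> {0..1} \<Longrightarrow> y \<in> {0..1} \<Longrightarrow> \<bar>x - y\<bar> < d \<Longrightarrow> cmod (k x - k y) < e * Re s"
        using eps unfolding uniformly_continuous_on_def by (metis dist_norm norm_minus_commute real_norm_def)
      obtain m0 :: nat where m0: "inverse (real (Suc m0)) < d"
        using reals_Archimedean[OF d] by blast
      define n where "n = M * Suc m0"
      have n: "n > 0" using M by (simp add: n_def)
      have "Suc m0 \<le> n" using M unfolding n_def by (cases M) simp_all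
      then have "1 / real n \<le> inverse (real (Suc m0))"
        unfolding inverse_eq_divide by (intro divide_left_mono) auto
      then have nd: "1 / real n < d" using m0 by linarith
      define z where "z i = real i / real n" for i
      define w where "w i = complex_of_real (z i) powr s" for i
      have "cmod (integral {0..z n} (\<lambda>x. complex_of_real x powr (s - 1) * k x)
            - (\<Sum>i<n. k (z (Suc i)) * (w (Suc i) - w i)) / s) \<le> (e * Re s) * z n powr Re s / Re s"
        unfolding z_def w_def
        by (rule mellin_integral_Riemann_sum[OF s cont n]) (use unif nd in \<open>force simp: less_imp_le\<close>)+
      moreover have zn: "z n = 1" using n by (simp add: z_def)
      ultimately have A: "cmod (?J - (\<Sum>i<n. k (z (Suc i)) * (w (Suc i) - w i)) / s) \<le> e"
        using s by simp
      have "(\<Sum>i<n. k (z (Suc i)) * (w (Suc i) - w i)) = k (z n) * w n - (\<Sum>i<n. (k (z (Suc i)) - k (z i)) * w i)"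
        by (rule sum_mult_diff_by_parts) (use s in \<open>simp add: w_def z_def\<close>)
      also have "cmod \<dots> \<le> cmod (k (z n) * w n) + cmod (\<Sum>i<n. (k (z (Suc i)) - k (z i)) * w i)"
        by (rule norm_triangle_ineq4)
      also have "cmod (k (z n) * w n) = cmod (k 1)"
        by (simp add: zn w_def)
      also have "cmod (\<Sum>i<n. (k (z (Suc i)) - k (z i)) * w i) \<le> (\<Sum>i<n. cmod (k (z (Suc i)) - k (z i)))"
      proof (rule sum_norm_le)
        fix i assume i: "i \<in> {..<n}"
        have "0 \<le> z i" "z i \<le> 1" using i n by (auto simp: z_def)
        then have "cmod (w i) \<le> 1"
          using s by (simp add: w_def cmod_cpowr powr_le1)
        then show "cmod ((k (z (Suc i)) - k (z i)) * w i) \<le> cmod (k (z (Suc i)) - k (z i))"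
          by (simp add: norm_mult mult_left_le)
      qed
      also have "\<dots> \<le> real M"
        using var[of "Suc m0"] unfolding z_def n_def by simp
      finally have B: "cmod ((\<Sum>i<n. k (z (Suc i)) * (w (Suc i) - w i)) / s) \<le> (cmod (k 1) + real M) / cmod s"
        unfolding norm_divide using s0 by (intro divide_right_mono) auto
      show ?thesis
        using A B norm_triangle_ineq2[of ?J "(\<Sum>i<n. k (z (Suc i)) * (w (Suc i) - w i)) / s"] by linarith
    qed
    then show "cmod ?J \<le> (cmod (k 1) + real M) / cmod s"
      by (rule field_le_epsilon)
  qed
qed

text \<open>Stated for every \<open>S\<close> containing the unit interval, because \<open>mellin\<close> integrates over the half-line whereas the
weak formulation integrates over the unit interval.\<close>

lemma kernel_density_integral:
  fixes f :: "real \<Rightarrow> complex"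
  assumes kd: "kernel_density \<kappa> k" and k: "continuous_on {0..1} k"
    and S: "{0..1} \<subseteq> S" and f: "(\<lambda>z. indicator S z *\<^sub>R f z) \<in> borel_measurable borel"
  shows "set_integrable \<kappa> S f \<longleftrightarrow> set_integrable lborel {0..1} (\<lambda>z. f z * complex_of_real (k z))"
    and "(LINT z:S|\<kappa>. f z) = (LINT z:{0..1}|lborel. f z * complex_of_real (k z))"
proof -
  let ?d = "\<lambda>z. indicator {0..1} z * k z"
  have \<kappa>: "\<kappa> = density lborel (\<lambda>z. ennreal (?d z))" and k0: "\<And>z. z \<in> {0..1} \<Longrightarrow> 0 \<le> k z"
    using kd by (auto simp: kernel_density_def)
  have d: "?d \<in> borel_measurable lborel"
    using borel_measurable_continuous_on_indicator[OF _ k] by simp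
  have d0: "AE z in lborel. 0 \<le> ?d z" using k0 by (auto simp: indicator_def)
  have f': "(\<lambda>z. indicator S z *\<^sub>R f z) \<in> borel_measurable lborel" using f by simp
  have eq: "?d z *\<^sub>R (indicator S z *\<^sub>R f z) = indicator {0..1} z *\<^sub>R (f z * complex_of_real (k z))" for z
    using S by (auto simp: indicator_def scaleR_conv_of_real)
  show "set_integrable \<kappa> S f \<longleftrightarrow> set_integrable lborel {0..1} (\<lambda>z. f z * complex_of_real (k z))"
    unfolding set_integrable_def \<kappa> integrable_density[OF f' d d0] eq ..
  show "(LINT z:S|\<kappa>. f z) = (LINT z:{0..1}|lborel. f z * complex_of_real (k z))"
    unfolding set_lebesgue_integral_def \<kappa> integral_density[OF f' d d0] eq ..
qed

lemma K_transform_density: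
  assumes kd: "kernel_density \<kappa> k" and k: "continuous_on {0..1} k" and s: "0 < Re s"
  shows "set_integrable \<kappa> {0..1} (\<lambda>z. complex_of_real z powr (s - 1))"
    and "K_transform \<kappa> s = (LINT z:{0..1}|\<kappa>. complex_of_real z powr (s - 1))"
    and "K_transform \<kappa> s = integral {0..1} (\<lambda>z. complex_of_real z powr (s - 1) * complex_of_real (k z))"
proof -
  note ib = kernel_density_integral[OF kd k subset_refl measurable_cpowr_on_Icc[of 1 "s - 1"]]
  have S: "{0..1::real} \<subseteq> {0..}" by auto
  note ia = kernel_density_integral[OF kd k S measurable_cpowr_on[of "s - 1"]]
  have int: "set_integrable lborel {0..1} (\<lambda>z. complex_of_real z powr (s - 1) * complex_of_real (k z))"
    using k by (intro set_integrable_cpowr_mult s continuous_intros)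
  show "set_integrable \<kappa> {0..1} (\<lambda>z. complex_of_real z powr (s - 1))"
    using int ib(1) by simp
  show "K_transform \<kappa> s = (LINT z:{0..1}|\<kappa>. complex_of_real z powr (s - 1))"
    unfolding K_transform_def mellin_def ia(2) ib(2) ..
  show "K_transform \<kappa> s = integral {0..1} (\<lambda>z. complex_of_real z powr (s - 1) * complex_of_real (k z))"
    unfolding K_transform_def mellin_def ia(2) by (rule set_borel_integral_eq_integral[OF int])
qed

lemma abs_continuous_fun_on_of_real:
  assumes "abs_continuous_fun_on S k"
  shows "abs_continuous_fun_on S (\<lambda>x. complex_of_real (k x))"
  using assms unfolding abs_continuous_fun_on_def by (simp flip: of_real_diff)

lemma K_transform_decay:
  assumes kd: "kernel_density \<kappa> k" and ac: "abs_continuous_fun_on {0..1} k"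
  obtains C where "C > 0" and "\<And>s. 0 < Re s \<Longrightarrow> cmod (K_transform \<kappa> s) \<le> C / cmod s"
proof -
  obtain C where "C > 0" and "\<And>s. 0 < Re s \<Longrightarrow>
      cmod (integral {0..1} (\<lambda>x. complex_of_real x powr (s - 1) * complex_of_real (k x))) \<le> C / cmod s"
    using mellin_abs_continuous_decay[OF abs_continuous_fun_on_of_real[OF ac]] by blast
  then show ?thesis
    using that[of C] K_transform_density(3)[OF kd abs_continuous_imp_continuous_on[OF ac]] by simp
qed

section \<open>The Mellin transform of the initial datum\<close>

lemma initial_measure_density:
  fixes u :: "real \<Rightarrow> real"
  assumes u0: "\<And>x. 0 \<le> u x" and supp: "closure {x. u x \<noteq> 0} \<subseteq> {0..L}" and cont: "continuous_on {0..L} u"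
  defines "M \<equiv> density lborel (\<lambda>x. ennreal (u x))"
  shows "AE x in M. x \<le> L"
    and "0 < Re s \<Longrightarrow> set_integrable M {0..} (\<lambda>x. complex_of_real x powr (s - 1))"
    and "0 < Re s \<Longrightarrow> mellin M s = integral {0..L} (\<lambda>x. complex_of_real x powr (s - 1) * complex_of_real (u x))"
proof -
  have out: "u x = 0" if "x \<notin> {0..L}" for x
    using supp closure_subset[of "{x. u x \<noteq> 0}"] that by auto
  have "(\<lambda>x. indicator {0..L} x *\<^sub>R u x) \<in> borel_measurable lborel"
    using borel_measurable_continuous_on_indicator[OF _ cont] by simp
  moreover have "(\<lambda>x. indicator {0..L} x *\<^sub>R u x) = u" using out by (auto simp: fun_eq_iff indicator_def)
  ultimately have um: "u \<in> borel_measurable lborel" by simp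
  show "AE x in M. x \<le> L"
  proof -
    have "0 < ennreal (u x) \<longrightarrow> x \<le> L" for x
      using out[of x] by (cases "x \<le> L") auto
    then show ?thesis unfolding M_def using um by (subst AE_density) auto
  qed
  assume s: "0 < Re s"
  have f: "(\<lambda>x. indicator {0..} x *\<^sub>R complex_of_real x powr (s - 1)) \<in> borel_measurable lborel"
    using measurable_cpowr_on by simp
  have eq: "u x *\<^sub>R (indicator {0..} x *\<^sub>R complex_of_real x powr (s - 1))
      = indicator {0..L} x *\<^sub>R (complex_of_real x powr (s - 1) * complex_of_real (u x))" for x
    using out[of x] by (auto simp: indicator_def scaleR_conv_of_real)
  have int: "set_integrable lborel {0..L} (\<lambda>x. complex_of_real x powr (s - 1) * complex_of_real (u x))"
    using cont by (intro set_integrable_cpowr_mult s continuous_intros)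
  have u0': "AE x in lborel. 0 \<le> u x" using u0 by simp
  show "set_integrable M {0..} (\<lambda>x. complex_of_real x powr (s - 1))"
    using int unfolding set_integrable_def M_def integrable_density[OF f um u0'] eq .
  have "mellin M s = (LINT x:{0..L}|lborel. complex_of_real x powr (s - 1) * complex_of_real (u x))"
    unfolding mellin_def set_lebesgue_integral_def M_def integral_density[OF f um u0'] eq ..
  then show "mellin M s = integral {0..L} (\<lambda>x. complex_of_real x powr (s - 1) * complex_of_real (u x))"
    using set_borel_integral_eq_integral(2)[OF int] by simp
qed

text \<open>Three integrations by parts. The boundary terms at \<open>0\<close> vanish since \<open>Re s > 0\<close>.\<close>

lemma initial_transform_expansion:
  fixes D :: "nat \<Rightarrow> real \<Rightarrow> real"
  assumes L: "0 < L" and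
    D: "\<And>j x. j < 3 \<Longrightarrow> x \<in> {0..L} \<Longrightarrow> (D j has_real_derivative D (Suc j) x) (at x within {0..L})"
    and D3: "continuous_on {0..L} (D 3)"
  obtains C where "C > 0" and
    "\<And>s. 0 < Re s \<Longrightarrow> cmod (integral {0..L} (\<lambda>x. complex_of_real x powr (s - 1) * complex_of_real (D 0 x))
        - complex_of_real L powr s * complex_of_real (D 0 L) / s
        + complex_of_real L powr s * complex_of_real (L * D 1 L) / (s * (s + 1))
        - complex_of_real L powr s * complex_of_real (L\<^sup>2 * D 2 L) / (s * (s + 1) * (s + 2)))
      \<le> C * L powr Re s / (cmod s * cmod (s + 1) * cmod (s + 2))"
proof -
  let ?J = "\<lambda>j s. integral {0..L} (\<lambda>x. complex_of_real x powr (s - 1) * complex_of_real (D j x))"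
  have Dv: "((\<lambda>x. complex_of_real (D j x)) has_vector_derivative complex_of_real (D (Suc j) x)) (at x within {0..L})"
    if "j < 3" "x \<in> {0..L}" for j x
    using D[OF that] by (intro has_vector_derivative_of_real) (simp add: has_real_derivative_iff_has_vector_derivative)
  have cont: "continuous_on {0..L} (D j)" if "j \<le> 3" for j
  proof (cases "j = 3")
    case False
    then show ?thesis using D[of j] that
      by (intro DERIV_continuous_on) auto
  qed (use D3 in simp)
  have intble: "(\<lambda>x. complex_of_real x powr (s - 1) * complex_of_real (D j x)) integrable_on {0..L}"
    if "0 < Re s" "j \<le> 3" for j s
    using set_integrable_cpowr_mult[OF that(1), of L "\<lambda>x. complex_of_real (D j x)"] cont[OF that(2)]
    by (intro set_borel_integral_eq_integral) (auto intro!: continuous_intros)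
  have parts: "?J j s = complex_of_real L powr s * complex_of_real (D j L) / s - ?J (Suc j) (s + 1) / s"
    if s: "0 < Re s" and j: "j < 3" for j s
  proof -
    have "((\<lambda>x. complex_of_real x powr (s - 1) * complex_of_real (D j x)
          + complex_of_real x powr s / s * complex_of_real (D (Suc j) x)) has_integral
          complex_of_real L powr s / s * complex_of_real (D j L) - complex_of_real 0 powr s / s * complex_of_real (D j 0)) {0..L}"
      using Dv[OF j] L by (intro cpowr_parts_has_integral s) auto
    then have "((\<lambda>x. (complex_of_real x powr (s - 1) * complex_of_real (D j x)
          + complex_of_real x powr s / s * complex_of_real (D (Suc j) x)) - complex_of_real x powr (s - 1) * complex_of_real (D j x)) has_integral
          complex_of_real L powr s / s * complex_of_real (D j L) - ?J j s) {0..L}"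
      using integrable_integral[OF intble[OF s]] j by (intro has_integral_diff) auto
    moreover have "((\<lambda>x. (complex_of_real x powr (s + 1 - 1) * complex_of_real (D (Suc j) x)) / s) has_integral ?J (Suc j) (s + 1) / s) {0..L}"
      using s j by (intro has_integral_divide integrable_integral intble) auto
    ultimately have "complex_of_real L powr s / s * complex_of_real (D j L) - ?J j s = ?J (Suc j) (s + 1) / s"
      by (simp add: has_integral_unique)
    then show ?thesis by (simp add: algebra_simps)
  qed
  obtain B where B: "\<And>x. x \<in> {0..L} \<Longrightarrow> \<bar>D 3 x\<bar> \<le> B"
    using compact_imp_bounded[OF compact_continuous_image[OF D3 compact_Icc]]
    unfolding bounded_iff by (metis imageI real_norm_def)
  have B0: "0 \<le> B" using B[of 0] L by auto
  have J3: "cmod (?J 3 (s + 3)) \<le> (B + 1) * L ^ 3 * L powr Re s" if s: "0 < Re s" for s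
  proof -
    have le: "x powr (Re s + 2) \<le> L powr (Re s + 2)" if "x \<in> {0..L}" for x
      using that s by (intro powr_mono2) auto
    have "cmod (?J 3 (s + 3)) \<le> integral {0..L} (\<lambda>x. L powr (Re s + 2) * B)"
    proof (intro integral_norm_bound_integral intble)
      show "cmod (complex_of_real x powr (s + 3 - 1) * complex_of_real (D 3 x)) \<le> L powr (Re s + 2) * B"
        if "x \<in> {0..L}" for x
        unfolding norm_mult using that B[OF that] le[OF that] by (intro mult_mono) (auto simp: cmod_cpowr add.commute)
    qed (use s in auto)
    also have "\<dots> = B * (L ^ 3 * L powr Re s)"
      using L by (simp add: powr_add power3_eq_cube power2_eq_square)
    also have "\<dots> \<le> (B + 1) * (L ^ 3 * L powr Re s)"
      using L by (intro mult_right_mono) auto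
    finally show ?thesis by (simp add: mult.assoc)
  qed
  show ?thesis
  proof
    show "(B + 1) * L ^ 3 > 0" using B0 L by simp
    fix s assume s: "0 < Re s"
    have nz: "s \<noteq> 0" "s + 1 \<noteq> 0" "s + 2 \<noteq> 0" using s by (auto simp: complex_eq_iff)
    have pw: "complex_of_real L powr (s + 1) = complex_of_real L powr s * complex_of_real L"
      "complex_of_real L powr (s + 2) = complex_of_real L powr s * (complex_of_real L)\<^sup>2"
      using L by (auto simp: powr_add powr_nat)
    have "?J 0 s = complex_of_real L powr s * complex_of_real (D 0 L) / s - ?J 1 (s + 1) / s"
      using parts[of s 0] s by simp
    also have "?J 1 (s + 1) = complex_of_real L powr (s + 1) * complex_of_real (D 1 L) / (s + 1) - ?J 2 (s + 2) / (s + 1)"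
      using parts[of "s + 1" 1] s by (simp add: numeral_2_eq_2 add.assoc)
    also have "?J 2 (s + 2) = complex_of_real L powr (s + 2) * complex_of_real (D 2 L) / (s + 2) - ?J 3 (s + 3) / (s + 2)"
      using parts[of "s + 2" 2] s by (simp add: numeral_3_eq_3 numeral_2_eq_2 add.assoc)
    finally have "?J 0 s
        - complex_of_real L powr s * complex_of_real (D 0 L) / s
        + complex_of_real L powr s * complex_of_real (L * D 1 L) / (s * (s + 1))
        - complex_of_real L powr s * complex_of_real (L\<^sup>2 * D 2 L) / (s * (s + 1) * (s + 2))
        = - (?J 3 (s + 3) / (s * (s + 1) * (s + 2)))"
      unfolding pw using nz by (simp add: diff_divide_distrib power2_eq_square mult_ac)
    then show "cmod (?J 0 s
        - complex_of_real L powr s * complex_of_real (D 0 L) / s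
        + complex_of_real L powr s * complex_of_real (L * D 1 L) / (s * (s + 1))
        - complex_of_real L powr s * complex_of_real (L\<^sup>2 * D 2 L) / (s * (s + 1) * (s + 2)))
      \<le> (B + 1) * L ^ 3 * L powr Re s / (cmod s * cmod (s + 1) * cmod (s + 2))"
      using J3[OF s] by (simp add: norm_divide norm_mult divide_right_mono)
  qed
qed

text \<open>Whichever of the first two boundary terms at \<open>L\<close> is the first not to vanish dominates. In the
second case the exponent is \<open>2\<close>, and replacing \<open>s(s+1)\<close> by \<open>s\<^sup>2\<close> costs one more order in \<open>1/|s|\<close>.\<close>

lemma initial_transform_leading_term:
  fixes u :: "real \<Rightarrow> real"
  assumes L: "0 < L" and u: "Ck_on 3 u {0..L}"
    and edge: "u L > 0 \<or> u L = 0 \<and> (\<exists>d<0. (u has_real_derivative d) (at L within {0..L}))"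
  obtains c :: complex and p :: nat and C where "c \<noteq> 0"
    and "\<And>s. 0 < Re s \<Longrightarrow> cmod (integral {0..L} (\<lambda>x. complex_of_real x powr (s - 1) * complex_of_real (u x))
          - c * complex_of_real L powr s / s ^ p) \<le> C * L powr Re s / cmod s ^ (p + 1)"
proof -
  obtain D where D0: "\<And>x. x \<in> {0..L} \<Longrightarrow> D 0 x = u x"
    and D: "\<And>j x. j < 3 \<Longrightarrow> x \<in> {0..L} \<Longrightarrow> (D j has_real_derivative D (Suc j) x) (at x within {0..L})"
    and D3: "continuous_on {0..L} (D (3::nat))"
    using u unfolding Ck_on_def by blast
  let ?J = "\<lambda>s. integral {0..L} (\<lambda>x. complex_of_real x powr (s - 1) * complex_of_real (u x))"
  have J: "?J s = integral {0..L} (\<lambda>x. complex_of_real x powr (s - 1) * complex_of_real (D 0 x))" for s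
    by (intro Henstock_Kurzweil_Integration.integral_cong) (simp add: D0)
  obtain C where C: "C > 0" and exp: "\<And>s. 0 < Re s \<Longrightarrow> cmod (?J s
        - complex_of_real L powr s * complex_of_real (D 0 L) / s
        + complex_of_real L powr s * complex_of_real (L * D 1 L) / (s * (s + 1))
        - complex_of_real L powr s * complex_of_real (L\<^sup>2 * D 2 L) / (s * (s + 1) * (s + 2)))
      \<le> C * L powr Re s / (cmod s * cmod (s + 1) * cmod (s + 2))"
    using initial_transform_expansion[OF L D D3] unfolding J[symmetric] by blast
  define A1 where "A1 = L * \<bar>D 1 L\<bar>"
  define A2 where "A2 = L\<^sup>2 * \<bar>D 2 L\<bar>"
  have A: "0 \<le> A1" "0 \<le> A2" using L by (auto simp: A1_def A2_def)
  have ge: "1 \<le> cmod (s + 1)" "1 \<le> cmod (s + 2)" "cmod s \<le> cmod (s + 1)" "cmod s \<le> cmod (s + 2)"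
    if "0 < Re s" for s
    using complex_Re_le_cmod[of "s + 1"] complex_Re_le_cmod[of "s + 2"] that
      cmod_le_cmod_add_of_real[of s 1] cmod_le_cmod_add_of_real[of s 2] by auto
  show ?thesis
  proof (cases "u L > 0")
    case True
    show ?thesis
    proof (rule that[of "complex_of_real (u L)" 1 "A1 + A2 + C"])
      fix s assume s: "0 < Re s"
      have s0: "0 < cmod s" using s by auto
      define X1 where "X1 = complex_of_real L powr s * complex_of_real (L * D 1 L) / (s * (s + 1))"
      define X2 where "X2 = complex_of_real L powr s * complex_of_real (L\<^sup>2 * D 2 L) / (s * (s + 1) * (s + 2))"
      define X3 where "X3 = ?J s - complex_of_real L powr s * complex_of_real (D 0 L) / s + X1 - X2"
      have le2: "cmod s ^ (1 + 1) \<le> cmod s * cmod (s + 1)"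
        using ge[OF s] by (simp add: power2_eq_square mult_left_mono)
      have le3: "cmod s ^ (1 + 1) \<le> cmod s * cmod (s + 1) * cmod (s + 2)"
        using mult_mono[OF le2 ge(2)[OF s]] by simp
      have "cmod X1 = A1 * L powr Re s / (cmod s * cmod (s + 1))"
        using L by (simp add: X1_def A1_def norm_mult norm_divide cmod_cpowr abs_mult)
      also have "\<dots> \<le> A1 * L powr Re s / cmod s ^ (1 + 1)"
        using A s0 le2 by (intro divide_left_mono mult_pos_pos le2) (auto intro: less_le_trans[OF _ ge(3)[OF s]])
      finally have X1: "cmod X1 \<le> A1 * L powr Re s / cmod s ^ (1 + 1)" .
      have pos3: "0 < cmod s * cmod (s + 1) * cmod (s + 2) * cmod s ^ (1 + 1)"
        using s0 ge[OF s] by (intro mult_pos_pos) auto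
      have "cmod X2 = A2 * L powr Re s / (cmod s * cmod (s + 1) * cmod (s + 2))"
        using L by (simp add: X2_def A2_def norm_mult norm_divide norm_power cmod_cpowr abs_mult)
      also have "\<dots> \<le> A2 * L powr Re s / cmod s ^ (1 + 1)"
        using A by (intro divide_left_mono le3 pos3) auto
      finally have X2: "cmod X2 \<le> A2 * L powr Re s / cmod s ^ (1 + 1)" .
      have "cmod X3 \<le> C * L powr Re s / (cmod s * cmod (s + 1) * cmod (s + 2))"
        using exp[OF s] unfolding X3_def X1_def X2_def .
      also have "\<dots> \<le> C * L powr Re s / cmod s ^ (1 + 1)"
        using C by (intro divide_left_mono le3 pos3) auto
      finally have X3: "cmod X3 \<le> C * L powr Re s / cmod s ^ (1 + 1)" .
      have "?J s - complex_of_real (u L) * complex_of_real L powr s / s ^ 1 = X3 - X1 + X2"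
        using D0[of L] L by (simp add: X3_def mult.commute)
      then have "cmod (?J s - complex_of_real (u L) * complex_of_real L powr s / s ^ 1) \<le> cmod X3 + cmod X1 + cmod X2"
        using norm_triangle_ineq4[of X3 X1] norm_triangle_ineq[of "X3 - X1" X2] by simp
      also have "\<dots> \<le> (A1 + A2 + C) * L powr Re s / cmod s ^ (1 + 1)"
        using X1 X2 X3 by (simp add: distrib_right add_divide_distrib)
      finally show "cmod (?J s - complex_of_real (u L) * complex_of_real L powr s / s ^ 1)
          \<le> (A1 + A2 + C) * L powr Re s / cmod s ^ (1 + 1)" .
    qed (use True in simp)
  next
    case False
    then have uL: "u L = 0" using edge by auto
    from edge False obtain d where d: "d < 0" "(u has_real_derivative d) (at L within {0..L})" by auto
    have "(D 0 has_vector_derivative D 1 L) (at L within {0..L})"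
      using D[of 0 L] L by (simp add: has_real_derivative_iff_has_vector_derivative)
    then have "(u has_vector_derivative D 1 L) (at L within {0..L})"
      by (rule has_vector_derivative_transform[rotated 2]) (use L D0 in auto)
    then have "d = D 1 L"
      using vector_derivative_unique_within_closed_interval[of 0 L L u d "D 1 L"] L d(2)
      by (simp add: has_real_derivative_iff_has_vector_derivative)
    then have D1: "D 1 L < 0" using d by simp
    show ?thesis
    proof (rule that[of "- complex_of_real (L * D 1 L)" 2 "A1 + A2 + C"])
      show "- complex_of_real (L * D 1 L) \<noteq> 0" using D1 L by simp
      fix s assume s: "0 < Re s"
      have s0: "0 < cmod s" "s \<noteq> 0" "s + 1 \<noteq> 0" using s by (auto simp: complex_eq_iff)
      define X1 where "X1 = complex_of_real L powr s * complex_of_real (L * D 1 L) / (s * s * (s + 1))"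
      define X2 where "X2 = complex_of_real L powr s * complex_of_real (L\<^sup>2 * D 2 L) / (s * (s + 1) * (s + 2))"
      define X3 where "X3 = ?J s - complex_of_real L powr s * complex_of_real (D 0 L) / s
        + complex_of_real L powr s * complex_of_real (L * D 1 L) / (s * (s + 1)) - X2"
      have le2: "cmod s ^ (2 + 1) \<le> cmod s * cmod s * cmod (s + 1)"
        using ge[OF s] by (simp add: power3_eq_cube mult_left_mono)
      have "cmod s * cmod s * cmod s \<le> cmod s * cmod (s + 1) * cmod (s + 2)"
        using ge[OF s] by (intro mult_mono) auto
      then have le3: "cmod s ^ (2 + 1) \<le> cmod s * cmod (s + 1) * cmod (s + 2)"
        by (simp add: power3_eq_cube)
      have pos2: "0 < cmod s * cmod s * cmod (s + 1) * cmod s ^ (2 + 1)"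
        and pos3: "0 < cmod s * cmod (s + 1) * cmod (s + 2) * cmod s ^ (2 + 1)"
        using s0 ge[OF s] by (auto intro!: mult_pos_pos)
      have "cmod X1 = A1 * L powr Re s / (cmod s * cmod s * cmod (s + 1))"
        using L by (simp add: X1_def A1_def norm_mult norm_divide cmod_cpowr abs_mult)
      also have "\<dots> \<le> A1 * L powr Re s / cmod s ^ (2 + 1)"
        using A by (intro divide_left_mono le2 pos2) auto
      finally have X1: "cmod X1 \<le> A1 * L powr Re s / cmod s ^ (2 + 1)" .
      have "cmod X2 = A2 * L powr Re s / (cmod s * cmod (s + 1) * cmod (s + 2))"
        using L by (simp add: X2_def A2_def norm_mult norm_divide norm_power cmod_cpowr abs_mult)
      also have "\<dots> \<le> A2 * L powr Re s / cmod s ^ (2 + 1)"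
        using A by (intro divide_left_mono le3 pos3) auto
      finally have X2: "cmod X2 \<le> A2 * L powr Re s / cmod s ^ (2 + 1)" .
      have "cmod X3 \<le> C * L powr Re s / (cmod s * cmod (s + 1) * cmod (s + 2))"
        using exp[OF s] unfolding X3_def X2_def .
      also have "\<dots> \<le> C * L powr Re s / cmod s ^ (2 + 1)"
        using C by (intro divide_left_mono le3 pos3) auto
      finally have X3: "cmod X3 \<le> C * L powr Re s / cmod s ^ (2 + 1)" .
      have frac: "y / (s * s) - y / (s * (s + 1)) = y / (s * s * (s + 1))" for y
        using s0 by (simp add: divide_simps) (simp add: algebra_simps)
      have "?J s - (- complex_of_real (L * D 1 L)) * complex_of_real L powr s / s\<^sup>2 = X3 + X1 + X2"
        using D0[of L] L uL unfolding X3_def X1_def frac[symmetric] by (simp add: power2_eq_square mult.commute)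
      then have "cmod (?J s - (- complex_of_real (L * D 1 L)) * complex_of_real L powr s / s\<^sup>2) \<le> cmod X3 + cmod X1 + cmod X2"
        using norm_triangle_ineq[of X3 X1] norm_triangle_ineq[of "X3 + X1" X2] by simp
      also have "\<dots> \<le> (A1 + A2 + C) * L powr Re s / cmod s ^ (2 + 1)"
        using X1 X2 X3 by (simp add: distrib_right add_divide_distrib)
      finally show "cmod (?J s - (- complex_of_real (L * D 1 L)) * complex_of_real L powr s / s\<^sup>2)
          \<le> (A1 + A2 + C) * L powr Re s / cmod s ^ (2 + 1)" .
    qed
  qed
qed

section \<open>Truncated powers and convergence lemmas\<close>

text \<open>For \<open>\<epsilon> \<le> x \<le> L\<close> this is \<open>x\<^sup>s\<^sup>-\<^sup>1\<close>, because \<open>x\<^sup>s\<^sup>-\<^sup>1 = x\<^sup>s/x\<close>. Truncating the denominator instead of the power makes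
the function continuous at \<open>0\<close> for all \<open>Re s > 0\<close>, monotone in \<open>\<epsilon>\<close>, and compatible with scaling.\<close>

definition cutoff_cpowr :: "real \<Rightarrow> real \<Rightarrow> complex \<Rightarrow> real \<Rightarrow> complex" where
  "cutoff_cpowr L \<epsilon> s x = complex_of_real (min x L) powr s / complex_of_real (max (min x L) \<epsilon>)"

context
  fixes L \<epsilon> :: real and s :: complex
  assumes L: "0 < L" and \<epsilon>: "0 < \<epsilon>" and s: "0 < Re s"
begin

lemma continuous_on_cutoff_cpowr: "continuous_on {0..} (cutoff_cpowr L \<epsilon> s)"
proof -
  have "continuous_on {0..} (\<lambda>x. complex_of_real (min x L) powr s)"
    by (rule continuous_on_compose2[OF continuous_on_cpowr[OF s], of _ "\<lambda>x. min x L"])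
      (use L in \<open>auto intro!: continuous_intros\<close>)
  then show ?thesis
    unfolding cutoff_cpowr_def using \<epsilon>
    by (intro continuous_on_divide continuous_on_of_real continuous_on_max continuous_on_min
        continuous_on_id continuous_on_const) auto
qed

lemma cmod_cutoff_cpowr:
  "0 \<le> x \<Longrightarrow> cmod (cutoff_cpowr L \<epsilon> s x) = min x L powr Re s / max (min x L) \<epsilon>"
  using L \<epsilon> by (simp add: cutoff_cpowr_def norm_divide cmod_cpowr abs_of_pos less_max_iff_disj)

lemma cmod_cutoff_cpowr_le: "0 \<le> x \<Longrightarrow> cmod (cutoff_cpowr L \<epsilon> s x) \<le> L powr Re s / \<epsilon>"
  unfolding cmod_cutoff_cpowr using L \<epsilon> s by (intro frac_le powr_mono2) auto

lemma cmod_cutoff_cpowr_le_powr: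
  assumes "0 \<le> x" "x \<le> L"
  shows "cmod (cutoff_cpowr L \<epsilon> s x) \<le> x powr (Re s - 1)"
proof (cases "x = 0")
  case False
  then have "x powr Re s / max x \<epsilon> \<le> x powr Re s / x"
    using assms \<epsilon> by (intro divide_left_mono) auto
  then show ?thesis using assms False by (simp add: cmod_cutoff_cpowr powr_diff)
qed (use s L in \<open>simp add: cutoff_cpowr_def\<close>)

text \<open>The truncated power inherits the multiplicativity of \<open>x\<^sup>s\<^sup>-\<^sup>1\<close> as an inequality. This bounds the gain term by
a multiple of the truncated power itself, with a constant independent of \<open>\<epsilon>\<close>.\<close>

lemma cmod_cutoff_cpowr_scale:
  assumes x: "0 \<le> x" "x \<le> L" and z: "0 \<le> z" "z \<le> 1"
  shows "cmod (cutoff_cpowr L \<epsilon> s (x * z)) \<le> z powr (Re s - 1) * cmod (cutoff_cpowr L \<epsilon> s x)"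
proof (cases "z = 0")
  case False
  then have z0: "0 < z" using z by simp
  have xz: "x * z \<le> x" using mult_left_le[OF z(2) x(1)] by simp
  have "max x \<epsilon> * z \<le> max (x * z) \<epsilon>"
  proof -
    have "\<epsilon> * z \<le> \<epsilon>" using z \<epsilon> by (intro mult_left_le) auto
    then show ?thesis by (cases "x \<le> \<epsilon>") (auto simp: max_def)
  qed
  then have "(x * z) powr Re s / max (x * z) \<epsilon> \<le> (x * z) powr Re s / (max x \<epsilon> * z)"
    using z0 \<epsilon> by (intro divide_left_mono) (auto simp: less_max_iff_disj intro!: mult_pos_pos)
  also have "\<dots> = z powr (Re s - 1) * (x powr Re s / max x \<epsilon>)"
    using x z0 by (simp add: powr_mult powr_diff mult_ac)
  finally show ?thesis
    using x z xz by (simp add: cmod_cutoff_cpowr)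
qed (use s L in \<open>simp add: cutoff_cpowr_def\<close>)

end

lemma cutoff_cpowr_eq:
  assumes "0 < Re s" "0 \<le> x" "x \<le> L" "x = 0 \<or> \<epsilon> \<le> x"
  shows "cutoff_cpowr L \<epsilon> s x = complex_of_real x powr (s - 1)"
  using assms by (cases "x = 0") (auto simp: cutoff_cpowr_def powr_diff max_def)

lemma cutoff_cpowr_tendsto:
  assumes "0 < Re s" "0 \<le> x" "x \<le> L"
  shows "(\<lambda>m. cutoff_cpowr L (1 / real (Suc m)) s x) \<longlonglongrightarrow> complex_of_real x powr (s - 1)"
proof (rule tendsto_eventually)
  have "\<forall>\<^sub>F m in sequentially. x = 0 \<or> 1 / real (Suc m) < x"
  proof (cases "x = 0")
    case False
    then show ?thesis
      using order_tendstoD(2)[OF LIMSEQ_inverse_real_of_nat, of x] assms by (simp add: inverse_eq_divide)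
  qed simp
  then show "\<forall>\<^sub>F m in sequentially. cutoff_cpowr L (1 / real (Suc m)) s x = complex_of_real x powr (s - 1)"
    by eventually_elim (use assms cutoff_cpowr_eq in auto)
qed

lemma cutoff_cpowr_of_real:
  assumes "0 \<le> x" "0 < L"
  shows "cutoff_cpowr L \<epsilon> (complex_of_real \<sigma>) x = complex_of_real (min x L powr \<sigma> / max (min x L) \<epsilon>)"
  using assms by (simp add: cutoff_cpowr_def powr_of_real)

lemma set_dominated_convergence:
  fixes f :: "nat \<Rightarrow> 'a \<Rightarrow> 'b::{banach, second_countable_topology}"
  assumes "set_borel_measurable M A g" and "\<And>i. set_borel_measurable M A (f i)"
    and w: "set_integrable M A w"
    and bound: "\<And>i. AE x in M. x \<in> A \<longrightarrow> norm (f i x) \<le> w x"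
    and lim: "AE x in M. x \<in> A \<longrightarrow> (\<lambda>i. f i x) \<longlonglongrightarrow> g x"
  shows "set_integrable M A g"
    and "(\<lambda>i. LINT x:A|M. f i x) \<longlonglongrightarrow> (LINT x:A|M. g x)"
proof -
  let ?s = "\<lambda>i x. indicator A x *\<^sub>R f i x" and ?g = "\<lambda>x. indicator A x *\<^sub>R g x"
    and ?w = "\<lambda>x. indicator A x *\<^sub>R w x"
  have l: "AE x in M. (\<lambda>i. ?s i x) \<longlonglongrightarrow> ?g x"
    using lim by eventually_elim (auto simp: indicator_def)
  have b: "AE x in M. norm (?s i x) \<le> ?w x" for i
    using bound[of i] by eventually_elim (auto simp: indicator_def)
  have m: "?g \<in> borel_measurable M" "\<And>i. ?s i \<in> borel_measurable M"
    using assms(1,2) by (auto simp: set_borel_measurable_def)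
  have w': "integrable M ?w" using w by (simp add: set_integrable_def)
  show "set_integrable M A g"
    unfolding set_integrable_def by (rule integrable_dominated_convergence[OF m w' l b])
  show "(\<lambda>i. LINT x:A|M. f i x) \<longlonglongrightarrow> (LINT x:A|M. g x)"
    unfolding set_lebesgue_integral_def by (rule integral_dominated_convergence[OF m w' l b])
qed

text \<open>A Gronwall bound with a cruder rate. Weighting \<open>M\<close> by \<open>exp(-2bt)\<close> and evaluating the
inequality where the weighted function is maximal absorbs half of the maximum.\<close>

lemma integral_inequality_exp_bound:
  fixes M :: "real \<Rightarrow> real"
  assumes cont: "continuous_on {0..T} M" and a: "0 \<le> a" and b: "0 < b"
    and le: "\<And>t. t \<in> {0..T} \<Longrightarrow> M t \<le> a + b * integral {0..t} M"
    and t: "t \<in> {0..T}"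
  shows "M t \<le> 2 * a * exp (2 * b * t)"
proof -
  let ?g = "\<lambda>t. M t * exp (- (2 * b * t))"
  have "continuous_on {0..T} ?g" by (intro continuous_intros cont)
  then obtain t0 where t0: "t0 \<in> {0..T}" and max: "\<And>t. t \<in> {0..T} \<Longrightarrow> ?g t \<le> ?g t0"
    using continuous_attains_sup[of "{0..T}" ?g] t by fastforce
  define S where "S = ?g t0"
  have MS: "M r \<le> S * exp (2 * b * r)" if "r \<in> {0..T}" for r
    using max[OF that] by (simp add: S_def exp_minus field_simps)
  have "S \<le> 2 * a"
  proof (cases "S \<le> 0")
    case False
    have I: "((\<lambda>r. S * exp (2 * b * r)) has_integral (S * exp (2 * b * t0) / (2 * b) - S * exp (2 * b * 0) / (2 * b))) {0..t0}"
      using t0 b by (intro fundamental_theorem_of_calculus)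
        (auto intro!: derivative_eq_intros simp: has_real_derivative_iff_has_vector_derivative[symmetric])
    have "integral {0..t0} M \<le> integral {0..t0} (\<lambda>r. S * exp (2 * b * r))"
    proof (rule integral_le)
      show "M integrable_on {0..t0}"
        using t0 by (intro integrable_continuous_interval continuous_on_subset[OF cont]) auto
      show "(\<lambda>r. S * exp (2 * b * r)) integrable_on {0..t0}" using I by blast
    qed (use MS t0 in auto)
    also have "\<dots> \<le> S * exp (2 * b * t0) / (2 * b)"
      using integral_unique[OF I] False b by simp
    finally have "b * integral {0..t0} M \<le> S * exp (2 * b * t0) / 2"
      using b by (simp add: field_simps)
    moreover have "M t0 = S * exp (2 * b * t0)"
      by (simp add: S_def exp_minus)
    ultimately have "S * exp (2 * b * t0) \<le> 2 * a"
      using le[OF t0] by linarith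
    moreover have "S * 1 \<le> S * exp (2 * b * t0)"
      using False b t0 by (intro mult_left_mono) auto
    ultimately show ?thesis by linarith
  qed (use a in linarith)
  then have "S * exp (2 * b * t) \<le> 2 * a * exp (2 * b * t)" by (intro mult_right_mono) auto
  then show ?thesis using MS[OF t] by linarith
qed

text \<open>The second bound measures how far the product is from its value at \<open>a = 0\<close>. It carries a factor \<open>B\<close>,
which becomes \<open>1/|s|\<close> in the error estimate.\<close>

lemma prod_minus_one_bounds:
  fixes a :: "nat \<Rightarrow> complex"
  assumes "\<And>j. cmod (a j) \<le> B"
  shows "cmod (\<Prod>j<n. a j - 1) \<le> (1 + B) ^ n"
    and "cmod ((\<Prod>j<n. a j - 1) - (- 1) ^ n) \<le> real n * B * (1 + B) ^ n"
proof -
  have B: "0 \<le> B" using assms[of 0] norm_ge_zero order_trans by blast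
  have step: "cmod (a j - 1) \<le> 1 + B" for j
    using norm_triangle_ineq4[of "a j" 1] assms[of j] by simp
  show bound: "cmod (\<Prod>j<n. a j - 1) \<le> (1 + B) ^ n" for n
  proof (induction n)
    case (Suc n)
    then show ?case
      using mult_mono[OF Suc step[of n]] B by (simp add: norm_mult mult.commute)
  qed simp
  show "cmod ((\<Prod>j<n. a j - 1) - (- 1) ^ n) \<le> real n * B * (1 + B) ^ n"
  proof (induction n)
    case (Suc n)
    let ?P = "\<Prod>j<n. a j - 1"
    have "(\<Prod>j<Suc n. a j - 1) - (- 1) ^ Suc n = ?P * a n - (?P - (- 1) ^ n)"
      by (simp add: algebra_simps)
    then have "cmod ((\<Prod>j<Suc n. a j - 1) - (- 1) ^ Suc n)
        \<le> cmod (?P * a n) + cmod (?P - (- 1) ^ n)"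
      using norm_triangle_ineq4 by metis
    also have "cmod (?P * a n) \<le> (1 + B) ^ n * B"
      unfolding norm_mult using B by (intro mult_mono bound assms) auto
    finally have "cmod ((\<Prod>j<Suc n. a j - 1) - (- 1) ^ Suc n)
        \<le> (real (Suc n) * B) * (1 + B) ^ n"
      using Suc by (simp add: algebra_simps)
    also have "\<dots> \<le> (real (Suc n) * B) * (1 + B) ^ Suc n"
      using B by (intro mult_left_mono power_increasing) auto
    finally show ?case .
  qed simp
qed

section \<open>Support and moments of the solution\<close>

text \<open>The evolution equation for the transforms holds without densities, so the interface mentions none. It asks for
moments of every order above \<open>-1\<close>, because the power \<open>x\<^sup>s\<^sup>-\<^sup>1\<close> is singular at \<open>0\<close> when \<open>Re s < 1\<close>.\<close>

locale fragmentation_flow =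
  fixes \<alpha> \<gamma> L :: real and \<kappa> :: "real measure" and \<mu> :: "real \<Rightarrow> real measure"
  assumes \<alpha>: "0 < \<alpha>" and \<gamma>: "0 < \<gamma>" and L: "0 < L"
    and kernel: "fragmentation_kernel \<kappa>"
    and kernel_moment: "\<And>s. 0 < Re s \<Longrightarrow> set_integrable \<kappa> {0..1} (\<lambda>z. complex_of_real z powr (s - 1))"
    and K_transform_eq: "\<And>s. 0 < Re s \<Longrightarrow> K_transform \<kappa> s = (LINT z:{0..1}|\<kappa>. complex_of_real z powr (s - 1))"
    and solution: "frag_solution \<alpha> \<gamma> \<kappa> \<mu>"
    and initial_support: "AE x in \<mu> 0. x \<le> L"
    and initial_moment: "\<And>s. 0 < Re s \<Longrightarrow> set_integrable (\<mu> 0) {0..} (\<lambda>x. complex_of_real x powr (s - 1))"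
begin

lemma kernel_measure: "finite_measure \<kappa>" "sets \<kappa> = sets borel"
  using kernel by (auto simp: fragmentation_kernel_def nonneg_measure_def)

lemma solution_measure:
  assumes "0 \<le> t"
  shows "finite_measure (\<mu> t)" "sets (\<mu> t) = sets borel"
  using solution assms by (auto simp: frag_solution_def nonneg_measure_def)

lemma measurable_solution [simp]:
  "0 \<le> t \<Longrightarrow> borel_measurable (\<mu> t) = borel_measurable borel"
  by (intro measurable_cong_sets solution_measure refl)

lemma kernel_set_integrable:
  fixes g :: "real \<Rightarrow> real"
  assumes "continuous_on {0..1} g"
  shows "set_integrable \<kappa> {0..1} g"
proof -
  obtain B where "\<And>x. x \<in> {0..1} \<Longrightarrow> \<bar>g x\<bar> \<le> B"
    using compact_imp_bounded[OF compact_continuous_image[OF assms compact_Icc]]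
    unfolding bounded_iff by (metis imageI real_norm_def)
  then have "norm (indicator {0..1} x *\<^sub>R g x) \<le> max 0 B" for x
    by (auto simp: indicator_def le_max_iff_disj)
  moreover have "(\<lambda>x. indicator {0..1} x *\<^sub>R g x) \<in> borel_measurable \<kappa>"
    using borel_measurable_continuous_on_indicator[OF _ assms]
    by (simp add: measurable_cong_sets[OF kernel_measure(2) refl])
  ultimately show ?thesis
    unfolding set_integrable_def
    by (intro finite_measure.integrable_const_bound[OF kernel_measure(1)]) auto
qed

lemma weak_formulation:
  fixes \<phi> :: "real \<Rightarrow> real"
  assumes "continuous_on {0..} \<phi>" "bounded ((\<lambda>x. \<phi> x / (1 + x)) ` {0..})" "0 \<le> t"
  shows "set_integrable (\<mu> t) {0..} \<phi>"
    and "set_integrable (\<mu> t) {0..} (frag_integrand \<alpha> \<gamma> \<kappa> \<phi>)"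
    and "set_integrable lborel {0..t} (\<lambda>r. LINT x:{0..}|\<mu> r. frag_integrand \<alpha> \<gamma> \<kappa> \<phi> x)"
    and "(LINT x:{0..}|\<mu> t. \<phi> x) = (LINT x:{0..}|\<mu> 0. \<phi> x) +
             (LINT r:{0..t}|lborel. (LINT x:{0..}|\<mu> r. frag_integrand \<alpha> \<gamma> \<kappa> \<phi> x))"
  using solution assms unfolding frag_solution_def by blast+

lemma kernel_first_moment: "(LINT z:{0..1}|\<kappa>. z) = 1"
  using kernel by (simp add: fragmentation_kernel_def)

text \<open>The test function \<open>max 0 (x - L)\<close> is convex and vanishes at \<open>0\<close>, so splitting \<open>x\<close> into fragments of
total mass \<open>x\<close> does not increase it: its integral is nonincreasing in time and starts at \<open>0\<close>.\<close>

lemma solution_support: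
  assumes t: "0 \<le> t"
  shows "AE x in \<mu> t. x \<in> {0..} \<longrightarrow> x \<le> L"
proof -
  let ?\<phi> = "\<lambda>x. max 0 (x - L)"
  let ?f = "frag_integrand \<alpha> \<gamma> \<kappa> ?\<phi>"
  have cont: "continuous_on A ?\<phi>" for A by (intro continuous_intros)
  have "norm (?\<phi> x / (1 + x)) \<le> 1" if "0 \<le> x" for x
    using that L by (auto simp: divide_simps)
  then have bdd: "bounded ((\<lambda>x. ?\<phi> x / (1 + x)) ` {0..})"
    by (auto simp: bounded_iff intro!: exI[of _ 1])
  note weak = weak_formulation[OF cont bdd]
  have neg: "?f x \<le> 0" if x: "0 \<le> x" for x
  proof -
    have "(LINT z:{0..1}|\<kappa>. ?\<phi> (x * z)) \<le> (LINT z:{0..1}|\<kappa>. ?\<phi> x * z)"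
    proof (rule set_integral_mono)
      show "set_integrable \<kappa> {0..1} (\<lambda>z. ?\<phi> (x * z))" "set_integrable \<kappa> {0..1} (\<lambda>z. ?\<phi> x * z)"
        by (intro kernel_set_integrable continuous_intros)+
      fix z :: real assume z: "z \<in> {0..1}"
      have "x * z - L \<le> (x - L) * z"
        using z L mult_left_le[of z L] by (simp add: left_diff_distrib)
      also have "\<dots> \<le> ?\<phi> x * z" using z by (intro mult_right_mono) auto
      finally show "?\<phi> (x * z) \<le> ?\<phi> x * z" using z by simp
    qed
    then have "- ?\<phi> x + (LINT z:{0..1}|\<kappa>. ?\<phi> (x * z)) \<le> 0"
      using kernel_first_moment by simp
    then show ?thesis
      unfolding frag_integrand_def using \<alpha> by (intro mult_nonneg_nonpos) auto
  qed
  have "(LINT x:{0..}|\<mu> r. ?f x) \<le> 0" for r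
    using neg integral_nonneg_AE[where M="\<mu> r" and f="\<lambda>x. - (indicator {0..} x *\<^sub>R ?f x)"]
    by (auto simp: set_lebesgue_integral_def indicator_def)
  then have "(LINT r:{0..t}|lborel. (LINT x:{0..}|\<mu> r. ?f x)) \<le> 0"
    using integral_nonneg_AE[where M=lborel and f="\<lambda>r. - (indicator {0..t} r *\<^sub>R (LINT x:{0..}|\<mu> r. ?f x))"]
    by (auto simp: set_lebesgue_integral_def indicator_def)
  moreover have "(LINT x:{0..}|\<mu> 0. ?\<phi> x) = 0"
    unfolding set_lebesgue_integral_def using initial_support
    by (intro integral_eq_zero_AE) (auto elim!: eventually_mono)
  ultimately have "(LINT x:{0..}|\<mu> t. ?\<phi> x) \<le> 0"
    using weak(4)[OF t] by simp
  moreover have "0 \<le> (LINT x:{0..}|\<mu> t. ?\<phi> x)"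
    unfolding set_lebesgue_integral_def by (intro integral_nonneg_AE) auto
  ultimately have "(\<integral>x. indicator {0..} x *\<^sub>R ?\<phi> x \<partial>\<mu> t) = 0"
    unfolding set_lebesgue_integral_def by (rule antisym)
  then have "AE x in \<mu> t. indicator {0..} x *\<^sub>R ?\<phi> x = 0"
    using weak(1)[OF t] by (subst (asm) integral_nonneg_eq_0_iff_AE) (auto simp: set_integrable_def)
  then show ?thesis
    by eventually_elim (auto simp: indicator_def max_def split: if_splits)
qed

text \<open>The scaling inequality for truncated powers, integrated over the kernel. The complex factor \<open>c\<close> allows
the real weak formulation to be used for real and imaginary parts alike.\<close>

lemma frag_integrand_cutoff:
  assumes \<epsilon>: "0 < \<epsilon>" and s: "0 < Re s" and x: "0 \<le> x" "x \<le> L"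
  defines "\<sigma> \<equiv> complex_of_real (Re s)"
  shows "set_integrable \<kappa> {0..1} (\<lambda>z. Re (c * cutoff_cpowr L \<epsilon> s (x * z)))"
    and "\<bar>LINT z:{0..1}|\<kappa>. Re (c * cutoff_cpowr L \<epsilon> s (x * z))\<bar>
      \<le> cmod c * Re (K_transform \<kappa> \<sigma>) * cmod (cutoff_cpowr L \<epsilon> s x)"
proof -
  let ?g = "\<lambda>z. Re (c * cutoff_cpowr L \<epsilon> s (x * z))"
  have "continuous_on {0..1} (\<lambda>z. cutoff_cpowr L \<epsilon> s (x * z))"
    by (rule continuous_on_compose2[OF continuous_on_cutoff_cpowr[OF L \<epsilon> s]])
      (use x in \<open>auto intro!: continuous_intros\<close>)
  then show int: "set_integrable \<kappa> {0..1} ?g"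
    by (intro kernel_set_integrable continuous_intros)
  have \<sigma>: "0 < Re \<sigma>" using s by (simp add: \<sigma>_def)
  have re: "Re (complex_of_real z powr (\<sigma> - 1)) = z powr (Re s - 1)" if "0 \<le> z" for z
    using that powr_of_real[of z "Re s - 1"] by (simp add: \<sigma>_def)
  have intp: "set_integrable \<kappa> {0..1} (\<lambda>z. Re (complex_of_real z powr (\<sigma> - 1)))"
    using kernel_moment[OF \<sigma>] by (auto simp: set_integrable_def dest: integrable_Re)
  have K: "Re (K_transform \<kappa> \<sigma>) = (LINT z:{0..1}|\<kappa>. Re (complex_of_real z powr (\<sigma> - 1)))"
    unfolding K_transform_eq[OF \<sigma>] set_lebesgue_integral_def
    using integral_Re[OF kernel_moment[OF \<sigma>, unfolded set_integrable_def]] by simp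
  have "\<bar>LINT z:{0..1}|\<kappa>. ?g z\<bar> \<le> (LINT z:{0..1}|\<kappa>. \<bar>?g z\<bar>)"
    using set_integral_norm_bound[OF int] by simp
  also have "\<dots> \<le> (LINT z:{0..1}|\<kappa>. cmod c * cmod (cutoff_cpowr L \<epsilon> s x) * Re (complex_of_real z powr (\<sigma> - 1)))"
  proof (rule set_integral_mono)
    show "set_integrable \<kappa> {0..1} (\<lambda>z. \<bar>?g z\<bar>)" using int by (rule set_integrable_abs)
    show "set_integrable \<kappa> {0..1} (\<lambda>z. cmod c * cmod (cutoff_cpowr L \<epsilon> s x) * Re (complex_of_real z powr (\<sigma> - 1)))"
      using intp by simp
    fix z :: real assume z: "z \<in> {0..1}"
    have "\<bar>?g z\<bar> \<le> cmod c * cmod (cutoff_cpowr L \<epsilon> s (x * z))"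
      using abs_Re_le_cmod[of "c * cutoff_cpowr L \<epsilon> s (x * z)"] by (simp add: norm_mult)
    also have "\<dots> \<le> cmod c * (z powr (Re s - 1) * cmod (cutoff_cpowr L \<epsilon> s x))"
      using z x by (intro mult_left_mono cmod_cutoff_cpowr_scale[OF L \<epsilon> s]) auto
    finally show "\<bar>?g z\<bar> \<le> cmod c * cmod (cutoff_cpowr L \<epsilon> s x) * Re (complex_of_real z powr (\<sigma> - 1))"
      using z re by (simp add: mult_ac)
  qed
  also have "\<dots> = cmod c * Re (K_transform \<kappa> \<sigma>) * cmod (cutoff_cpowr L \<epsilon> s x)"
    unfolding K by simp
  finally show "\<bar>LINT z:{0..1}|\<kappa>. ?g z\<bar> \<le> cmod c * Re (K_transform \<kappa> \<sigma>) * cmod (cutoff_cpowr L \<epsilon> s x)" .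
qed

lemma cutoff_test_function:
  assumes \<epsilon>: "0 < \<epsilon>" and s: "0 < Re s"
  shows "continuous_on {0..} (\<lambda>x. Re (c * cutoff_cpowr L \<epsilon> s x))"
    and "bounded ((\<lambda>x. Re (c * cutoff_cpowr L \<epsilon> s x)) ` {0..})"
    and "bounded ((\<lambda>x. Re (c * cutoff_cpowr L \<epsilon> s x) / (1 + x)) ` {0..})"
proof -
  show "continuous_on {0..} (\<lambda>x. Re (c * cutoff_cpowr L \<epsilon> s x))"
    by (intro continuous_intros continuous_on_cutoff_cpowr[OF L \<epsilon> s])
  let ?B = "cmod c * (L powr Re s / \<epsilon>)"
  have b: "\<bar>Re (c * cutoff_cpowr L \<epsilon> s x)\<bar> \<le> ?B" if "0 \<le> x" for x
  proof -
    have "\<bar>Re (c * cutoff_cpowr L \<epsilon> s x)\<bar> \<le> cmod c * cmod (cutoff_cpowr L \<epsilon> s x)"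
      using abs_Re_le_cmod[of "c * cutoff_cpowr L \<epsilon> s x"] by (simp add: norm_mult)
    also have "\<dots> \<le> ?B" using that by (intro mult_left_mono cmod_cutoff_cpowr_le[OF L \<epsilon> s]) auto
    finally show ?thesis .
  qed
  then show "bounded ((\<lambda>x. Re (c * cutoff_cpowr L \<epsilon> s x)) ` {0..})"
    unfolding bounded_iff by (intro exI[of _ ?B]) auto
  have "\<bar>Re (c * cutoff_cpowr L \<epsilon> s x) / (1 + x)\<bar> \<le> ?B" if "0 \<le> x" for x
  proof -
    have "\<bar>Re (c * cutoff_cpowr L \<epsilon> s x) / (1 + x)\<bar> \<le> \<bar>Re (c * cutoff_cpowr L \<epsilon> s x)\<bar> / 1"
      unfolding abs_divide using that by (intro divide_left_mono) auto
    then show ?thesis using b[OF that] by simp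
  qed
  then show "bounded ((\<lambda>x. Re (c * cutoff_cpowr L \<epsilon> s x) / (1 + x)) ` {0..})"
    unfolding bounded_iff by (intro exI[of _ ?B]) auto
qed

lemma K_transform_real_nonneg:
  assumes "0 < \<sigma>" shows "0 \<le> Re (K_transform \<kappa> (complex_of_real \<sigma>))"
proof -
  let ?s = "complex_of_real \<sigma>"
  have s: "0 < Re ?s" using assms by simp
  have re: "Re (complex_of_real z powr (?s - 1)) = z powr (\<sigma> - 1)" if "0 \<le> z" for z
    using that powr_of_real[of z "\<sigma> - 1"] by simp
  have "Re (K_transform \<kappa> ?s) = (\<integral>z. Re (indicator {0..1} z *\<^sub>R complex_of_real z powr (?s - 1)) \<partial>\<kappa>)"
    unfolding K_transform_eq[OF s] set_lebesgue_integral_def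
    using kernel_moment[OF s] by (intro integral_Re[symmetric]) (simp add: set_integrable_def)
  also have "0 \<le> \<dots>" using re by (intro integral_nonneg_AE) (auto simp: indicator_def)
  finally show ?thesis .
qed

text \<open>Dropping the loss term, the truncated moment \<open>M\<close> satisfies \<open>M(t) \<le> a + b \<integral>M\<close> with \<open>a\<close> and \<open>b\<close>
independent of \<open>\<epsilon>\<close>; it is continuous in time because the truncated power is a bounded test function.\<close>

lemma cutoff_moment_bound:
  fixes \<epsilon> \<sigma> :: real
  assumes \<epsilon>: "0 < \<epsilon>" and \<sigma>: "0 < \<sigma>" and t: "0 \<le> t"
  defines "f \<equiv> \<lambda>x. Re (1 * cutoff_cpowr L \<epsilon> (complex_of_real \<sigma>) x)"
    and "b \<equiv> \<alpha> * L powr \<gamma> * Re (K_transform \<kappa> (complex_of_real \<sigma>)) + 1"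
  shows "(LINT x:{0..}|\<mu> t. f x) \<le> 2 * (LINT x:{0..}|\<mu> 0. x powr (\<sigma> - 1)) * exp (2 * b * t)"
proof -
  let ?s = "complex_of_real \<sigma>"
  have s: "0 < Re ?s" using \<sigma> by simp
  have test: "continuous_on {0..} f" "bounded (f ` {0..})" "bounded ((\<lambda>x. f x / (1 + x)) ` {0..})"
    unfolding f_def by (rule cutoff_test_function[OF \<epsilon> s])+
  note weak = weak_formulation[OF test(1,3)]
  have fc: "f x = cmod (cutoff_cpowr L \<epsilon> ?s x)" if "0 \<le> x" for x
  proof -
    have "0 \<le> min x L powr \<sigma> / max (min x L) \<epsilon>"
      using \<epsilon> by (intro divide_nonneg_nonneg) (auto simp: le_max_iff_disj)
    then show ?thesis
      unfolding f_def cutoff_cpowr_of_real[OF that L] norm_of_real mult_1 Re_complex_of_real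
      by (rule abs_of_nonneg[symmetric])
  qed
  have f0: "0 \<le> f x" if "0 \<le> x" for x using fc[OF that] by simp
  have K0: "0 \<le> Re (K_transform \<kappa> ?s)" by (rule K_transform_real_nonneg[OF \<sigma>])
  have b: "0 < b" unfolding b_def using \<alpha> L K0 by (intro add_nonneg_pos mult_nonneg_nonneg) auto
  define a where "a = (LINT x:{0..}|\<mu> 0. x powr (\<sigma> - 1))"
  have a0: "0 \<le> a" unfolding a_def set_lebesgue_integral_def by (intro integral_nonneg_AE) auto
  define M where "M t = (LINT x:{0..}|\<mu> t. f x)" for t
  have contM: "continuous_on {0..} M"
    using solution test(1,2) unfolding frag_solution_def narrowly_continuous_def M_def by blast
  have frag: "frag_integrand \<alpha> \<gamma> \<kappa> f x \<le> b * f x" if x: "0 \<le> x" "x \<le> L" for x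
  proof -
    have "\<bar>LINT z:{0..1}|\<kappa>. f (x * z)\<bar> \<le> Re (K_transform \<kappa> ?s) * f x"
      unfolding fc[OF x(1)] unfolding f_def using frag_integrand_cutoff(2)[OF \<epsilon> s x, of 1] by simp
    then have "- f x + (LINT z:{0..1}|\<kappa>. f (x * z)) \<le> Re (K_transform \<kappa> ?s) * f x"
      using f0[OF x(1)] by linarith
    then have "frag_integrand \<alpha> \<gamma> \<kappa> f x \<le> \<alpha> * x powr \<gamma> * (Re (K_transform \<kappa> ?s) * f x)"
      unfolding frag_integrand_def using \<alpha> by (intro mult_left_mono) auto
    also have "\<dots> \<le> \<alpha> * L powr \<gamma> * (Re (K_transform \<kappa> ?s) * f x)"
      using \<alpha> \<gamma> x K0 f0[OF x(1)] by (intro mult_right_mono mult_left_mono powr_mono2) auto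
    also have "\<dots> \<le> b * f x"
      unfolding b_def using f0[OF x(1)] by (simp add: algebra_simps)
    finally show ?thesis .
  qed
  have fragM: "(LINT x:{0..}|\<mu> r. frag_integrand \<alpha> \<gamma> \<kappa> f x) \<le> b * M r" if r: "0 \<le> r" for r
  proof -
    have "(LINT x:{0..}|\<mu> r. frag_integrand \<alpha> \<gamma> \<kappa> f x) \<le> (LINT x:{0..}|\<mu> r. b * f x)"
      using weak(1,2)[OF r] solution_support[OF r] frag
      by (intro set_integral_mono_AE) (auto elim!: eventually_mono)
    then show ?thesis by (simp add: M_def)
  qed
  have ineq: "M t \<le> a + b * integral {0..t} M" if t: "0 \<le> t" for t
  proof -
    have "continuous_on {0..t} M" using contM by (rule continuous_on_subset) auto
    then have Mint: "set_integrable lborel {0..t} M"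
      by (intro borel_integrable_atLeastAtMost') 
    have "(LINT r:{0..t}|lborel. (LINT x:{0..}|\<mu> r. frag_integrand \<alpha> \<gamma> \<kappa> f x)) \<le> (LINT r:{0..t}|lborel. b * M r)"
      using weak(3)[OF t] Mint fragM by (intro set_integral_mono) auto
    also have "\<dots> = b * integral {0..t} M"
      using set_borel_integral_eq_integral(2)[OF Mint] by simp
    finally have A: "(LINT r:{0..t}|lborel. (LINT x:{0..}|\<mu> r. frag_integrand \<alpha> \<gamma> \<kappa> f x)) \<le> b * integral {0..t} M" .
    have "M 0 \<le> a"
      unfolding M_def a_def
    proof (rule set_integral_mono_AE)
      show "set_integrable (\<mu> 0) {0..} f" using weak(1)[of 0] by simp
      have "integrable (\<mu> 0) (\<lambda>x. Re (indicator {0..} x *\<^sub>R complex_of_real x powr (?s - 1)))"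
        using initial_moment[OF s] by (intro integrable_Re) (simp add: set_integrable_def)
      also have "(\<lambda>x. Re (indicator {0..} x *\<^sub>R complex_of_real x powr (?s - 1))) = (\<lambda>x. indicator {0..} x *\<^sub>R x powr (\<sigma> - 1))"
        using powr_of_real[of _ "\<sigma> - 1"] by (auto simp: indicator_def)
      finally show "set_integrable (\<mu> 0) {0..} (\<lambda>x. x powr (\<sigma> - 1))" by (simp add: set_integrable_def)
      show "AE x in \<mu> 0. x \<in> {0..} \<longrightarrow> f x \<le> x powr (\<sigma> - 1)"
        using initial_support
      proof eventually_elim
        case (elim x)
        then show ?case using cmod_cutoff_cpowr_le_powr[OF L \<epsilon> s, of x] fc[of x] by simp
      qed
    qed
    then show ?thesis using weak(4)[OF t] A by (simp add: M_def)
  qed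
  have "M t \<le> 2 * a * exp (2 * b * t)"
    by (rule integral_inequality_exp_bound[OF _ a0 b, of t])
      (use t ineq in \<open>auto intro: continuous_on_subset[OF contM]\<close>)
  then show ?thesis by (simp add: M_def a_def)
qed

text \<open>Monotone convergence as the truncation is removed.\<close>

lemma moment_bound:
  assumes s: "0 < Re s" and T: "0 \<le> T"
  obtains B where "0 \<le> B"
    and "\<And>t. t \<in> {0..T} \<Longrightarrow> set_integrable (\<mu> t) {0..} (\<lambda>x. x powr (Re s - 1))"
    and "\<And>t. t \<in> {0..T} \<Longrightarrow> (LINT x:{0..}|\<mu> t. x powr (Re s - 1)) \<le> B"
proof -
  define \<sigma> where "\<sigma> = Re s"
  have \<sigma>: "0 < \<sigma>" using s by (simp add: \<sigma>_def)
  let ?s = "complex_of_real \<sigma>"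
  have s': "0 < Re ?s" using \<sigma> by simp
  define b where "b = \<alpha> * L powr \<gamma> * Re (K_transform \<kappa> (complex_of_real \<sigma>)) + 1"
  define a where "a = (LINT x:{0..}|\<mu> 0. x powr (\<sigma> - 1))"
  have a0: "0 \<le> a" unfolding a_def set_lebesgue_integral_def by (intro integral_nonneg_AE) auto
  have b0: "0 \<le> b" unfolding b_def using \<alpha> K_transform_real_nonneg[OF \<sigma>] by (intro add_nonneg_nonneg mult_nonneg_nonneg) auto
  define B where "B = 2 * a * exp (2 * b * T)"
  have B0: "0 \<le> B" using a0 by (simp add: B_def)
  have main: "(\<integral>\<^sup>+x. ennreal (indicator {0..} x *\<^sub>R x powr (\<sigma> - 1)) \<partial>\<mu> t) \<le> ennreal B" if t: "t \<in> {0..T}" for t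
  proof -
    have t0: "0 \<le> t" using t by simp
    \<comment> \<open>The factor \<open>1\<close> is the instance \<open>c = 1\<close> of the general test function.\<close>
    define f where "f m x = Re (1 * cutoff_cpowr L (1 / real (Suc m)) ?s x)" for m x
    have eps: "0 < 1 / real (Suc m)" for m by simp
    have test: "continuous_on {0..} (f m)" "bounded ((\<lambda>x. f m x / (1 + x)) ` {0..})" for m
      unfolding f_def by (rule cutoff_test_function[OF eps s'])+
    note weak = weak_formulation[OF test t0]
    have fe: "f m x = min x L powr \<sigma> / max (min x L) (1 / real (Suc m))" if "0 \<le> x" for m x
      unfolding f_def cutoff_cpowr_of_real[OF that L] by simp
    have f0: "0 \<le> f m x" if "0 \<le> x" for m x
      unfolding fe[OF that] by (simp add: le_max_iff_disj)
    have le: "ennreal (indicator {0..} x *\<^sub>R x powr (\<sigma> - 1)) \<le> (SUP m. ennreal (indicator {0..} x *\<^sub>R f m x))"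
      if x: "x \<in> {0..} \<longrightarrow> x \<le> L" for x
    proof (cases "0 < x")
      case True
      then obtain m where "inverse (real (Suc m)) < x" using reals_Archimedean by blast
      then have "f m x = x powr (\<sigma> - 1)"
        using x True L by (simp add: fe powr_diff inverse_eq_divide max_def)
      then have "ennreal (indicator {0..} x *\<^sub>R x powr (\<sigma> - 1)) = ennreal (indicator {0..} x *\<^sub>R f m x)" by simp
      also have "\<dots> \<le> (SUP m. ennreal (indicator {0..} x *\<^sub>R f m x))" by (rule SUP_upper) simp
      finally show ?thesis .
    qed (auto simp: indicator_def)
    have "(\<integral>\<^sup>+x. ennreal (indicator {0..} x *\<^sub>R x powr (\<sigma> - 1)) \<partial>\<mu> t)
        \<le> (\<integral>\<^sup>+x. (SUP m. ennreal (indicator {0..} x *\<^sub>R f m x)) \<partial>\<mu> t)"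
      using solution_support[OF t0] le by (intro nn_integral_mono_AE) (auto elim!: eventually_mono)
    also have "\<dots> = (SUP m. \<integral>\<^sup>+x. ennreal (indicator {0..} x *\<^sub>R f m x) \<partial>\<mu> t)"
    proof (rule nn_integral_monotone_convergence_SUP_AE)
      show "(\<lambda>x. ennreal (indicator {0..} x *\<^sub>R f m x)) \<in> borel_measurable (\<mu> t)" for m
        using weak(1)[of m] by (auto simp: set_integrable_def)
      have "f m x \<le> f (Suc m) x" if x: "0 \<le> x" for m x
        unfolding fe[OF x]
      proof (rule divide_left_mono)
        have "1 / real (Suc (Suc m)) \<le> 1 / real (Suc m)" by (simp add: frac_le)
        then show "max (min x L) (1 / real (Suc (Suc m))) \<le> max (min x L) (1 / real (Suc m))" by linarith
        show "0 < max (min x L) (1 / real (Suc m)) * max (min x L) (1 / real (Suc (Suc m)))"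
          by (intro mult_pos_pos) (auto simp: less_max_iff_disj)
      qed simp
      then show "AE x in \<mu> t. ennreal (indicator {0..} x *\<^sub>R f m x) \<le> ennreal (indicator {0..} x *\<^sub>R f (Suc m) x)" for m
        by (intro AE_I2 ennreal_leI) (auto simp: indicator_def)
    qed
    also have "\<dots> \<le> ennreal B"
    proof (rule SUP_least)
      fix m
      have "(\<integral>\<^sup>+x. ennreal (indicator {0..} x *\<^sub>R f m x) \<partial>\<mu> t) = ennreal (LINT x:{0..}|\<mu> t. f m x)"
        unfolding set_lebesgue_integral_def
        using weak(1)[of m] f0 by (intro nn_integral_eq_integral) (auto simp: set_integrable_def indicator_def)
      also have "(LINT x:{0..}|\<mu> t. f m x) \<le> 2 * a * exp (2 * b * t)"
        using cutoff_moment_bound[OF eps \<sigma> t0, of m] by (simp add: f_def a_def b_def)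
      also have "\<dots> \<le> B"
        unfolding B_def using t a0 b0 by (intro mult_left_mono) (auto intro: mult_left_mono)
      finally show "(\<integral>\<^sup>+x. ennreal (indicator {0..} x *\<^sub>R f m x) \<partial>\<mu> t) \<le> ennreal B"
        by (simp add: ennreal_leI)
    qed
    finally show ?thesis .
  qed
  have meas: "(\<lambda>x. indicator {0..} x *\<^sub>R x powr (\<sigma> - 1)) \<in> borel_measurable borel" by measurable
  show ?thesis
  proof (rule that[OF B0])
    fix t assume t: "t \<in> {0..T}"
    then have t0: "0 \<le> t" by simp
    have lt: "(\<integral>\<^sup>+x. ennreal (indicator {0..} x *\<^sub>R x powr (\<sigma> - 1)) \<partial>\<mu> t) < \<infinity>"
      using main[OF t] by (rule le_less_trans) simp
    then show "set_integrable (\<mu> t) {0..} (\<lambda>x. x powr (Re s - 1))"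
      unfolding set_integrable_def \<sigma>_def[symmetric] using meas t0
      by (intro integrableI_nonneg) auto
    show "(LINT x:{0..}|\<mu> t. x powr (Re s - 1)) \<le> B"
      unfolding set_lebesgue_integral_def \<sigma>_def[symmetric]
      using main[OF t] by (intro integral_real_bounded B0)
  qed
qed

section \<open>The evolution equation of the Mellin transform\<close>

abbreviation U where "U \<equiv> U_transform \<mu>"
abbreviation K where "K \<equiv> K_transform \<kappa>"

lemma set_measurable_cpowr:
  "0 \<le> t \<Longrightarrow> set_borel_measurable (\<mu> t) {0..} (\<lambda>x. complex_of_real x powr s)"
  unfolding set_borel_measurable_def by (simp add: measurable_cpowr_on)

lemma transform_integrable:
  assumes s: "0 < Re s" and t: "0 \<le> t"
  shows "set_integrable (\<mu> t) {0..} (\<lambda>x. complex_of_real x powr (s - 1))"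
proof -
  obtain B where "\<And>r. r \<in> {0..t} \<Longrightarrow> set_integrable (\<mu> r) {0..} (\<lambda>x. x powr (Re s - 1))"
    using moment_bound[OF s t] by blast
  then have "set_integrable (\<mu> t) {0..} (\<lambda>x. x powr (Re s - 1))" using t by simp
  then show ?thesis
    by (rule set_integrable_bound) (auto simp: cmod_cpowr set_measurable_cpowr[OF t])
qed

lemma cmod_transform_le:
  assumes s: "0 < Re s" and t: "0 \<le> t"
  shows "cmod (U t s) \<le> (LINT x:{0..}|\<mu> t. x powr (Re s - 1))"
proof -
  have "cmod (U t s) \<le> (LINT x:{0..}|\<mu> t. cmod (complex_of_real x powr (s - 1)))"
    unfolding U_transform_def mellin_def by (rule set_integral_norm_bound[OF transform_integrable[OF s t]])
  also have "\<dots> = (LINT x:{0..}|\<mu> t. x powr (Re s - 1))"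
    unfolding set_lebesgue_integral_def
    by (intro Bochner_Integration.integral_cong) (auto simp: indicator_def cmod_cpowr)
  finally show ?thesis .
qed

lemma set_measurable_Re_cpowr:
  assumes s: "0 < Re s" and t: "0 \<le> t"
  shows "set_borel_measurable (\<mu> t) {0..} (\<lambda>x. Re (c * complex_of_real x powr (s - 1)))"
proof -
  have "set_integrable (\<mu> t) {0..} (\<lambda>x. c * complex_of_real x powr (s - 1))"
    using transform_integrable[OF s t] by simp
  from integrable_Re[OF this[unfolded set_integrable_def]] show ?thesis
    by (auto simp: set_borel_measurable_def)
qed

lemma Re_transform:
  assumes s: "0 < Re s" and t: "0 \<le> t"
  shows "Re (c * U t s) = (LINT x:{0..}|\<mu> t. Re (c * complex_of_real x powr (s - 1)))"
proof -
  have i: "set_integrable (\<mu> t) {0..} (\<lambda>x. c * complex_of_real x powr (s - 1))"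
    using transform_integrable[OF s t] by simp
  have "Re (c * U t s) = Re (LINT x:{0..}|\<mu> t. c * complex_of_real x powr (s - 1))"
    by (simp add: U_transform_def mellin_def)
  also have "\<dots> = (LINT x:{0..}|\<mu> t. Re (c * complex_of_real x powr (s - 1)))"
    unfolding set_lebesgue_integral_def
    using integral_Re[OF i[unfolded set_integrable_def]] by simp
  finally show ?thesis .
qed

lemma Re_K_transform:
  assumes s: "0 < Re s"
  shows "Re (c * K s) = (LINT z:{0..1}|\<kappa>. Re (c * complex_of_real z powr (s - 1)))"
proof -
  have i: "set_integrable \<kappa> {0..1} (\<lambda>z. c * complex_of_real z powr (s - 1))"
    using kernel_moment[OF s] by simp
  have "Re (c * K s) = Re (LINT z:{0..1}|\<kappa>. c * complex_of_real z powr (s - 1))"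
    by (simp add: K_transform_eq[OF s])
  also have "\<dots> = (LINT z:{0..1}|\<kappa>. Re (c * complex_of_real z powr (s - 1)))"
    unfolding set_lebesgue_integral_def
    using integral_Re[OF i[unfolded set_integrable_def]] by simp
  finally show ?thesis .
qed

text \<open>By multiplicativity of the power, the gain term of \<open>x\<^sup>s\<^sup>-\<^sup>1\<close> is \<open>K(s) x\<^sup>s\<^sup>-\<^sup>1\<close>. This is where the Mellin
transform of the kernel appears.\<close>

lemma cutoff_gain_tendsto:
  assumes s: "0 < Re s" and x: "0 \<le> x" "x \<le> L"
  shows "(\<lambda>m. LINT z:{0..1}|\<kappa>. Re (c * cutoff_cpowr L (1 / real (Suc m)) s (x * z)))
    \<longlonglongrightarrow> Re (c * complex_of_real x powr (s - 1) * K s)"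
proof -
  have eps: "0 < 1 / real (Suc m)" for m by simp
  have "(\<lambda>m. LINT z:{0..1}|\<kappa>. Re (c * cutoff_cpowr L (1 / real (Suc m)) s (x * z)))
      \<longlonglongrightarrow> (LINT z:{0..1}|\<kappa>. Re (c * complex_of_real x powr (s - 1) * complex_of_real z powr (s - 1)))"
  proof (rule set_dominated_convergence(2))
    have "set_integrable \<kappa> {0..1} (\<lambda>z. c * complex_of_real x powr (s - 1) * complex_of_real z powr (s - 1))"
      using kernel_moment[OF s] by simp
    from integrable_Re[OF this[unfolded set_integrable_def]]
    show "set_borel_measurable \<kappa> {0..1} (\<lambda>z. Re (c * complex_of_real x powr (s - 1) * complex_of_real z powr (s - 1)))"
      by (auto simp: set_borel_measurable_def)
    show "set_borel_measurable \<kappa> {0..1} (\<lambda>z. Re (c * cutoff_cpowr L (1 / real (Suc m)) s (x * z)))" for m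
      using frag_integrand_cutoff(1)[OF eps s x, of c m]
      by (auto simp: set_borel_measurable_def set_integrable_def)
    show "set_integrable \<kappa> {0..1} (\<lambda>z. cmod c * x powr (Re s - 1) * cmod (complex_of_real z powr (s - 1)))"
      using set_integrable_norm[OF kernel_moment[OF s]] by simp
    show "AE z in \<kappa>. z \<in> {0..1} \<longrightarrow> norm (Re (c * cutoff_cpowr L (1 / real (Suc m)) s (x * z)))
        \<le> cmod c * x powr (Re s - 1) * cmod (complex_of_real z powr (s - 1))" for m
    proof (intro AE_I2 impI)
      fix z :: real assume z: "z \<in> {0..1}"
      have xz: "0 \<le> x * z" "x * z \<le> L" using x z mult_left_le[of z x] by auto
      have "norm (Re (c * cutoff_cpowr L (1 / real (Suc m)) s (x * z))) \<le> cmod c * cmod (cutoff_cpowr L (1 / real (Suc m)) s (x * z))"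
        using abs_Re_le_cmod[of "c * cutoff_cpowr L (1 / real (Suc m)) s (x * z)"] by (simp add: norm_mult)
      also have "\<dots> \<le> cmod c * (x * z) powr (Re s - 1)"
        by (intro mult_left_mono cmod_cutoff_cpowr_le_powr[OF L eps s xz]) simp
      finally show "norm (Re (c * cutoff_cpowr L (1 / real (Suc m)) s (x * z)))
        \<le> cmod c * x powr (Re s - 1) * cmod (complex_of_real z powr (s - 1))"
        using x z by (simp add: powr_mult cmod_cpowr mult.assoc)
    qed
    show "AE z in \<kappa>. z \<in> {0..1} \<longrightarrow> (\<lambda>m. Re (c * cutoff_cpowr L (1 / real (Suc m)) s (x * z)))
        \<longlonglongrightarrow> Re (c * complex_of_real x powr (s - 1) * complex_of_real z powr (s - 1))"
    proof (intro AE_I2 impI)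
      fix z :: real assume z: "z \<in> {0..1}"
      have xz: "0 \<le> x * z" "x * z \<le> L" using x z mult_left_le[of z x] by auto
      have "complex_of_real (x * z) powr (s - 1) = complex_of_real x powr (s - 1) * complex_of_real z powr (s - 1)"
        using x z by (intro cpowr_mult_of_real) auto
      then show "(\<lambda>m. Re (c * cutoff_cpowr L (1 / real (Suc m)) s (x * z)))
        \<longlonglongrightarrow> Re (c * complex_of_real x powr (s - 1) * complex_of_real z powr (s - 1))"
        using tendsto_Re[OF tendsto_mult_left[OF cutoff_cpowr_tendsto[OF s xz], of c]] by (simp add: mult.assoc)
    qed
  qed
  then show ?thesis by (simp only: Re_K_transform[OF s])
qed

lemma frag_integrand_cutoff_bound:
  assumes \<epsilon>: "0 < \<epsilon>" and s: "0 < Re s" and x: "0 \<le> x" "x \<le> L"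
  shows "\<bar>frag_integrand \<alpha> \<gamma> \<kappa> (\<lambda>x. Re (c * cutoff_cpowr L \<epsilon> s x)) x\<bar>
    \<le> \<alpha> * L powr \<gamma> * cmod c * (1 + Re (K (complex_of_real (Re s)))) * x powr (Re s - 1)"
proof -
  let ?\<phi> = "\<lambda>x. Re (c * cutoff_cpowr L \<epsilon> s x)" and ?N = "cmod (cutoff_cpowr L \<epsilon> s x)"
    and ?k = "Re (K (complex_of_real (Re s)))"
  have k0: "0 \<le> ?k" using s by (rule K_transform_real_nonneg)
  have "\<bar>?\<phi> x\<bar> \<le> cmod c * ?N"
    using abs_Re_le_cmod[of "c * cutoff_cpowr L \<epsilon> s x"] by (simp add: norm_mult)
  then have "\<bar>- ?\<phi> x + (LINT z:{0..1}|\<kappa>. ?\<phi> (x * z))\<bar> \<le> cmod c * (1 + ?k) * ?N"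
    using frag_integrand_cutoff(2)[OF \<epsilon> s x, of c] by (simp add: algebra_simps)
  also have "\<dots> \<le> cmod c * (1 + ?k) * x powr (Re s - 1)"
    using k0 by (intro mult_left_mono cmod_cutoff_cpowr_le_powr[OF L \<epsilon> s x]) auto
  finally have A: "\<bar>- ?\<phi> x + (LINT z:{0..1}|\<kappa>. ?\<phi> (x * z))\<bar> \<le> cmod c * (1 + ?k) * x powr (Re s - 1)" .
  have "\<bar>frag_integrand \<alpha> \<gamma> \<kappa> ?\<phi> x\<bar> = \<alpha> * x powr \<gamma> * \<bar>- ?\<phi> x + (LINT z:{0..1}|\<kappa>. ?\<phi> (x * z))\<bar>"
    unfolding frag_integrand_def abs_mult using \<alpha> by simp
  also have "\<dots> \<le> \<alpha> * L powr \<gamma> * (cmod c * (1 + ?k) * x powr (Re s - 1))"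
    using \<alpha> \<gamma> x by (intro mult_mono A mult_left_mono powr_mono2) auto
  finally show ?thesis by (simp add: mult.assoc)
qed

text \<open>Dominated convergence in the weak formulation for truncated powers, three times: in the kernel
variable, in \<open>x\<close>, and in time. The dominating functions come from \<open>moment_bound\<close>, which holds uniformly on \<open>{0..t}\<close>.\<close>

lemma transform_equation_Re:
  assumes s: "0 < Re s" and t: "0 \<le> t"
  shows "((\<lambda>r. Re (c * (complex_of_real \<alpha> * (K s - 1) * U r (s + complex_of_real \<gamma>)))) has_integral
           (Re (c * U t s) - Re (c * U 0 s))) {0..t}"
proof -
  have s\<gamma>: "0 < Re (s + complex_of_real \<gamma>)" using s \<gamma> by simp
  define \<phi> where "\<phi> m x = Re (c * cutoff_cpowr L (1 / real (Suc m)) s x)" for m x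
  have eps: "0 < 1 / real (Suc m)" for m by simp
  have test: "continuous_on {0..} (\<phi> m)" "bounded ((\<lambda>x. \<phi> m x / (1 + x)) ` {0..})" for m
    unfolding \<phi>_def by (rule cutoff_test_function[OF eps s])+
  note weak = weak_formulation[OF test]
  obtain B where B0: "0 \<le> B"
    and int: "\<And>r. r \<in> {0..t} \<Longrightarrow> set_integrable (\<mu> r) {0..} (\<lambda>x. x powr (Re s - 1))"
    and B: "\<And>r. r \<in> {0..t} \<Longrightarrow> (LINT x:{0..}|\<mu> r. x powr (Re s - 1)) \<le> B"
    using moment_bound[OF s t] by blast
  have U_lim: "(\<lambda>m. LINT x:{0..}|\<mu> r. \<phi> m x) \<longlonglongrightarrow> Re (c * U r s)" if r: "r \<in> {0..t}" for r
    unfolding Re_transform[OF s, of r c, OF atLeastAtMost_iff[THEN iffD1, OF r, THEN conjunct1]]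
  proof (rule set_dominated_convergence(2))
    have r0: "0 \<le> r" using r by simp
    show "set_borel_measurable (\<mu> r) {0..} (\<lambda>x. Re (c * complex_of_real x powr (s - 1)))"
      by (rule set_measurable_Re_cpowr[OF s r0])
    show "set_borel_measurable (\<mu> r) {0..} (\<phi> m)" for m
      using weak(1)[OF r0, of m] by (auto simp: set_borel_measurable_def set_integrable_def)
    show "set_integrable (\<mu> r) {0..} (\<lambda>x. cmod c * x powr (Re s - 1))" using int[OF r] by simp
    show "AE x in \<mu> r. x \<in> {0..} \<longrightarrow> norm (\<phi> m x) \<le> cmod c * x powr (Re s - 1)" for m
      using solution_support[OF r0]
    proof (eventually_elim, intro impI)
      fix x :: real assume x: "x \<in> {0..} \<longrightarrow> x \<le> L" "x \<in> {0..}"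
      have "norm (\<phi> m x) \<le> cmod c * cmod (cutoff_cpowr L (1 / real (Suc m)) s x)"
        unfolding \<phi>_def using abs_Re_le_cmod[of "c * cutoff_cpowr L (1 / real (Suc m)) s x"] by (simp add: norm_mult)
      also have "\<dots> \<le> cmod c * x powr (Re s - 1)"
        using x by (intro mult_left_mono cmod_cutoff_cpowr_le_powr[OF L eps s]) auto
      finally show "norm (\<phi> m x) \<le> cmod c * x powr (Re s - 1)" .
    qed
    show "AE x in \<mu> r. x \<in> {0..} \<longrightarrow> (\<lambda>m. \<phi> m x) \<longlonglongrightarrow> Re (c * complex_of_real x powr (s - 1))"
      using solution_support[OF r0]
    proof (eventually_elim, intro impI)
      fix x :: real assume "x \<in> {0..} \<longrightarrow> x \<le> L" "x \<in> {0..}"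
      then show "(\<lambda>m. \<phi> m x) \<longlonglongrightarrow> Re (c * complex_of_real x powr (s - 1))"
        unfolding \<phi>_def by (intro tendsto_Re tendsto_mult_left cutoff_cpowr_tendsto[OF s]) auto
    qed
  qed
  define F where "F m r = (LINT x:{0..}|\<mu> r. frag_integrand \<alpha> \<gamma> \<kappa> (\<phi> m) x)" for m r
  define D where "D = \<alpha> * L powr \<gamma> * cmod c * (1 + Re (K (complex_of_real (Re s))))"
  have D0: "0 \<le> D"
    unfolding D_def using \<alpha> K_transform_real_nonneg[OF s] by (intro mult_nonneg_nonneg) auto
  let ?G = "\<lambda>r. Re (c * (complex_of_real \<alpha> * (K s - 1) * U r (s + complex_of_real \<gamma>)))"
  have fbound: "\<bar>frag_integrand \<alpha> \<gamma> \<kappa> (\<phi> m) x\<bar> \<le> D * x powr (Re s - 1)" if "0 \<le> x" "x \<le> L" for m x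
    unfolding D_def \<phi>_def using frag_integrand_cutoff_bound[OF eps s that] .
  have F_lim: "(\<lambda>m. F m r) \<longlonglongrightarrow> ?G r" if r: "r \<in> {0..t}" for r
  proof -
    have r0: "0 \<le> r" using r by simp
    have G: "?G r = (LINT x:{0..}|\<mu> r. Re (c * (complex_of_real \<alpha> * (K s - 1)) * complex_of_real x powr (s + complex_of_real \<gamma> - 1)))"
      using Re_transform[OF s\<gamma> r0, of "c * (complex_of_real \<alpha> * (K s - 1))"] by (simp add: mult.assoc)
    show ?thesis
      unfolding F_def G
    proof (rule set_dominated_convergence(2))
      show "set_borel_measurable (\<mu> r) {0..} (\<lambda>x. Re (c * (complex_of_real \<alpha> * (K s - 1)) * complex_of_real x powr (s + complex_of_real \<gamma> - 1)))"
        by (rule set_measurable_Re_cpowr[OF s\<gamma> r0])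
      show "set_borel_measurable (\<mu> r) {0..} (frag_integrand \<alpha> \<gamma> \<kappa> (\<phi> m))" for m
        using weak(2)[OF r0, of m] by (auto simp: set_borel_measurable_def set_integrable_def)
      show "set_integrable (\<mu> r) {0..} (\<lambda>x. D * x powr (Re s - 1))" using int[OF r] by simp
      show "AE x in \<mu> r. x \<in> {0..} \<longrightarrow> norm (frag_integrand \<alpha> \<gamma> \<kappa> (\<phi> m) x) \<le> D * x powr (Re s - 1)" for m
        using solution_support[OF r0] by eventually_elim (use fbound in auto)
      show "AE x in \<mu> r. x \<in> {0..} \<longrightarrow> (\<lambda>m. frag_integrand \<alpha> \<gamma> \<kappa> (\<phi> m) x) \<longlonglongrightarrow>
          Re (c * (complex_of_real \<alpha> * (K s - 1)) * complex_of_real x powr (s + complex_of_real \<gamma> - 1))"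
        using solution_support[OF r0]
      proof (eventually_elim, intro impI)
        fix x :: real assume "x \<in> {0..} \<longrightarrow> x \<le> L" "x \<in> {0..}"
        then have x: "0 \<le> x" "x \<le> L" by auto
        have "(\<lambda>m. frag_integrand \<alpha> \<gamma> \<kappa> (\<phi> m) x) \<longlonglongrightarrow>
            \<alpha> * x powr \<gamma> * (- Re (c * complex_of_real x powr (s - 1)) + Re (c * complex_of_real x powr (s - 1) * K s))"
          unfolding frag_integrand_def \<phi>_def
          by (intro tendsto_mult_left tendsto_add tendsto_minus cutoff_gain_tendsto[OF s x]
              tendsto_Re cutoff_cpowr_tendsto[OF s x])
        also have "\<alpha> * x powr \<gamma> * (- Re (c * complex_of_real x powr (s - 1)) + Re (c * complex_of_real x powr (s - 1) * K s))
            = Re (complex_of_real (\<alpha> * x powr \<gamma>) * (c * complex_of_real x powr (s - 1) * K s - c * complex_of_real x powr (s - 1)))"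
          by (simp only: Re_complex_of_real Im_complex_of_real times_complex.simps minus_complex.simps mult_zero_left diff_zero) simp
        also have "complex_of_real (\<alpha> * x powr \<gamma>) * (c * complex_of_real x powr (s - 1) * K s - c * complex_of_real x powr (s - 1))
            = c * (complex_of_real \<alpha> * (K s - 1)) * (complex_of_real x powr (s - 1) * complex_of_real x powr complex_of_real \<gamma>)"
          using x by (simp add: powr_of_real algebra_simps)
        also have "complex_of_real x powr (s - 1) * complex_of_real x powr complex_of_real \<gamma> = complex_of_real x powr (s + complex_of_real \<gamma> - 1)"
          by (simp add: powr_add[symmetric] algebra_simps)
        finally show "(\<lambda>m. frag_integrand \<alpha> \<gamma> \<kappa> (\<phi> m) x) \<longlonglongrightarrow>
          Re (c * (complex_of_real \<alpha> * (K s - 1)) * complex_of_real x powr (s + complex_of_real \<gamma> - 1))" .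
      qed
    qed
  qed
  have Fbound: "\<bar>F m r\<bar> \<le> D * B" if r: "r \<in> {0..t}" for m r
  proof -
    have r0: "0 \<le> r" using r by simp
    have "\<bar>F m r\<bar> \<le> (LINT x:{0..}|\<mu> r. \<bar>frag_integrand \<alpha> \<gamma> \<kappa> (\<phi> m) x\<bar>)"
      unfolding F_def using set_integral_norm_bound[OF weak(2)[OF r0, of m]] by simp
    also have "\<dots> \<le> (LINT x:{0..}|\<mu> r. D * x powr (Re s - 1))"
    proof (rule set_integral_mono_AE)
      show "set_integrable (\<mu> r) {0..} (\<lambda>x. \<bar>frag_integrand \<alpha> \<gamma> \<kappa> (\<phi> m) x\<bar>)"
        using weak(2)[OF r0] by (rule set_integrable_abs)
      show "set_integrable (\<mu> r) {0..} (\<lambda>x. D * x powr (Re s - 1))" using int[OF r] by simp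
      show "AE x\<in>{0..} in \<mu> r. \<bar>frag_integrand \<alpha> \<gamma> \<kappa> (\<phi> m) x\<bar> \<le> D * x powr (Re s - 1)"
        using solution_support[OF r0] by eventually_elim (use fbound in auto)
    qed
    also have "\<dots> \<le> D * B" using B[OF r] D0 by (simp add: mult_left_mono)
    finally show ?thesis .
  qed
  have Fmeas: "set_borel_measurable lborel {0..t} (F m)" for m
    using weak(3)[OF t, of m] unfolding F_def[symmetric]
    by (auto simp: set_borel_measurable_def set_integrable_def)
  have Gmeas: "set_borel_measurable lborel {0..t} ?G"
    unfolding set_borel_measurable_def
  proof (rule borel_measurable_LIMSEQ_metric)
    show "(\<lambda>r. indicator {0..t} r *\<^sub>R F m r) \<in> borel_measurable lborel" for m
      using Fmeas by (simp add: set_borel_measurable_def)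
    show "(\<lambda>m. indicator {0..t} r *\<^sub>R F m r) \<longlonglongrightarrow> indicator {0..t} r *\<^sub>R ?G r" for r
    proof (cases "r \<in> {0..t}")
      case True
      show ?thesis by (intro tendsto_scaleR tendsto_const F_lim[OF True])
    next
      case False
      then have "indicator {0..t} r = (0::real)" by (rule indicator_simps)
      then show ?thesis by (simp only: scaleR_zero_left tendsto_const)
    qed
  qed
  have const: "set_integrable lborel {0..t} (\<lambda>_. D * B)"
    by (intro borel_integrable_atLeastAtMost') simp
  have Fb: "AE r in lborel. r \<in> {0..t} \<longrightarrow> norm (F m r) \<le> D * B" for m
    using Fbound by (intro AE_I2) auto
  have Fl: "AE r in lborel. r \<in> {0..t} \<longrightarrow> (\<lambda>m. F m r) \<longlonglongrightarrow> ?G r"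
    using F_lim by (intro AE_I2) auto
  note dct = set_dominated_convergence[OF Gmeas Fmeas const Fb Fl]
  have t': "t \<in> {0..t}" "0 \<in> {0..t}" using t by auto
  have "(\<lambda>m. (LINT x:{0..}|\<mu> 0. \<phi> m x) + (LINT r:{0..t}|lborel. F m r))
      \<longlonglongrightarrow> Re (c * U 0 s) + (LINT r:{0..t}|lborel. ?G r)"
    by (intro tendsto_add U_lim t' dct(2))
  moreover have "(\<lambda>m. LINT x:{0..}|\<mu> t. \<phi> m x) = (\<lambda>m. (LINT x:{0..}|\<mu> 0. \<phi> m x) + (LINT r:{0..t}|lborel. F m r))"
    using weak(4)[OF t] by (simp add: F_def)
  ultimately have "Re (c * U t s) = Re (c * U 0 s) + (LINT r:{0..t}|lborel. ?G r)"
    using LIMSEQ_unique[OF U_lim[OF t'(1)]] by simp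
  moreover have "?G integrable_on {0..t}" "(LINT r:{0..t}|lborel. ?G r) = integral {0..t} ?G"
    using set_borel_integral_eq_integral[OF dct(1)] by auto
  ultimately show ?thesis
    by (simp add: has_integral_integrable_integral)
qed

text \<open>Real and imaginary parts are the cases \<open>c = 1\<close> and \<open>c = -\<i>\<close> of the previous lemma.\<close>

lemma transform_has_integral:
  assumes s: "0 < Re s" and t: "0 \<le> t"
  shows "((\<lambda>r. complex_of_real \<alpha> * (K s - 1) * U r (s + complex_of_real \<gamma>)) has_integral (U t s - U 0 s)) {0..t}"
proof -
  let ?G = "\<lambda>r. complex_of_real \<alpha> * (K s - 1) * U r (s + complex_of_real \<gamma>)"
  have re: "((\<lambda>r. Re (?G r)) has_integral (Re (U t s) - Re (U 0 s))) {0..t}"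
    using transform_equation_Re[OF s t, of 1] by (simp only: mult_1)
  have "Re (- \<i> * z) = Im z" for z by simp
  then have im: "((\<lambda>r. Im (?G r)) has_integral (Im (U t s) - Im (U 0 s))) {0..t}"
    using transform_equation_Re[OF s t, of "- \<i>"] by (simp only:)
  have "((\<lambda>r. complex_of_real (Re (?G r)) + \<i> * complex_of_real (Im (?G r))) has_integral
      complex_of_real (Re (U t s) - Re (U 0 s)) + \<i> * complex_of_real (Im (U t s) - Im (U 0 s))) {0..t}"
    by (intro has_integral_add has_integral_mult_right has_integral_of_real re im)
  moreover have "complex_of_real (Re (U t s) - Re (U 0 s)) + \<i> * complex_of_real (Im (U t s) - Im (U 0 s)) = U t s - U 0 s"
    by (simp add: complex_eq_iff)
  ultimately show ?thesis by (simp only: complex_eq[symmetric])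
qed

text \<open>Continuity in time follows from the integrated equation itself; it upgrades that equation to a
pointwise derivative.\<close>

lemma continuous_on_transform:
  assumes s: "0 < Re s"
  shows "continuous_on {0..T} (\<lambda>t. U t s)"
proof (cases "0 \<le> T")
  case True
  let ?G = "\<lambda>r. complex_of_real \<alpha> * (K s - 1) * U r (s + complex_of_real \<gamma>)"
  have "continuous_on {0..T} (\<lambda>t. U 0 s + integral {0..t} ?G)"
    using transform_has_integral[OF s True]
    by (intro continuous_intros indefinite_integral_continuous_1) blast
  then show ?thesis
    by (rule continuous_on_eq) (use integral_unique[OF transform_has_integral[OF s]] in auto)
qed simp

lemma transform_has_vector_derivative:
  assumes s: "0 < Re s" and a: "0 \<le> a" and t: "t \<in> {a..b}"
  shows "((\<lambda>t. U t s) has_vector_derivative complex_of_real \<alpha> * (K s - 1) * U t (s + complex_of_real \<gamma>))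
    (at t within {a..b})"
proof -
  let ?G = "\<lambda>r. complex_of_real \<alpha> * (K s - 1) * U r (s + complex_of_real \<gamma>)"
  have "((\<lambda>u. integral {0..u} ?G) has_vector_derivative ?G t) (at t within {0..b})"
    using s \<gamma> a t by (intro integral_has_vector_derivative continuous_intros continuous_on_transform) auto
  then have "((\<lambda>u. integral {0..u} ?G) has_vector_derivative ?G t) (at t within {a..b})"
    by (rule has_vector_derivative_within_subset) (use a in auto)
  from has_vector_derivative_add[OF has_vector_derivative_const this]
  have "((\<lambda>u. U 0 s + integral {0..u} ?G) has_vector_derivative ?G t) (at t within {a..b})"
    by simp
  then show ?thesis
    by (rule has_vector_derivative_transform[rotated 2])
      (use t a integral_unique[OF transform_has_integral[OF s]] in auto)
qed

section \<open>Taylor series of the transforms and the error\<close>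

lemma shifted_moment_le:
  assumes s: "0 < Re s" and t: "0 \<le> t" and a: "0 \<le> a"
  shows "(LINT x:{0..}|\<mu> t. x powr (Re s + a - 1)) \<le> L powr a * (LINT x:{0..}|\<mu> t. x powr (Re s - 1))"
proof -
  have int: "set_integrable (\<mu> t) {0..} (\<lambda>x. x powr (Re z - 1))" if "0 < Re z" for z
    using moment_bound[OF that t] t by (metis atLeastAtMost_iff order_refl)
  have "(LINT x:{0..}|\<mu> t. x powr (Re s + a - 1)) \<le> (LINT x:{0..}|\<mu> t. L powr a * x powr (Re s - 1))"
  proof (rule set_integral_mono_AE)
    show "set_integrable (\<mu> t) {0..} (\<lambda>x. x powr (Re s + a - 1))"
      using int[of "s + complex_of_real a"] s a by simp
    show "set_integrable (\<mu> t) {0..} (\<lambda>x. L powr a * x powr (Re s - 1))" using int[OF s] by simp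
    show "AE x\<in>{0..} in \<mu> t. x powr (Re s + a - 1) \<le> L powr a * x powr (Re s - 1)"
      using solution_support[OF t]
    proof (eventually_elim, intro impI)
      fix x :: real assume "x \<in> {0..} \<longrightarrow> x \<le> L" "x \<in> {0..}"
      then have x: "0 \<le> x" "x \<le> L" by auto
      have "x powr (Re s + a - 1) = x powr a * x powr (Re s - 1)"
        by (simp add: powr_add[symmetric] algebra_simps)
      also have "\<dots> \<le> L powr a * x powr (Re s - 1)"
        using x a by (intro mult_right_mono powr_mono2) auto
      finally show "x powr (Re s + a - 1) \<le> L powr a * x powr (Re s - 1)" .
    qed
  qed
  then show ?thesis by simp
qed

lemma cmod_shifted_transform_le:
  assumes s: "0 < Re s" and t: "0 \<le> t"
  shows "cmod (U t (s + complex_of_real (real n * \<gamma>)))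
    \<le> (L powr \<gamma>) ^ n * (LINT x:{0..}|\<mu> t. x powr (Re s - 1))"
proof -
  have "0 \<le> real n * \<gamma>" using \<gamma> by simp
  then have "cmod (U t (s + complex_of_real (real n * \<gamma>))) \<le> (LINT x:{0..}|\<mu> t. x powr (Re s + real n * \<gamma> - 1))"
    using cmod_transform_le[of "s + complex_of_real (real n * \<gamma>)" t] s t by simp
  also have "\<dots> \<le> L powr (real n * \<gamma>) * (LINT x:{0..}|\<mu> t. x powr (Re s - 1))"
    using shifted_moment_le[OF s t \<open>0 \<le> real n * \<gamma>\<close>] .
  finally show ?thesis by (simp only: power_mult_powr[OF L])
qed

text \<open>Up to \<open>\<alpha>\<^sup>n\<close>, the coefficient of \<open>U(t,s+n\<gamma>)\<close> in the \<open>n\<close>-th time derivative of \<open>U(t,s)\<close>.\<close>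

definition loss_gain_product :: "complex \<Rightarrow> nat \<Rightarrow> complex" where
  "loss_gain_product s n = (\<Prod>j<n. K (s + complex_of_real (real j * \<gamma>)) - 1)"

text \<open>Each derivative costs at most a factor \<open>\<alpha> (1 + B) L\<^sup>\<gamma>\<close>, thanks to the support in \<open>[0,L]\<close>. The
Taylor remainder is therefore dominated by a term of an exponential series.\<close>

lemma transform_Taylor_sums:
  assumes s: "0 < Re s" and t: "0 \<le> t" and h: "0 \<le> h"
    and B: "\<And>j. cmod (K (s + complex_of_real (real j * \<gamma>))) \<le> B"
  shows "(\<lambda>n. complex_of_real ((\<alpha> * h) ^ n / fact n) * loss_gain_product s n * U t (s + complex_of_real (real n * \<gamma>))) sums U (t + h) s"
proof -
  define D where "D n r = complex_of_real (\<alpha> ^ n) * loss_gain_product s n * U r (s + complex_of_real (real n * \<gamma>))" for n r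
  obtain M where M0: "0 \<le> M" and "\<And>r. r \<in> {0..t + h} \<Longrightarrow> set_integrable (\<mu> r) {0..} (\<lambda>x. x powr (Re s - 1))"
    and M: "\<And>r. r \<in> {0..t + h} \<Longrightarrow> (LINT x:{0..}|\<mu> r. x powr (Re s - 1)) \<le> M"
    by (rule moment_bound[OF s add_nonneg_nonneg[OF t h]]) (rule that)
  have B0: "0 \<le> B" using B[of 0] norm_ge_zero order_trans by blast
  have sn: "0 < Re (s + complex_of_real (real n * \<gamma>))" for n
    using s \<gamma> by (simp add: add_pos_nonneg)
  have deriv: "(D n has_vector_derivative D (Suc n) r) (at r within {t..t + h})" if "r \<in> {t..t + h}" for n r
  proof -
    have "((\<lambda>r. (complex_of_real (\<alpha> ^ n) * loss_gain_product s n) * U r (s + complex_of_real (real n * \<gamma>))) has_vector_derivative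
      (complex_of_real (\<alpha> ^ n) * loss_gain_product s n) * (complex_of_real \<alpha> * (K (s + complex_of_real (real n * \<gamma>)) - 1) *
        U r (s + complex_of_real (real n * \<gamma>) + complex_of_real \<gamma>))) (at r within {t..t + h})"
      by (intro has_vector_derivative_mult_right transform_has_vector_derivative sn t that)
    moreover have eq: "s + complex_of_real (real n * \<gamma>) + complex_of_real \<gamma> = s + complex_of_real (real (Suc n) * \<gamma>)"
      by (simp add: algebra_simps)
    moreover have "complex_of_real (\<alpha> ^ Suc n) * loss_gain_product s (Suc n)
        = complex_of_real (\<alpha> ^ n) * loss_gain_product s n * (complex_of_real \<alpha> * (K (s + complex_of_real (real n * \<gamma>)) - 1))"
      by (simp add: loss_gain_product_def)
    ultimately show ?thesis
      unfolding D_def by (simp only: mult.assoc)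
  qed
  define X where "X = \<alpha> * (1 + B) * L powr \<gamma>"
  have X0: "0 \<le> X" using \<alpha> B0 by (simp add: X_def)
  have Dle: "cmod (D n r) \<le> X ^ n * M" if r: "r \<in> {t..t + h}" for n r
  proof -
    have r0: "0 \<le> r" "r \<in> {0..t + h}" using r t by auto
    have "cmod (U r (s + complex_of_real (real n * \<gamma>))) \<le> (L powr \<gamma>) ^ n * M"
      using cmod_shifted_transform_le[OF s r0(1), of n] M[OF r0(2)]
      by (meson mult_left_mono order_trans powr_ge_zero zero_le_power)
    moreover have "cmod (loss_gain_product s n) \<le> (1 + B) ^ n"
      unfolding loss_gain_product_def by (rule prod_minus_one_bounds(1)) (rule B)
    ultimately have "cmod (D n r) \<le> \<alpha> ^ n * (1 + B) ^ n * ((L powr \<gamma>) ^ n * M)"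
      unfolding D_def norm_mult norm_of_real using \<alpha> B0 M0 by (intro mult_mono) auto
    then show ?thesis by (simp add: X_def power_mult_distrib mult.assoc)
  qed
  have rem: "cmod (U (t + h) s - (\<Sum>i<Suc q. (h ^ i / fact i) *\<^sub>R D i t)) \<le> M * X * h * ((X * h) ^ q /\<^sub>R fact q)" for q
  proof -
    have "((\<lambda>x. ((t + h - x) ^ (Suc q - 1) / fact (Suc q - 1)) *\<^sub>R D (Suc q) x) has_integral
        D 0 (t + h) - (\<Sum>i<Suc q. ((t + h - t) ^ i / fact i) *\<^sub>R D i t)) {t..t + h}"
      by (rule Taylor_has_integral) (use h deriv in auto)
    then have I: "((\<lambda>x. ((t + h - x) ^ q / fact q) *\<^sub>R D (Suc q) x) has_integral
        U (t + h) s - (\<Sum>i<Suc q. (h ^ i / fact i) *\<^sub>R D i t)) {t..t + h}"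
      by (simp add: D_def loss_gain_product_def)
    have "cmod (U (t + h) s - (\<Sum>i<Suc q. (h ^ i / fact i) *\<^sub>R D i t)) \<le> (h ^ q / fact q * (X ^ Suc q * M)) * measure lborel {t..t + h}"
    proof (rule has_integral_bound_real[OF _ finite.emptyI I])
      show "0 \<le> h ^ q / fact q * (X ^ Suc q * M)" using h X0 M0 by simp
      fix x assume x: "x \<in> {t..t + h} - {}"
      have "(t + h - x) ^ q / fact q \<le> h ^ q / fact q"
        using x by (intro divide_right_mono power_mono) auto
      then show "cmod (((t + h - x) ^ q / fact q) *\<^sub>R D (Suc q) x) \<le> h ^ q / fact q * (X ^ Suc q * M)"
        unfolding norm_scaleR using x h Dle[of x "Suc q"] by (intro mult_mono) auto
    qed
    then show ?thesis using h by (simp add: power_mult_distrib mult_ac divide_inverse)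
  qed
  have "(\<lambda>q. (X * h) ^ q /\<^sub>R fact q) \<longlonglongrightarrow> 0"
    by (rule summable_LIMSEQ_zero[OF sums_summable[OF exp_converges]])
  then have zero: "(\<lambda>q. M * X * h * ((X * h) ^ q /\<^sub>R fact q)) \<longlonglongrightarrow> 0"
    by (rule tendsto_mult_right_zero)
  have "\<forall>\<^sub>F q in sequentially. cmod (U (t + h) s - (\<Sum>i<Suc q. (h ^ i / fact i) *\<^sub>R D i t))
      \<le> M * X * h * ((X * h) ^ q /\<^sub>R fact q)"
    by (rule always_eventually) (rule allI, rule rem)
  from Lim_null_comparison[OF this zero]
  have "(\<lambda>q. U (t + h) s - (\<Sum>i<Suc q. (h ^ i / fact i) *\<^sub>R D i t)) \<longlonglongrightarrow> 0" .
  from tendsto_diff[OF tendsto_const[of "U (t + h) s"] this]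
  have "(\<lambda>q. \<Sum>i<Suc q. (h ^ i / fact i) *\<^sub>R D i t) \<longlonglongrightarrow> U (t + h) s" by simp
  then have "(\<lambda>i. (h ^ i / fact i) *\<^sub>R D i t) sums U (t + h) s"
    unfolding sums_def by (rule LIMSEQ_imp_Suc)
  moreover have "(h ^ i / fact i) *\<^sub>R D i t = complex_of_real ((\<alpha> * h) ^ i / fact i) * loss_gain_product s i * U t (s + complex_of_real (real i * \<gamma>))" for i
    by (simp add: D_def scaleR_conv_of_real power_mult_distrib mult_ac)
  ultimately show ?thesis by simp
qed

text \<open>Termwise integration of the exponential series of the damping factor.\<close>

lemma W_transform_sums:
  assumes s: "0 < Re s" and t: "0 \<le> t" and h: "0 \<le> h"
  shows "(\<lambda>n. complex_of_real ((- (\<alpha> * h)) ^ n / fact n) * U t (s + complex_of_real (real n * \<gamma>))) sums W_transform \<alpha> \<gamma> \<mu> t h s"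
proof -
  let ?c = "\<lambda>n. complex_of_real ((- (\<alpha> * h)) ^ n / fact n)"
  define f where "f n x = indicator {0..} x *\<^sub>R (?c n * complex_of_real x powr (s + complex_of_real (real n * \<gamma>) - 1))" for n x
  define M where "M = (LINT x:{0..}|\<mu> t. x powr (Re s - 1))"
  have sn: "0 < Re (s + complex_of_real (real n * \<gamma>))" for n
    using s \<gamma> by (simp add: add_pos_nonneg)
  have int: "integrable (\<mu> t) (f n)" for n
  proof -
    have "set_integrable (\<mu> t) {0..} (\<lambda>x. ?c n * complex_of_real x powr (s + complex_of_real (real n * \<gamma>) - 1))"
      by (intro set_integrable_mult_right transform_integrable sn t)
    then show ?thesis by (simp add: set_integrable_def f_def[abs_def])
  qed
  have U: "(\<integral>x. f n x \<partial>\<mu> t) = ?c n * U t (s + complex_of_real (real n * \<gamma>))" for n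
  proof -
    have "(\<integral>x. f n x \<partial>\<mu> t) = (LINT x:{0..}|\<mu> t. ?c n * complex_of_real x powr (s + complex_of_real (real n * \<gamma>) - 1))"
      unfolding f_def set_lebesgue_integral_def ..
    also have "\<dots> = ?c n * (LINT x:{0..}|\<mu> t. complex_of_real x powr (s + complex_of_real (real n * \<gamma>) - 1))"
      by (rule set_integral_mult_right)
    finally show ?thesis unfolding U_transform_def mellin_def .
  qed
  have pw: "complex_of_real x powr (s + complex_of_real (real n * \<gamma>) - 1)
      = complex_of_real x powr (s - 1) * complex_of_real ((x powr \<gamma>) ^ n)" if x: "0 \<le> x" for x n
  proof (cases "x = 0")
    case False
    then have x': "0 < x" using x by simp
    have "complex_of_real x powr (s + complex_of_real (real n * \<gamma>) - 1)
        = complex_of_real x powr (s - 1) * complex_of_real x powr complex_of_real (real n * \<gamma>)"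
      by (simp add: powr_add[symmetric] algebra_simps)
    also have "complex_of_real x powr complex_of_real (real n * \<gamma>) = complex_of_real ((x powr \<gamma>) ^ n)"
      using powr_of_real[OF x, of "real n * \<gamma>"] power_mult_powr[OF x', of n \<gamma>] by simp
    finally show ?thesis .
  qed simp
  have sums: "(\<lambda>n. f n x) sums (indicator {0..} x *\<^sub>R (complex_of_real x powr (s - 1) * complex_of_real (exp (- \<alpha> * h * x powr \<gamma>))))"
    and nsum: "summable (\<lambda>n. norm (f n x))" for x
  proof -
    show "(\<lambda>n. f n x) sums (indicator {0..} x *\<^sub>R (complex_of_real x powr (s - 1) * complex_of_real (exp (- \<alpha> * h * x powr \<gamma>))))"
    proof (cases "0 \<le> x")
      case True
      have "(\<lambda>n. (- \<alpha> * h * x powr \<gamma>) ^ n /\<^sub>R fact n) sums exp (- \<alpha> * h * x powr \<gamma>)" by (rule exp_converges)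
      then have "(\<lambda>n. complex_of_real x powr (s - 1) * complex_of_real ((- \<alpha> * h * x powr \<gamma>) ^ n /\<^sub>R fact n)) sums
          (complex_of_real x powr (s - 1) * complex_of_real (exp (- \<alpha> * h * x powr \<gamma>)))"
        by (intro sums_mult sums_of_real)
      moreover have "f n x = complex_of_real x powr (s - 1) * complex_of_real ((- \<alpha> * h * x powr \<gamma>) ^ n /\<^sub>R fact n)" for n
      proof -
        have "(- \<alpha> * h * x powr \<gamma>) ^ n = (- (\<alpha> * h)) ^ n * (x powr \<gamma>) ^ n"
          by (simp add: power_mult_distrib[symmetric])
        then show ?thesis
          unfolding f_def pw[OF True] using True by (simp add: divide_inverse mult_ac)
      qed
      ultimately show ?thesis using True by simp
    qed (simp add: f_def)
    have "summable (\<lambda>n. cmod (complex_of_real x powr (s - 1)) * ((\<alpha> * h * x powr \<gamma>) ^ n /\<^sub>R fact n))"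
      by (intro summable_mult sums_summable[OF exp_converges])
    then show "summable (\<lambda>n. norm (f n x))"
    proof (rule summable_comparison_test')
      show "norm (norm (f n x)) \<le> cmod (complex_of_real x powr (s - 1)) * ((\<alpha> * h * x powr \<gamma>) ^ n /\<^sub>R fact n)" for n
      proof (cases "0 \<le> x")
        case True
        show ?thesis
          unfolding f_def pw[OF True] norm_scaleR norm_mult norm_of_real
          using True \<alpha> h by (simp add: power_abs abs_mult power_mult_distrib divide_inverse mult_ac)
      qed (use \<alpha> h in \<open>simp add: f_def\<close>)
    qed
  qed
  have nint: "(\<integral>x. norm (f n x) \<partial>\<mu> t) \<le> M * ((\<alpha> * h * L powr \<gamma>) ^ n /\<^sub>R fact n)" for n
  proof -
    have "(\<integral>x. norm (f n x) \<partial>\<mu> t) = (LINT x:{0..}|\<mu> t. (\<alpha> * h) ^ n / fact n * x powr (Re s + real n * \<gamma> - 1))"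
      unfolding set_lebesgue_integral_def using \<alpha> h
      by (intro Bochner_Integration.integral_cong)
        (auto simp: f_def norm_mult norm_divide norm_power cmod_cpowr indicator_def abs_mult)
    also have "\<dots> = (\<alpha> * h) ^ n / fact n * (LINT x:{0..}|\<mu> t. x powr (Re s + real n * \<gamma> - 1))"
      by (rule set_integral_mult_right)
    also have "\<dots> \<le> (\<alpha> * h) ^ n / fact n * ((L powr \<gamma>) ^ n * M)"
      using shifted_moment_le[OF s t, of "real n * \<gamma>"] \<alpha> \<gamma> h
      by (intro mult_left_mono) (auto simp: M_def power_mult_powr[OF L])
    finally show ?thesis by (simp add: power_mult_distrib divide_inverse mult_ac)
  qed
  have "summable (\<lambda>n. \<integral>x. norm (f n x) \<partial>\<mu> t)"
  proof (rule summable_comparison_test')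
    show "summable (\<lambda>n. M * ((\<alpha> * h * L powr \<gamma>) ^ n /\<^sub>R fact n))"
      by (intro summable_mult sums_summable[OF exp_converges])
    show "norm (\<integral>x. norm (f n x) \<partial>\<mu> t) \<le> M * ((\<alpha> * h * L powr \<gamma>) ^ n /\<^sub>R fact n)" for n
      using nint[of n] integral_nonneg_AE[where M="\<mu> t" and f="\<lambda>x. norm (f n x)"] by simp
  qed
  from sums_integral[OF int AE_I2[OF nsum] this]
  have "(\<lambda>n. ?c n * U t (s + complex_of_real (real n * \<gamma>))) sums (\<integral>x. (\<Sum>n. f n x) \<partial>\<mu> t)"
    by (simp only: U)
  also have "(\<integral>x. (\<Sum>n. f n x) \<partial>\<mu> t) = W_transform \<alpha> \<gamma> \<mu> t h s"
    unfolding W_transform_def set_lebesgue_integral_def sums_unique[OF sums, symmetric] ..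
  finally show ?thesis .
qed

lemma numerator_sums:
  assumes s: "0 < Re s" and t: "0 \<le> t" and h: "0 \<le> h"
    and B: "\<And>j. cmod (K (s + complex_of_real (real j * \<gamma>))) \<le> B"
  shows "(\<lambda>n. complex_of_real ((\<alpha> * h) ^ n / fact n) * (loss_gain_product s n - (- 1) ^ n) * U t (s + complex_of_real (real n * \<gamma>)))
    sums (U (t + h) s - W_transform \<alpha> \<gamma> \<mu> t h s)"
proof -
  have "complex_of_real ((- (\<alpha> * h)) ^ n / fact n) = complex_of_real ((\<alpha> * h) ^ n / fact n) * (- 1) ^ n" for n
    by (simp add: power_minus[of "\<alpha> * h"] power_minus[of "complex_of_real \<alpha> * complex_of_real h"])
  then show ?thesis
    using sums_diff[OF transform_Taylor_sums[OF s t h B] W_transform_sums[OF s t h]]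
    by (simp only: left_diff_distrib right_diff_distrib)
qed

text \<open>The terms of order \<open>0\<close> and \<open>1\<close> in \<open>h\<close> of the numerator are \<open>0\<close> and \<open>\<alpha> h K(s) U(t,s+\<gamma>)\<close>, so the
error is the tail from \<open>n = 2\<close>. In each remaining term the factor \<open>n\<close> from \<open>prod_minus_one_bounds\<close> is
absorbed by \<open>n!\<close>. The bound \<open>B\<close> is kept as a factor and replaced by \<open>B\<^sub>0\<close> only inside the exponential, so that
\<open>B = O(1/|s|)\<close> can be inserted later.\<close>

lemma R_error_bound:
  assumes s: "0 < Re s" and t: "0 \<le> t" and h: "0 < h"
    and B: "\<And>j. cmod (K (s + complex_of_real (real j * \<gamma>))) \<le> B" and B0: "B \<le> B\<^sub>0"
    and U1: "U t (s + complex_of_real \<gamma>) \<noteq> 0"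
    and Q: "\<And>n. cmod (U t (s + complex_of_real (real (Suc n) * \<gamma>))) \<le> Q * (L powr \<gamma>) ^ n * cmod (U t (s + complex_of_real \<gamma>))"
  shows "cmod (R_error \<alpha> \<gamma> \<kappa> \<mu> s t h)
    \<le> \<alpha> * h * B * (Q * (1 + B\<^sub>0)\<^sup>2 * L powr \<gamma> * exp (\<alpha> * h * (1 + B\<^sub>0) * L powr \<gamma>))"
proof -
  define c where "c n = complex_of_real ((\<alpha> * h) ^ n / fact n) * (loss_gain_product s n - (- 1) ^ n) * U t (s + complex_of_real (real n * \<gamma>))" for n
  define u where "u = cmod (U t (s + complex_of_real \<gamma>))"
  define N where "N = U (t + h) s - W_transform \<alpha> \<gamma> \<mu> t h s"
  define X where "X = \<alpha> * h * (1 + B\<^sub>0) * L powr \<gamma>"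
  define G where "G = (\<alpha> * h)\<^sup>2 * B * Q * (1 + B\<^sub>0)\<^sup>2 * L powr \<gamma> * u"
  have ah: "0 < \<alpha> * h" using \<alpha> h by simp
  have Bn: "0 \<le> B" using B[of 0] norm_ge_zero order_trans by blast
  have u: "0 < u" using U1 by (simp add: u_def)
  have "0 \<le> Q * (L powr \<gamma>) ^ 0 * u" unfolding u_def by (rule order_trans[OF norm_ge_zero Q])
  then have Q0: "0 \<le> Q" using u by (simp add: zero_le_mult_iff)
  have "c sums N"
    unfolding c_def N_def by (rule numerator_sums[OF s t less_imp_le[OF h] B])
  then have "(\<lambda>n. c (n + 2)) sums (N - (\<Sum>i<2. c i))" by (rule sums_split_initial_segment)
  moreover have "(\<Sum>i<2. c i) = complex_of_real (\<alpha> * h) * K s * U t (s + complex_of_real \<gamma>)"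
    by (simp add: c_def loss_gain_product_def numeral_2_eq_2)
  ultimately have tail: "(\<lambda>n. c (n + 2)) sums (N - complex_of_real (\<alpha> * h) * K s * U t (s + complex_of_real \<gamma>))"
    by simp
  have cle: "cmod (c (n + 2)) \<le> G * (X ^ n /\<^sub>R fact n)" for n
  proof -
    have Pn: "cmod (loss_gain_product s (n + 2) - (- 1) ^ (n + 2)) \<le> real (n + 2) * B * (1 + B\<^sub>0) ^ (n + 2)"
    proof -
      have "cmod (loss_gain_product s (n + 2) - (- 1) ^ (n + 2)) \<le> real (n + 2) * B * (1 + B) ^ (n + 2)"
        unfolding loss_gain_product_def by (rule prod_minus_one_bounds(2)) (rule B)
      also have "\<dots> \<le> real (n + 2) * B * (1 + B\<^sub>0) ^ (n + 2)"
        using B0 Bn by (intro mult_left_mono power_mono) auto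
      finally show ?thesis .
    qed
    have Un: "cmod (U t (s + complex_of_real (real (n + 2) * \<gamma>))) \<le> Q * (L powr \<gamma>) ^ (n + 1) * u"
      using Q[of "n + 1"] by (simp add: u_def)
    have "cmod (c (n + 2)) = (\<alpha> * h) ^ (n + 2) / fact (n + 2) * cmod (loss_gain_product s (n + 2) - (- 1) ^ (n + 2))
        * cmod (U t (s + complex_of_real (real (n + 2) * \<gamma>)))"
      unfolding c_def norm_mult norm_of_real using ah by simp
    also have "\<dots> \<le> (\<alpha> * h) ^ (n + 2) / fact (n + 2) * (real (n + 2) * B * (1 + B\<^sub>0) ^ (n + 2))
        * (Q * (L powr \<gamma>) ^ (n + 1) * u)"
      using \<alpha> h Bn B0 by (intro mult_mono mult_left_mono Pn Un) (auto intro!: divide_nonneg_nonneg mult_nonneg_nonneg)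
    also have "\<dots> = real (n + 2) / fact (n + 2) * (G * X ^ n)"
      by (simp add: G_def X_def power_add power_mult_distrib power2_eq_square)
    also have "real (n + 2) / fact (n + 2) = 1 / fact (n + 1)"
      using fact_Suc[of "n + 1", where ?'a=real] by (simp del: of_nat_Suc)
    also have "1 / fact (n + 1) * (G * X ^ n) \<le> 1 / fact n * (G * X ^ n)"
    proof (rule mult_right_mono)
      show "1 / fact (n + 1) \<le> (1::real) / fact n"
        by (intro divide_left_mono fact_mono) auto
      show "0 \<le> G * X ^ n"
        using ah Bn B0 Q0 u by (auto simp: G_def X_def intro!: mult_nonneg_nonneg)
    qed
    finally show ?thesis by (simp add: divide_inverse mult_ac)
  qed
  have "cmod (N - complex_of_real (\<alpha> * h) * K s * U t (s + complex_of_real \<gamma>)) \<le> G * exp X"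
    by (rule norm_sums_le[OF tail sums_mult[OF exp_converges] cle])
  moreover have "R_error \<alpha> \<gamma> \<kappa> \<mu> s t h
      = - (N - complex_of_real (\<alpha> * h) * K s * U t (s + complex_of_real \<gamma>)) / (complex_of_real (\<alpha> * h) * U t (s + complex_of_real \<gamma>))"
    unfolding R_error_def K_est_def N_def using \<alpha> h U1 by (simp add: field_simps)
  then have "cmod (R_error \<alpha> \<gamma> \<kappa> \<mu> s t h)
      = cmod (N - complex_of_real (\<alpha> * h) * K s * U t (s + complex_of_real \<gamma>)) / (\<alpha> * h * u)"
    unfolding u_def by (simp only: norm_divide norm_minus_cancel norm_mult[of "complex_of_real (\<alpha> * h)"] norm_of_real abs_of_pos[OF ah])
  ultimately have "cmod (R_error \<alpha> \<gamma> \<kappa> \<mu> s t h) \<le> G * exp X / (\<alpha> * h * u)"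
    using ah u by (simp add: divide_right_mono)
  also have "\<dots> = \<alpha> * h * B * (Q * (1 + B\<^sub>0)\<^sup>2 * L powr \<gamma> * exp X)"
    using ah u by (simp add: G_def power2_eq_square)
  finally show ?thesis by (simp add: X_def)
qed

end

section \<open>Asymptotics of the Mellin transform for large arguments\<close>

locale fragmentation_flow_decay = fragmentation_flow +
  fixes C\<^sub>K :: real
  assumes C\<^sub>K: "0 < C\<^sub>K"
    and K_decay: "\<And>s. 0 < Re s \<Longrightarrow> cmod (K_transform \<kappa> s) \<le> C\<^sub>K / cmod s"
begin

lemma K_shift_le:
  assumes s: "0 < Re s"
  shows "cmod (K (s + complex_of_real (real j * \<gamma>))) \<le> C\<^sub>K / cmod s"
proof -
  have j: "0 \<le> real j * \<gamma>" using \<gamma> by simp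
  have "cmod (K (s + complex_of_real (real j * \<gamma>))) \<le> C\<^sub>K / cmod (s + complex_of_real (real j * \<gamma>))"
    using s j by (intro K_decay) simp
  also have "\<dots> \<le> C\<^sub>K / cmod s"
    using s j C\<^sub>K cmod_le_cmod_add_of_real[of s "real j * \<gamma>"] by (intro divide_left_mono mult_pos_pos) (auto simp: complex_eq_iff)
  finally show ?thesis .
qed

text \<open>In the series at \<open>t = 0\<close>, each term is compared with the one obtained by replacing \<open>P\<^sub>n(s)\<close>
by \<open>(-1)\<^sup>n\<close>, the initial transform by its leading term, and \<open>s + n\<gamma>\<close> by \<open>s\<close> in the denominator. The simplified terms sum to
\<open>exp(-\<alpha> t L\<^sup>\<gamma>) c L\<^sup>s/s\<^sup>p\<close>. Each replacement costs a factor \<open>1/|s|\<close> and at most a geometric factor in \<open>n\<close>, which the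
factorial absorbs.\<close>

lemma transform_asymptotics:
  fixes c :: complex and p :: nat
  assumes c: "c \<noteq> 0" and T: "0 \<le> T"
    and E: "\<And>s. 0 < Re s \<Longrightarrow> cmod (U 0 s - c * complex_of_real L powr s / s ^ p) \<le> C\<^sub>E * L powr Re s / cmod s ^ (p + 1)"
  obtains V a b where "0 < V" "0 < a" "0 < b" "C\<^sub>K \<le> V"
    and "\<And>t s. t \<in> {0..T} \<Longrightarrow> 0 < Re s \<Longrightarrow> V \<le> cmod s \<Longrightarrow> a * L powr Re s / cmod s ^ p \<le> cmod (U t s)"
    and "\<And>t s. t \<in> {0..T} \<Longrightarrow> 0 < Re s \<Longrightarrow> V \<le> cmod s \<Longrightarrow> cmod (U t s) \<le> b * L powr Re s / cmod s ^ p"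
proof -
  define l where "l = L powr \<gamma>"
  have l: "0 < l" using L by (simp add: l_def)
  have "0 \<le> C\<^sub>E * L powr Re 1 / cmod 1 ^ (p + 1)" by (rule order_trans[OF norm_ge_zero E]) simp
  then have CE: "0 \<le> C\<^sub>E" using L by (simp add: zero_le_mult_iff)
  define C1 where "C1 = C\<^sub>E + cmod c * real p * \<gamma> + cmod c * C\<^sub>K"
  have C1: "0 \<le> C1" using CE \<gamma> C\<^sub>K by (simp add: C1_def)
  define C2 where "C2 = C1 * exp (\<alpha> * T * (4 * l))"
  have C2: "0 \<le> C2" using C1 by (simp add: C2_def)
  have main: "cmod (U t s - complex_of_real (exp (- (\<alpha> * t * l))) * (c * complex_of_real L powr s / s ^ p))
      \<le> C2 * L powr Re s / cmod s ^ (p + 1)"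
    if t: "t \<in> {0..T}" and s: "0 < Re s" and V1: "1 \<le> cmod s" and VK: "C\<^sub>K \<le> cmod s" for t s
  proof -
    have t0: "0 \<le> t" using t by simp
    have s0: "0 < cmod s" using s by auto
    let ?m = "c * complex_of_real L powr s / s ^ p" and ?w = "\<lambda>n. s + complex_of_real (real n * \<gamma>)"
    let ?g = "L powr Re s / cmod s ^ (p + 1)"
    have w: "cmod s \<le> cmod (?w n)" "0 < Re (?w n)" for n
      using s \<gamma> cmod_le_cmod_add_of_real[of s "real n * \<gamma>"] by (simp_all add: add_pos_nonneg)
    have B: "cmod (K (?w j)) \<le> C\<^sub>K / cmod s" for j by (rule K_shift_le[OF s])
    have B1: "C\<^sub>K / cmod s \<le> 1" using VK s0 by (simp add: divide_le_eq)
    have S1: "(\<lambda>n. complex_of_real ((\<alpha> * t) ^ n / fact n) * loss_gain_product s n * U 0 (?w n)) sums U t s"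
      using transform_Taylor_sums[OF s order_refl t0 B] by simp
    have S2: "(\<lambda>n. complex_of_real ((- (\<alpha> * t * l)) ^ n /\<^sub>R fact n) * ?m) sums (complex_of_real (exp (- (\<alpha> * t * l))) * ?m)"
      by (intro sums_mult2 sums_of_real exp_converges)
    have coeff: "cmod (complex_of_real ((\<alpha> * t) ^ n / fact n) * loss_gain_product s n * U 0 (?w n)
        - complex_of_real ((- (\<alpha> * t * l)) ^ n /\<^sub>R fact n) * ?m) \<le> (C1 * ?g) * ((\<alpha> * t * (4 * l)) ^ n /\<^sub>R fact n)" for n
    proof -
      have Pn: "cmod (loss_gain_product s n) \<le> 2 ^ n"
      proof -
        have "cmod (loss_gain_product s n) \<le> (1 + C\<^sub>K / cmod s) ^ n" unfolding loss_gain_product_def by (rule prod_minus_one_bounds(1)) (rule B)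
        also have "\<dots> \<le> 2 ^ n" using B1 C\<^sub>K s0 by (intro power_mono) auto
        finally show ?thesis .
      qed
      have Pn1: "cmod (loss_gain_product s n - (- 1) ^ n) \<le> real n * (C\<^sub>K / cmod s) * 2 ^ n"
      proof -
        have "cmod (loss_gain_product s n - (- 1) ^ n) \<le> real n * (C\<^sub>K / cmod s) * (1 + C\<^sub>K / cmod s) ^ n"
          unfolding loss_gain_product_def by (rule prod_minus_one_bounds(2)) (rule B)
        also have "\<dots> \<le> real n * (C\<^sub>K / cmod s) * 2 ^ n" using B1 C\<^sub>K s0 by (intro mult_left_mono power_mono) auto
        finally show ?thesis .
      qed
      have Lw: "complex_of_real L powr ?w n = complex_of_real L powr s * complex_of_real (l ^ n)"
      proof -
        have "complex_of_real L powr complex_of_real (real n * \<gamma>) = complex_of_real (l ^ n)"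
          using powr_of_real[of L "real n * \<gamma>"] L power_mult_powr[OF L, of n \<gamma>] by (simp add: l_def)
        then show ?thesis by (simp only: powr_add)
      qed
      have Lr: "L powr Re (?w n) = L powr Re s * l ^ n"
        using power_mult_powr[OF L, of n \<gamma>] by (simp add: powr_add l_def)
      have T1: "cmod (loss_gain_product s n * (U 0 (?w n) - c * complex_of_real L powr ?w n / ?w n ^ p)) \<le> 2 ^ n * (C\<^sub>E * ?g * l ^ n)"
      proof -
        have "C\<^sub>E * L powr Re (?w n) / cmod (?w n) ^ (p + 1) \<le> C\<^sub>E * L powr Re (?w n) / cmod s ^ (p + 1)"
          using CE by (intro divide_left_mono power_mono mult_pos_pos zero_less_power less_le_trans[OF s0 w(1)] s0 w(1)) auto
        from order_trans[OF E[OF w(2)] this]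
        have "cmod (U 0 (?w n) - c * complex_of_real L powr ?w n / ?w n ^ p) \<le> C\<^sub>E * (L powr Re s * l ^ n) / cmod s ^ (p + 1)"
          unfolding Lr .
        then have "cmod (U 0 (?w n) - c * complex_of_real L powr ?w n / ?w n ^ p) \<le> C\<^sub>E * ?g * l ^ n"
          by (simp only: times_divide_eq_right times_divide_eq_left mult.assoc)
        then show ?thesis unfolding norm_mult using Pn by (intro mult_mono) auto
      qed
      have T2: "cmod (loss_gain_product s n * (c * complex_of_real L powr ?w n * (1 / ?w n ^ p - 1 / s ^ p)))
          \<le> 2 ^ n * (cmod c * (L powr Re s * l ^ n) * (real p * (real n * \<gamma>) / cmod s ^ (p + 1)))"
      proof -
        have "cmod (complex_of_real L powr ?w n) = L powr Re s * l ^ n"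
          using cmod_cpowr[of L "?w n"] L Lr by simp
        then show ?thesis
          unfolding norm_mult using L l \<gamma> s
          by (intro mult_mono Pn cmod_inverse_power_diff_le) auto
      qed
      have T3: "cmod ((loss_gain_product s n - (- 1) ^ n) * (complex_of_real (l ^ n) * ?m)) \<le> real n * (C\<^sub>K / cmod s) * 2 ^ n * (l ^ n * (cmod c * L powr Re s / cmod s ^ p))"
        unfolding norm_mult[of "loss_gain_product s n - (- 1) ^ n"] using L l C\<^sub>K
        by (intro mult_mono Pn1) (auto simp: norm_mult norm_divide norm_power cmod_cpowr)
      \<comment> \<open>The three replacements: initial transform, denominator, product.\<close>
      have split: "loss_gain_product s n * U 0 (?w n) - (- 1) ^ n * complex_of_real (l ^ n) * ?m
          = loss_gain_product s n * (U 0 (?w n) - c * complex_of_real L powr ?w n / ?w n ^ p)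
          + loss_gain_product s n * (c * complex_of_real L powr ?w n * (1 / ?w n ^ p - 1 / s ^ p))
          + (loss_gain_product s n - (- 1) ^ n) * (complex_of_real (l ^ n) * ?m)"
        unfolding Lw by (simp add: algebra_simps diff_divide_distrib)
      have "cmod (loss_gain_product s n * U 0 (?w n) - (- 1) ^ n * complex_of_real (l ^ n) * ?m)
          \<le> 2 ^ n * (C\<^sub>E * ?g * l ^ n) + 2 ^ n * (cmod c * (L powr Re s * l ^ n) * (real p * (real n * \<gamma>) / cmod s ^ (p + 1)))
            + real n * (C\<^sub>K / cmod s) * 2 ^ n * (l ^ n * (cmod c * L powr Re s / cmod s ^ p))"
        unfolding split by (intro order_trans[OF norm_triangle_ineq] add_mono T1 T2 T3)
      also have "\<dots> = ?g * l ^ n * 2 ^ n * (C\<^sub>E + real n * (cmod c * real p * \<gamma> + cmod c * C\<^sub>K))"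
        using s0 by (simp add: field_simps)
      also have "\<dots> \<le> ?g * l ^ n * 2 ^ n * (2 ^ n * C1)"
      proof (rule mult_left_mono)
        have "C\<^sub>E \<le> 2 ^ n * C\<^sub>E" using CE by (simp add: mult_le_cancel_right1)
        moreover have "real n \<le> 2 ^ n" using of_nat_mono[OF less_imp_le[OF less_exp[of n]], where ?'a=real] by simp
        then have "real n * (cmod c * real p * \<gamma> + cmod c * C\<^sub>K) \<le> 2 ^ n * (cmod c * real p * \<gamma> + cmod c * C\<^sub>K)"
          using \<gamma> C\<^sub>K by (intro mult_right_mono) auto
        ultimately show "C\<^sub>E + real n * (cmod c * real p * \<gamma> + cmod c * C\<^sub>K) \<le> 2 ^ n * C1"
          unfolding C1_def by (simp add: algebra_simps)
        show "0 \<le> ?g * l ^ n * 2 ^ n" using l by simp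
      qed
      also have "\<dots> = C1 * ?g * (4 * l) ^ n"
      proof -
        have "(2::real) ^ n * 2 ^ n = 4 ^ n" by (simp flip: power_mult_distrib)
        then show ?thesis by (simp add: power_mult_distrib mult_ac)
      qed
      finally have A: "cmod (loss_gain_product s n * U 0 (?w n) - (- 1) ^ n * complex_of_real (l ^ n) * ?m) \<le> C1 * ?g * (4 * l) ^ n" .
      have "complex_of_real ((- (\<alpha> * t * l)) ^ n /\<^sub>R fact n) = complex_of_real ((\<alpha> * t) ^ n / fact n) * ((- 1) ^ n * complex_of_real (l ^ n))"
        by (simp add: power_minus[of "\<alpha> * t * l"] power_minus[of "complex_of_real \<alpha> * complex_of_real t * complex_of_real l"] power_mult_distrib divide_inverse)
      then have "complex_of_real ((\<alpha> * t) ^ n / fact n) * loss_gain_product s n * U 0 (?w n) - complex_of_real ((- (\<alpha> * t * l)) ^ n /\<^sub>R fact n) * ?m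
          = complex_of_real ((\<alpha> * t) ^ n / fact n) * (loss_gain_product s n * U 0 (?w n) - (- 1) ^ n * complex_of_real (l ^ n) * ?m)"
        by (simp only: right_diff_distrib mult.assoc)
      also have "cmod \<dots> = (\<alpha> * t) ^ n / fact n * cmod (loss_gain_product s n * U 0 (?w n) - (- 1) ^ n * complex_of_real (l ^ n) * ?m)"
        unfolding norm_mult[of "complex_of_real _"] norm_of_real using \<alpha> t0 by simp
      also have "\<dots> \<le> (\<alpha> * t) ^ n / fact n * (C1 * ?g * (4 * l) ^ n)"
        using A \<alpha> t0 by (intro mult_left_mono) auto
      finally show ?thesis by (simp add: power_mult_distrib divide_inverse mult_ac)
    qed
    have "cmod (U t s - complex_of_real (exp (- (\<alpha> * t * l))) * ?m) \<le> (C1 * ?g) * exp (\<alpha> * t * (4 * l))"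
      by (rule norm_sums_le[OF sums_diff[OF S1 S2] sums_mult[OF exp_converges] coeff])
    also have "\<dots> \<le> (C1 * ?g) * exp (\<alpha> * T * (4 * l))"
      using C1 \<alpha> l t by (intro mult_left_mono) auto
    finally show ?thesis by (simp add: C2_def mult_ac)
  qed
  define e where "e = exp (- (\<alpha> * T * l))"
  \<comment> \<open>The third entry makes the error at most half of the main term; the second makes \<open>|K(s+j\<gamma>)| \<le> 1\<close>.\<close>
  define V where "V = Max {1, C\<^sub>K, 2 * C2 / (cmod c * e)}"
  have V: "1 \<le> V" "C\<^sub>K \<le> V" "2 * C2 / (cmod c * e) \<le> V" by (auto simp: V_def)
  have e0: "0 < e" by (simp add: e_def)
  have c0: "0 < cmod c" using c by simp
  show ?thesis
  proof (rule that[of V "cmod c * e / 2" "cmod c + C2"])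
    show "0 < V" using V by simp
    show "0 < cmod c * e / 2" using c0 e0 by simp
    show "0 < cmod c + C2" using c0 C2 by (rule add_pos_nonneg)
    show "C\<^sub>K \<le> V" by (rule V)
    fix t s assume t: "t \<in> {0..T}" and s: "0 < Re s" and Vs: "V \<le> cmod s"
    have s0: "0 < cmod s" using s by auto
    define g where "g = L powr Re s / cmod s ^ p"
    have g0: "0 \<le> g" by (simp add: g_def)
    let ?m = "complex_of_real (exp (- (\<alpha> * t * l))) * (c * complex_of_real L powr s / s ^ p)"
    have m: "cmod ?m = exp (- (\<alpha> * t * l)) * (cmod c * g)"
      using L by (simp add: g_def norm_mult norm_divide norm_power cmod_cpowr)
    have dist: "cmod (U t s - ?m) \<le> C2 / cmod s * g"
      using main[OF t s] V Vs by (simp add: g_def mult_ac)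
    have et: "e \<le> exp (- (\<alpha> * t * l))" "exp (- (\<alpha> * t * l)) \<le> 1"
      unfolding e_def using t \<alpha> l by (auto intro!: mult_right_mono mult_left_mono)
    have "C2 / cmod s \<le> cmod c * e / 2"
    proof -
      have "2 * C2 / (cmod c * e) \<le> cmod s" using V(3) Vs by simp
      then show ?thesis using c0 e0 s0 by (simp add: field_simps)
    qed
    then have d1: "C2 / cmod s * g \<le> cmod c * e / 2 * g" using g0 by (intro mult_right_mono)
    have d2: "C2 / cmod s * g \<le> C2 * g"
      using g0 C2 V(1) Vs by (intro mult_right_mono) (auto simp: divide_le_eq mult_le_cancel_left1)
    have "e * (cmod c * g) \<le> cmod ?m" unfolding m using et(1) g0 by (intro mult_right_mono) auto
    moreover have "cmod ?m - cmod (U t s) \<le> cmod (U t s - ?m)"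
      using norm_triangle_ineq2[of ?m "U t s"] by (simp add: norm_minus_commute)
    moreover have "e * (cmod c * g) = cmod c * e / 2 * g + cmod c * e / 2 * g" by simp
    ultimately have "cmod c * e / 2 * g \<le> cmod (U t s)" using dist d1 by linarith
    then show "cmod c * e / 2 * L powr Re s / cmod s ^ p \<le> cmod (U t s)" by (simp add: g_def)
    have "cmod ?m \<le> 1 * (cmod c * g)" unfolding m using et(2) g0 by (intro mult_right_mono) auto
    moreover have "cmod (U t s) - cmod ?m \<le> cmod (U t s - ?m)" by (rule norm_triangle_ineq2)
    ultimately have "cmod (U t s) \<le> (cmod c + C2) * g" using dist d2 by (simp add: algebra_simps)
    then show "cmod (U t s) \<le> (cmod c + C2) * L powr Re s / cmod s ^ p" by (simp add: g_def)
  qed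
qed

lemma transform_ratio_bound:
  fixes p :: nat
  assumes s: "0 < Re s" and ab: "0 < a" "0 < b"
    and V: "V \<le> cmod s"
    and lower: "\<And>s. 0 < Re s \<Longrightarrow> V \<le> cmod s \<Longrightarrow> a * L powr Re s / cmod s ^ p \<le> cmod (U t s)"
    and upper: "\<And>s. 0 < Re s \<Longrightarrow> V \<le> cmod s \<Longrightarrow> cmod (U t s) \<le> b * L powr Re s / cmod s ^ p"
  shows "U t (s + complex_of_real \<gamma>) \<noteq> 0"
    and "cmod (U t (s + complex_of_real (real (Suc n) * \<gamma>))) \<le> b / a * (L powr \<gamma>) ^ n * cmod (U t (s + complex_of_real \<gamma>))"
proof -
  let ?v = "s + complex_of_real \<gamma>" and ?w = "s + complex_of_real (real (Suc n) * \<gamma>)"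
  have w: "?w = ?v + complex_of_real (real n * \<gamma>)" by (simp add: algebra_simps)
  have v: "0 < Re ?v" "V \<le> cmod ?v"
    using s \<gamma> V cmod_le_cmod_add_of_real[of s \<gamma>] by simp_all
  have vw: "cmod ?v \<le> cmod ?w"
    unfolding w by (rule cmod_le_cmod_add_of_real) (use v \<gamma> in simp_all)
  have w': "0 < Re ?w" "V \<le> cmod ?w" using s \<gamma> vw v by (simp_all add: add_pos_nonneg)
  have "?v \<noteq> 0" using v(1) by (metis less_irrefl zero_complex.sel(1))
  then have v0: "0 < cmod ?v" by simp
  have "0 < a * L powr Re ?v / cmod ?v ^ p" using ab L v0 by simp
  then show "U t ?v \<noteq> 0" using lower[OF v] by auto
  have Lw: "L powr Re ?w = L powr Re ?v * (L powr \<gamma>) ^ n"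
    unfolding w using power_mult_powr[OF L, of n \<gamma>] by (simp add: powr_add)
  have "cmod (U t ?w) \<le> b * L powr Re ?w / cmod ?w ^ p" by (rule upper[OF w'])
  also have "\<dots> \<le> b * L powr Re ?w / cmod ?v ^ p"
    using ab by (intro divide_left_mono power_mono mult_pos_pos zero_less_power less_le_trans[OF v0 vw] v0 vw) auto
  also have "\<dots> = b / a * (L powr \<gamma>) ^ n * (a * L powr Re ?v / cmod ?v ^ p)"
    unfolding Lw using ab by simp
  also have "\<dots> \<le> b / a * (L powr \<gamma>) ^ n * cmod (U t ?v)"
    using ab by (intro mult_left_mono lower[OF v]) auto
  finally show "cmod (U t ?w) \<le> b / a * (L powr \<gamma>) ^ n * cmod (U t ?v)" .
qed

lemma transform_of_real:
  "U t (complex_of_real \<sigma>) = complex_of_real (LINT x:{0..}|\<mu> t. x powr (\<sigma> - 1))"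
proof -
  have "U t (complex_of_real \<sigma>) = (LINT x:{0..}|\<mu> t. complex_of_real (x powr (\<sigma> - 1)))"
    unfolding U_transform_def mellin_def set_lebesgue_integral_def
    using powr_of_real[of _ "\<sigma> - 1"] by (intro Bochner_Integration.integral_cong) (auto simp: indicator_def)
  then show ?thesis by (simp only: set_integral_complex_of_real)
qed

text \<open>For real exponents the integrand is non-negative, so \<open>x \<le> L\<close> on the support gives the ratio bound
without any asymptotics.\<close>

lemma real_transform_ratio_bound:
  assumes \<sigma>: "0 < \<sigma>" and t: "0 \<le> t"
  shows "cmod (U t (complex_of_real \<sigma> + complex_of_real (real n * \<gamma>))) \<le> (L powr \<gamma>) ^ n * cmod (U t (complex_of_real \<sigma>))"
proof -
  have "0 \<le> (LINT x:{0..}|\<mu> t. x powr (\<sigma> - 1))"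
    unfolding set_lebesgue_integral_def by (intro integral_nonneg_AE) auto
  then have "cmod (U t (complex_of_real \<sigma>)) = (LINT x:{0..}|\<mu> t. x powr (\<sigma> - 1))"
    by (simp only: transform_of_real norm_of_real abs_of_nonneg)
  then show ?thesis
    using cmod_shifted_transform_le[of "complex_of_real \<sigma>" t n] \<sigma> t by simp
qed

text \<open>A zero at one real exponent propagates to all its shifts by \<open>n\<gamma>\<close>, since \<open>x \<le> L\<close>; but far enough to the right
the transform does not vanish.\<close>

lemma real_transform_nonzero:
  assumes \<sigma>: "0 < \<sigma>" and t: "0 \<le> t"
    and large: "\<And>s. 0 < Re s \<Longrightarrow> V \<le> cmod s \<Longrightarrow> U t s \<noteq> 0"
  shows "U t (complex_of_real \<sigma>) \<noteq> 0"
proof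
  assume zero: "U t (complex_of_real \<sigma>) = 0"
  \<comment> \<open>A shift that brings the argument into the range where the transform is known not to vanish.\<close>
  obtain n :: nat where n: "V / \<gamma> < real n" using reals_Archimedean2 by blast
  let ?w = "complex_of_real \<sigma> + complex_of_real (real n * \<gamma>)"
  have "V < real n * \<gamma>" using n \<gamma> by (simp add: divide_less_eq)
  moreover have "Re ?w \<le> cmod ?w" by (rule complex_Re_le_cmod)
  ultimately have "U t ?w \<noteq> 0" using \<sigma> \<gamma> by (intro large) (auto simp: add_pos_nonneg)
  then show False using real_transform_ratio_bound[OF \<sigma> t, of n] zero by simp
qed

section \<open>The error estimates\<close>

text \<open>The first estimate uses \<open>R_error_bound\<close> with \<open>B = C\<^sub>K/|s|\<close> and \<open>B\<^sub>0 = 1\<close>. On the real axis \<open>|s|\<close> need not be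
large, and the second takes \<open>B = B\<^sub>0 = C\<^sub>K\<close>.\<close>

lemma R_error_estimates:
  fixes c :: complex and p :: nat
  assumes c: "c \<noteq> 0" and T: "0 < T"
    and E: "\<And>s. 0 < Re s \<Longrightarrow> cmod (U 0 s - c * complex_of_real L powr s / s ^ p) \<le> C\<^sub>E * L powr Re s / cmod s ^ (p + 1)"
  shows "\<exists>V\<^sub>0>0. \<exists>C>0. \<forall>t\<in>{0<..<T}. \<forall>h\<in>{0<..<\<tau>\<^sub>0}. \<forall>s. 0 < Re s \<and> V\<^sub>0 \<le> cmod s \<longrightarrow>
            cmod (R_error \<alpha> \<gamma> \<kappa> \<mu> s t h) \<le> C * \<alpha> * h / cmod s"
    and "\<exists>C>0. \<forall>t\<in>{0<..<T}. \<forall>h\<in>{0<..<\<tau>\<^sub>0}. \<forall>s::real. 1 \<le> s \<longrightarrow>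
            cmod (R_error \<alpha> \<gamma> \<kappa> \<mu> (complex_of_real s) t h) \<le> C * \<alpha> * h"
proof -
  define l where "l = L powr \<gamma>"
  have l: "0 < l" using L by (simp add: l_def)
  obtain V a b where V: "0 < V" and ab: "0 < a" "0 < b" and VK: "C\<^sub>K \<le> V"
    and lower: "\<And>t s. t \<in> {0..T} \<Longrightarrow> 0 < Re s \<Longrightarrow> V \<le> cmod s \<Longrightarrow> a * L powr Re s / cmod s ^ p \<le> cmod (U t s)"
    and upper: "\<And>t s. t \<in> {0..T} \<Longrightarrow> 0 < Re s \<Longrightarrow> V \<le> cmod s \<Longrightarrow> cmod (U t s) \<le> b * L powr Re s / cmod s ^ p"
    by (rule transform_asymptotics[OF c less_imp_le[OF T]]) (rule E, assumption, rule that)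
  have expmono: "exp (\<alpha> * h * (1 + B) * l) \<le> exp (\<alpha> * \<tau>\<^sub>0 * (1 + B) * l)" if "h \<in> {0<..<\<tau>\<^sub>0}" "0 \<le> B" for h B
    using that \<alpha> l by (auto intro!: mult_right_mono mult_left_mono)
  define C where "C = C\<^sub>K * (b / a * (1 + 1)\<^sup>2 * l * exp (\<alpha> * \<tau>\<^sub>0 * (1 + 1) * l))"
  have C: "0 < C" unfolding C_def using C\<^sub>K ab l by (intro mult_pos_pos divide_pos_pos) auto
  have "cmod (R_error \<alpha> \<gamma> \<kappa> \<mu> s t h) \<le> C * \<alpha> * h / cmod s"
    if t: "t \<in> {0<..<T}" and h: "h \<in> {0<..<\<tau>\<^sub>0}" and s: "0 < Re s" and Vs: "V \<le> cmod s" for t h s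
  proof -
    have t': "t \<in> {0..T}" "0 \<le> t" and h0: "0 < h" using t h by auto
    have s0: "0 < cmod s" using s by auto
    note ratio = transform_ratio_bound[OF s ab Vs lower[OF t'(1)] upper[OF t'(1)]]
    have "C\<^sub>K / cmod s \<le> 1" using VK Vs s0 by (simp add: divide_le_eq)
    from R_error_bound[OF s t'(2) h0 K_shift_le[OF s] this ratio, folded l_def]
    have "cmod (R_error \<alpha> \<gamma> \<kappa> \<mu> s t h) \<le> \<alpha> * h * (C\<^sub>K / cmod s) * (b / a * (1 + 1)\<^sup>2 * l * exp (\<alpha> * h * (1 + 1) * l))" .
    also have "\<dots> \<le> \<alpha> * h * (C\<^sub>K / cmod s) * (b / a * (1 + 1)\<^sup>2 * l * exp (\<alpha> * \<tau>\<^sub>0 * (1 + 1) * l))"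
      using \<alpha> h0 C\<^sub>K ab l h by (intro mult_left_mono expmono) auto
    also have "\<dots> = C * \<alpha> * h / cmod s" by (simp add: C_def mult_ac)
    finally show ?thesis .
  qed
  then show "\<exists>V\<^sub>0>0. \<exists>C>0. \<forall>t\<in>{0<..<T}. \<forall>h\<in>{0<..<\<tau>\<^sub>0}. \<forall>s. 0 < Re s \<and> V\<^sub>0 \<le> cmod s \<longrightarrow>
            cmod (R_error \<alpha> \<gamma> \<kappa> \<mu> s t h) \<le> C * \<alpha> * h / cmod s"
    using V C by blast
  define C' where "C' = C\<^sub>K * (1 * (1 + C\<^sub>K)\<^sup>2 * l * exp (\<alpha> * \<tau>\<^sub>0 * (1 + C\<^sub>K) * l))"
  have C': "0 < C'" unfolding C'_def using C\<^sub>K l by (intro mult_pos_pos) auto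
  have "cmod (R_error \<alpha> \<gamma> \<kappa> \<mu> (complex_of_real \<sigma>) t h) \<le> C' * \<alpha> * h"
    if t: "t \<in> {0<..<T}" and h: "h \<in> {0<..<\<tau>\<^sub>0}" and \<sigma>: "1 \<le> \<sigma>" for t h \<sigma>
  proof -
    let ?s = "complex_of_real \<sigma>"
    have t': "t \<in> {0..T}" "0 \<le> t" and h0: "0 < h" using t h by auto
    have s: "0 < Re ?s" using \<sigma> by simp
    have \<sigma>\<gamma>: "0 < \<sigma> + \<gamma>" using \<sigma> \<gamma> by simp
    have K: "cmod (K (?s + complex_of_real (real j * \<gamma>))) \<le> C\<^sub>K" for j
    proof -
      have "C\<^sub>K / \<sigma> \<le> C\<^sub>K / 1" using C\<^sub>K \<sigma> by (intro divide_left_mono) auto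
      then show ?thesis using K_shift_le[OF s, of j] \<sigma> by simp
    qed
    have "U t z \<noteq> 0" if "0 < Re z" "V \<le> cmod z" for z
    proof -
      have "0 < cmod z" using that(1) by auto
      then have "0 < a * L powr Re z / cmod z ^ p" using ab L by simp
      then show ?thesis using lower[OF t'(1) that] by auto
    qed
    from real_transform_nonzero[OF \<sigma>\<gamma> t'(2) this]
    have nz: "U t (?s + complex_of_real \<gamma>) \<noteq> 0" by simp
    have ratio: "cmod (U t (?s + complex_of_real (real (Suc n) * \<gamma>))) \<le> 1 * (L powr \<gamma>) ^ n * cmod (U t (?s + complex_of_real \<gamma>))" for n
    proof -
      have eq: "?s + complex_of_real (real (Suc n) * \<gamma>) = complex_of_real (\<sigma> + \<gamma>) + complex_of_real (real n * \<gamma>)"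
        by (simp add: algebra_simps)
      show ?thesis unfolding eq using real_transform_ratio_bound[OF \<sigma>\<gamma> t'(2), of n] by simp
    qed
    from R_error_bound[OF s t'(2) h0 K order_refl nz ratio, folded l_def]
    have "cmod (R_error \<alpha> \<gamma> \<kappa> \<mu> ?s t h) \<le> \<alpha> * h * C\<^sub>K * (1 * (1 + C\<^sub>K)\<^sup>2 * l * exp (\<alpha> * h * (1 + C\<^sub>K) * l))" .
    also have "\<dots> \<le> \<alpha> * h * C\<^sub>K * (1 * (1 + C\<^sub>K)\<^sup>2 * l * exp (\<alpha> * \<tau>\<^sub>0 * (1 + C\<^sub>K) * l))"
      using \<alpha> h0 C\<^sub>K l h by (intro mult_left_mono expmono) auto
    also have "\<dots> = C' * \<alpha> * h" by (simp add: C'_def)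
    finally show ?thesis .
  qed
  then show "\<exists>C>0. \<forall>t\<in>{0<..<T}. \<forall>h\<in>{0<..<\<tau>\<^sub>0}. \<forall>s::real. 1 \<le> s \<longrightarrow>
            cmod (R_error \<alpha> \<gamma> \<kappa> \<mu> (complex_of_real s) t h) \<le> C * \<alpha> * h"
    using C' by blast
qed

end

theorem theorem7:
  fixes \<alpha> \<gamma> L :: real
    and \<kappa> :: "real measure" and k :: "real \<Rightarrow> real" and I :: "real set"
    and u\<^sub>0 :: "real \<Rightarrow> real" and \<mu> :: "real \<Rightarrow> real measure"
  assumes "\<alpha> > 0" and "\<gamma> > 0" and "L > 0"
    and "fragmentation_kernel \<kappa>" and "kernel_density \<kappa> k"
    and "is_interval I" and "I \<noteq> {}" and "I \<subseteq> {0<..}"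
    and "abs_continuous_fun_on {0..1} k"
    and "\<forall>s \<in> S_strip I. abs_continuous_fun_on {0..1}
           (\<lambda>x. inverse s * complex_of_real x powr s * complex_of_real (k x))"
    and "\<forall>x. 0 \<le> u\<^sub>0 x" and "closure {x. u\<^sub>0 x \<noteq> 0} \<subseteq> {0..L}" and "Ck_on 3 u\<^sub>0 {0..L}"
    and "u\<^sub>0 L > 0 \<or>
         u\<^sub>0 L = 0 \<and> (\<exists>d<0. (u\<^sub>0 has_real_derivative d) (at L within {0..L}))"
    and "frag_solution \<alpha> \<gamma> \<kappa> \<mu>" and "\<mu> 0 = density lborel (\<lambda>x. ennreal (u\<^sub>0 x))"
  shows "(\<forall>T>0. \<forall>\<tau>\<^sub>0>0. \<exists>V\<^sub>0>0. \<forall>V\<ge>V\<^sub>0. \<exists>C>0.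
            \<forall>t \<in> {0<..<T}. \<forall>\<Delta>\<tau> \<in> {0<..<\<tau>\<^sub>0}. \<forall>s \<in> D_strip I V.
              cmod (R_error \<alpha> \<gamma> \<kappa> \<mu> s t \<Delta>\<tau>) \<le> C * \<alpha> * \<Delta>\<tau> / cmod s)
       \<and> (\<forall>T>0. \<forall>\<tau>\<^sub>0>0. \<forall>s::real. s > 1 \<longrightarrow> (\<exists>C>0.
            \<forall>t \<in> {0<..<T}. \<forall>\<Delta>\<tau> \<in> {0<..<\<tau>\<^sub>0}.
              cmod (R_error \<alpha> \<gamma> \<kappa> \<mu> (complex_of_real s) t \<Delta>\<tau>) \<le> C * \<alpha> * \<Delta>\<tau>))"
proof -
  note kd = \<open>kernel_density \<kappa> k\<close> and ac = \<open>abs_continuous_fun_on {0..1} k\<close>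
  obtain C\<^sub>K where CK: "C\<^sub>K > 0" "\<And>s. 0 < Re s \<Longrightarrow> cmod (K_transform \<kappa> s) \<le> C\<^sub>K / cmod s"
    using K_transform_decay[OF kd ac] by blast
  note Kd = K_transform_density[OF kd abs_continuous_imp_continuous_on[OF ac]]
  obtain D where "\<forall>x\<in>{0..L}. D 0 x = u\<^sub>0 x" "\<forall>j\<le>3. continuous_on {0..L} (D (j::nat))"
    using \<open>Ck_on 3 u\<^sub>0 {0..L}\<close> unfolding Ck_on_def by blast
  then have cont: "continuous_on {0..L} u\<^sub>0"
    by (metis (no_types, lifting) continuous_on_cong le0)
  have u0: "\<And>x. 0 \<le> u\<^sub>0 x" using \<open>\<forall>x. 0 \<le> u\<^sub>0 x\<close> by blast
  note init = initial_measure_density[OF u0 \<open>closure {x. u\<^sub>0 x \<noteq> 0} \<subseteq> {0..L}\<close> cont, folded \<open>\<mu> 0 = _\<close>]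
  interpret fragmentation_flow_decay \<alpha> \<gamma> L \<kappa> \<mu> C\<^sub>K
    by unfold_locales (use assms(1-4,15) CK Kd(1,2) init(1,2) in auto)
  obtain c :: complex and p :: nat and C\<^sub>E where c: "c \<noteq> 0"
    and "\<And>s. 0 < Re s \<Longrightarrow> cmod (integral {0..L} (\<lambda>x. complex_of_real x powr (s - 1) * complex_of_real (u\<^sub>0 x))
          - c * complex_of_real L powr s / s ^ p) \<le> C\<^sub>E * L powr Re s / cmod s ^ (p + 1)"
    using initial_transform_leading_term[OF assms(3,13,14)] by blast
  then have E: "\<And>s. 0 < Re s \<Longrightarrow> cmod (U 0 s - c * complex_of_real L powr s / s ^ p) \<le> C\<^sub>E * L powr Re s / cmod s ^ (p + 1)"
    by (simp add: U_transform_def init(3))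
  note est = R_error_estimates[OF c _ E]
  show ?thesis
  proof (intro conjI allI impI)
    fix T \<tau>\<^sub>0 :: real assume T: "0 < T" "0 < \<tau>\<^sub>0"
    obtain V\<^sub>0 C where V: "V\<^sub>0 > 0" and C: "C > 0" and bound: "\<And>t h s. t \<in> {0<..<T} \<Longrightarrow> h \<in> {0<..<\<tau>\<^sub>0} \<Longrightarrow>
        0 < Re s \<Longrightarrow> V\<^sub>0 \<le> cmod s \<Longrightarrow> cmod (R_error \<alpha> \<gamma> \<kappa> \<mu> s t h) \<le> C * \<alpha> * h / cmod s"
      using est(1)[OF T(1)] by blast
    show "\<exists>V\<^sub>0>0. \<forall>V\<ge>V\<^sub>0. \<exists>C>0. \<forall>t \<in> {0<..<T}. \<forall>\<Delta>\<tau> \<in> {0<..<\<tau>\<^sub>0}. \<forall>s \<in> D_strip I V.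
              cmod (R_error \<alpha> \<gamma> \<kappa> \<mu> s t \<Delta>\<tau>) \<le> C * \<alpha> * \<Delta>\<tau> / cmod s"
    proof (rule exI[of _ V\<^sub>0], intro conjI allI impI V, rule exI[of _ C], intro conjI ballI C)
      fix V t h s assume "V\<^sub>0 \<le> V" "t \<in> {0<..<T}" "h \<in> {0<..<\<tau>\<^sub>0}" "s \<in> D_strip I V"
      moreover from this have "0 < Re s" "V\<^sub>0 \<le> cmod s"
        using \<open>I \<subseteq> {0<..}\<close> abs_Im_le_cmod[of s] by (auto simp: D_strip_def)
      ultimately show "cmod (R_error \<alpha> \<gamma> \<kappa> \<mu> s t h) \<le> C * \<alpha> * h / cmod s"
        by (intro bound)
    qed
  next
    fix T \<tau>\<^sub>0 s :: real assume T: "0 < T" "0 < \<tau>\<^sub>0" and s: "1 < s"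
    show "\<exists>C>0. \<forall>t \<in> {0<..<T}. \<forall>\<Delta>\<tau> \<in> {0<..<\<tau>\<^sub>0}.
              cmod (R_error \<alpha> \<gamma> \<kappa> \<mu> (complex_of_real s) t \<Delta>\<tau>) \<le> C * \<alpha> * \<Delta>\<tau>"
      using est(2)[OF T(1)] less_imp_le[OF s] by blast
  qed
qed

end
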